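(* Let $N\ge1$, $0<\theta\le2$, and let $f\colon[0,\infty)\to[0,\infty)$ satisfy (M), (S), (C), (L) and be supercritical. Let $\varphi,\psi\colon[0,\infty)\to[0,\infty)$ be any nondecreasing functions satisfying $\varphi\asymp G$ (equivalently $\varphi\asymp f'$) and $\varphi\circ\psi\asymp\mathrm{id}$. Then there exists a unique $\lambda_0=\lambda_0(\psi)>0$ such that $\mu_c(x):=\psi(\lambda_0|x|^{-\theta})$, $x\in\mathbb{R}^N$, is a dilation-critical singularity for problem (SHE).
   Context: Problem (SHE) is $\partial_t u+(-\Delta)^{\theta/2}u=f(u)$ in $\mathbb{R}^N\times(0,\infty)$, $u(\cdot,0)=\mu$, with $\mu\ge0$ locally integrable. Let $\Gamma_\theta$ be the fundamental solution of $\partial_t u+(-\Delta)^{\theta/2}u=0$ on $\mathbb{R}^N\times(0,\infty)$. A solution of (SHE) in $Q_T=\mathbb{R}^N\times(0,T)$ is a nonnegative measurable a.e.-finite $u$ with $u(x,t)=\int\Gamma_\theta(x-y,t)\mu(y)\,dy+\int_0^t\int\Gamma_\theta(x-y,t-s)f(u(y,s))\,dy\,ds$ for a.a. $(x,t)\in Q_T$; (SHE) is locally solvable if such a solution exists for some $T>0$. (M) $f$ continuous, nondecreasing, $f(u)>0$ for $u>0$. (S) there is $\tau_0>0$ with $f\in C^1([\tau_0,\infty))$ and $\int_{\tau_0}^\infty ds/f(s)<\infty$. (C) $f$ is convex on $[\tau_1,\infty)$ for some $\tau_1\ge0$. $F(u)=\int_u^\infty ds/f(s)$ ($u>0$), $F_0=\lim_{u\to0}F(u)$,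 $G(u)=1/F(u)$ for $u>0$, $G(0)=1/F_0$ ($=0$ if $F_0=\infty$). (L) $q_f=\lim_{u\to\infty}f'(u)F(u)$ exists and is finite; $p_f$ is defined by $1/p_f+1/q_f=1$; $f$ is supercritical if $p_f>1+\theta/N$. For nonnegative $\phi,\psi$, $\phi\asymp\psi$ means there are $C_1,C_2,L>0$ with $C_1\phi(u)\le\psi(u)\le C_2\phi(u)$ for all $u\ge L$. $\mathcal{B}=\bigcap_{r>0}L^\infty(\mathbb{R}^N\setminus B_r)$. A function $\mu_c\in\mathcal{B}$, nonnegative and locally integrable, is a dilation-critical singularity for (SHE) if, with $\mu(x)=\mu_c(x/\lambda)$: (i) for every $\lambda\in(0,1)$ (SHE) is locally solvable; (ii) for every $\lambda>1$ (SHE) is not locally solvable. *)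

theory Defs
  imports "HOL-Analysis.Analysis"
begin

text \<open>Gamma theta x t = (2 pi)^(-N) * integral of e^(i x.xi - t |xi|^theta) d xi, N = DIM('a).
  Since the symbol is even and real, the imaginary part vanishes, so only the cosine appears.\<close>
definition frac_heat_kernel :: "real \<Rightarrow> 'a::euclidean_space \<Rightarrow> real \<Rightarrow> real" where
  "frac_heat_kernel \<theta> x t =
     (2 * pi) powr (- real DIM('a)) *
     (\<integral>\<xi>. cos (x \<bullet> \<xi>) * exp (- t * norm \<xi> powr \<theta>) \<partial>lborel)"

definition she_solution ::
  "real \<Rightarrow> (real \<Rightarrow> real) \<Rightarrow> ('a::euclidean_space \<Rightarrow> real) \<Rightarrow> real \<Rightarrow> ('a \<Rightarrow> real \<Rightarrow> real) \<Rightarrow> bool" where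
  "she_solution \<theta> f \<mu> T u \<longleftrightarrow>
     (\<lambda>z. u (fst z) (snd z)) \<in> borel_measurable (lborel :: ('a \<times> real) measure) \<and>
     (\<forall>x t. 0 < t \<and> t < T \<longrightarrow> 0 \<le> u x t) \<and>
     (AE z in (lborel :: ('a \<times> real) measure). 0 < snd z \<and> snd z < T \<longrightarrow>
        ennreal (u (fst z) (snd z)) =
          (\<integral>\<^sup>+ y. ennreal (frac_heat_kernel \<theta> (fst z - y) (snd z)) * ennreal (\<mu> y) \<partial>lborel)
          + (\<integral>\<^sup>+ s \<in> {0<..<snd z}.
               (\<integral>\<^sup>+ y. ennreal (frac_heat_kernel \<theta> (fst z - y) (snd z - s)) * ennreal (f (u y s)) \<partial>lborel)
             \<partial>lborel))"

definition locally_solvable ::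
  "real \<Rightarrow> (real \<Rightarrow> real) \<Rightarrow> ('a::euclidean_space \<Rightarrow> real) \<Rightarrow> bool" where
  "locally_solvable \<theta> f \<mu> \<longleftrightarrow> (\<exists>T > 0. \<exists>u. she_solution \<theta> f \<mu> T u)"

definition in_B :: "('a::euclidean_space \<Rightarrow> real) \<Rightarrow> bool" where
  "in_B \<mu> \<longleftrightarrow> \<mu> \<in> borel_measurable lborel \<and>
     (\<forall>r > 0. \<exists>M. AE x in lborel. r \<le> norm x \<longrightarrow> \<bar>\<mu> x\<bar> \<le> M)"

definition locally_integrable :: "('a::euclidean_space \<Rightarrow> real) \<Rightarrow> bool" where
  "locally_integrable \<mu> \<longleftrightarrow> (\<forall>K. compact K \<longrightarrow> set_integrable lborel K \<mu>)"

definition dilation_critical ::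
  "real \<Rightarrow> (real \<Rightarrow> real) \<Rightarrow> ('a::euclidean_space \<Rightarrow> real) \<Rightarrow> bool" where
  "dilation_critical \<theta> f \<mu>c \<longleftrightarrow>
     in_B \<mu>c \<and> (\<forall>x. 0 \<le> \<mu>c x) \<and> locally_integrable \<mu>c \<and>
     (\<forall>c. 0 < c \<and> c < 1 \<longrightarrow> locally_solvable \<theta> f (\<lambda>x. \<mu>c ((1 / c) *\<^sub>R x))) \<and>
     (\<forall>c. 1 < c \<longrightarrow> \<not> locally_solvable \<theta> f (\<lambda>x. \<mu>c ((1 / c) *\<^sub>R x)))"

definition F_fun :: "(real \<Rightarrow> real) \<Rightarrow> real \<Rightarrow> real" where
  "F_fun f u = (LINT s:{u..}|lborel. 1 / f s)"

text \<open>F_0 = lim_{u -> 0} F(u) = integral over (0,infty) of 1/f, possibly infinite.\<close>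
definition F0_fun :: "(real \<Rightarrow> real) \<Rightarrow> ennreal" where
  "F0_fun f = (\<integral>\<^sup>+ s \<in> {0<..}. ennreal (1 / f s) \<partial>lborel)"

definition G_fun :: "(real \<Rightarrow> real) \<Rightarrow> real \<Rightarrow> real" where
  "G_fun f u = (if 0 < u then 1 / F_fun f u
                else if F0_fun f = \<infinity> then 0 else 1 / enn2real (F0_fun f))"

text \<open>p_f with 1/p_f + 1/q_f = 1 (p_f = infinity when q_f = 1).\<close>
definition p_of_q :: "real \<Rightarrow> ereal" where
  "p_of_q q = (if q = 1 then \<infinity> else ereal (q / (q - 1)))"

definition asymp_equiv :: "(real \<Rightarrow> real) \<Rightarrow> (real \<Rightarrow> real) \<Rightarrow> bool" where
  "asymp_equiv \<phi> \<psi> \<longleftrightarrow>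
     (\<exists>C1 C2 L. 0 < C1 \<and> 0 < C2 \<and> 0 < L \<and>
        (\<forall>u \<ge> L. C1 * \<phi> u \<le> \<psi> u \<and> \<psi> u \<le> C2 * \<phi> u))"

end

theory Submission
  imports Defs "HOL-Probability.Probability" "HOL-Real_Asymp.Real_Asymp"
begin

text \<open>Dilating \<open>\<psi>(l|x|\<^bsup>-\<theta>\<^esup>)\<close> by c only replaces l by \<open>l c\<^sup>\<theta>\<close>, and solvability is inherited by smaller initial
  data (monotone iteration below a supersolution). So the set of all l for which the problem is solvable is an
  interval starting at 0, and the only candidate for the critical value is its supremum. One has to show that this
  set is neither empty nor unbounded.

  Since \<open>G(\<psi>(s))\<close> is comparable to s, the datum behaves like \<open>F\<^bsup>-1\<^esup>(|x|\<^sup>\<theta>/l)\<close> near the origin.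
  For small l, fix \<open>q - 1 < r < min q (N/\<theta>)\<close>, put \<open>J = F\<^bsup>-r\<^esup>\<close>, which is convex near infinity, and let z be the caloric extension
  of \<open>J(\<mu>)\<close>; then \<open>J\<^bsup>-1\<^esup>(2z)\<close> is a supersolution for a short time.
  For large l, Jensen's inequality along a solution u shows \<open>S(t)\<mu> \<le> F\<^bsup>-1\<^esup>(t)\<close>, whereas Jensen's inequality for the convex function
  \<open>a \<mapsto> F\<^bsup>-1\<^esup>(a\<^sup>2)\<close> yields \<open>S(t)\<mu> \<ge> F\<^bsup>-1\<^esup>(\<delta>t) - O(\<surd>t)\<close> near the origin with small \<open>\<delta>\<close>. These contradict each other as \<open>f F\<^bsup>1/2\<^esup> \<rightarrow> \<infinity>\<close>.

  Of the kernel one only needs positivity, unit mass, the semigroup law, the bound \<open>O(t\<^bsup>-N/\<theta>\<^esup>)\<close> and the moment of order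
  \<open>\<theta>/2\<close>. Positivity holds because \<open>exp(-t(1 - e\<^bsup>-s\<^esup>)\<^sup>\<alpha>)\<close> is a power series in \<open>e\<^bsup>-s\<^esup>\<close> with nonnegative coefficients, so
  that \<open>exp(-t|\<xi>|\<^sup>\<theta>)\<close> is a limit of nonnegative combinations of Gaussians.\<close>

section \<open>Integrals of radial functions and Gaussians\<close>

text \<open>The exponents come from one identity: \<open>f F^\<rho>\<close> has derivative
  \<open>F^(\<rho>-1) (f' F - \<rho>)\<close>, so it eventually increases for \<rho> < q and
  decreases for \<rho> > q. Hence r > q - 1 makes \<open>J' = r / (f F^(r+1))\<close> increasing,
  that is, J convex, while r < q makes \<open>f F^r = f / J\<close> increasing, which bounds f(v) by
  a coefficient times J(v) = 2z, a bound linear in z that the semigroup law can integrate. Finally r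
  < N/\<theta> makes \<open>|x|^(-\<theta> r)\<close> locally integrable, whence z = O(t^(-r)).
  Supercriticality provides q - 1 < N/\<theta>, so such an r exists. For nonexistence the obstacle
  is that for \<theta> < 2 the kernel has no finite moment of order \<theta>. Halving the order
  costs an error O(\<surd>t), which is beaten by the gap
  \<open>F^(-1)(t/2) - F^(-1)(t) \<ge> f t / 2\<close>, with f taken at \<open>F^(-1)(t)\<close>.
  The kernel is given as a cosine integral, from which neither sign nor decay can be read off. This
  fixes the order of its theory: positivity comes before integrability, and inversion is regularised
  by Gaussians.\<close>

lemma nn_integral_le_suminf_balls:
  fixes w :: "'a::euclidean_space \<Rightarrow> ennreal"
  assumes w: "\<And>x. w x \<le> (\<Sum>n. ennreal (c n) * indicator (ball 0 (\<rho> n)) x)"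
    and c: "\<And>n. 0 \<le> c n" and \<rho>: "\<And>n. 0 \<le> \<rho> n"
    and s: "(\<lambda>n. c n * \<rho> n ^ DIM('a)) sums S"
  shows "(\<integral>\<^sup>+x. w x \<partial>lborel) \<le> ennreal (unit_ball_vol (DIM('a)) * S)"
proof -
  have "(\<integral>\<^sup>+x. w x \<partial>lborel) \<le> (\<integral>\<^sup>+x. (\<Sum>n. ennreal (c n) * indicator (ball 0 (\<rho> n)) x) \<partial>(lborel::'a measure))"
    by (intro nn_integral_mono w)
  also have "\<dots> = (\<Sum>n. \<integral>\<^sup>+x. ennreal (c n) * indicator (ball 0 (\<rho> n)) x \<partial>(lborel::'a measure))"
    by (intro nn_integral_suminf borel_measurable_times_ennreal borel_measurable_indicator) auto
  also have "\<dots> = (\<Sum>n. ennreal (unit_ball_vol (DIM('a)) * (c n * \<rho> n ^ DIM('a))))"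
    using c \<rho> by (intro suminf_cong)
      (simp add: nn_integral_cmult_indicator emeasure_ball ennreal_mult[symmetric] ac_simps)
  also have "\<dots> = ennreal (\<Sum>n. unit_ball_vol (DIM('a)) * (c n * \<rho> n ^ DIM('a)))"
    using c \<rho> sums_summable[OF s] by (intro suminf_ennreal2) (auto intro!: mult_nonneg_nonneg summable_mult)
  also have "\<dots> = ennreal (unit_ball_vol (DIM('a)) * S)"
    using s by (simp add: sums_iff suminf_mult)
  finally show ?thesis .
qed

lemma suminf_ennreal_ge_term:
  fixes a :: "nat \<Rightarrow> ennreal"
  shows "a n \<le> (\<Sum>i. a i)"
  using sum_le_suminf[OF summableI, of "{n}" a] by simp

text \<open>On the shell n \<le> |\<xi>| < n + 1 the integrand is at most
  \<open>exp (- t n^\<theta>)\<close>, and the shell lies in a ball of volume O((n+1)^N). Covering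
  by balls replaces polar coordinates, here and in
  \<open>nn_integral_norm_powr_ball_le\<close>.\<close>

lemma nn_integral_exp_norm_powr_finite:
  fixes t \<theta> :: real
  assumes t: "0 < t" and \<theta>: "0 < \<theta>"
  shows "(\<integral>\<^sup>+\<xi>. ennreal (exp (- t * norm (\<xi>::'a::euclidean_space) powr \<theta>)) \<partial>lborel) < \<infinity>"
proof -
  let ?c = "\<lambda>n::nat. exp (- t * real n powr \<theta>)"
  let ?N = "DIM('a)"
  have "summable (\<lambda>n. ?c n * (real n + 1) ^ ?N)"
  proof (rule summable_comparison_test_bigo)
    show "summable (\<lambda>n. norm (1 / real n ^ 2))"
      using inverse_power_summable[of 2, where 'a=real] by (simp add: field_simps)
    show "(\<lambda>n. ?c n * (real n + 1) ^ ?N) \<in> O(\<lambda>n. 1 / real n ^ 2)"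
      using t \<theta> by real_asymp
  qed
  then obtain S where S: "(\<lambda>n. ?c n * (real n + 1) ^ ?N) sums S" by (auto simp: summable_def)
  have "(\<integral>\<^sup>+\<xi>. ennreal (exp (- t * norm (\<xi>::'a) powr \<theta>)) \<partial>lborel) \<le> ennreal (unit_ball_vol ?N * S)"
  proof (rule nn_integral_le_suminf_balls[OF _ _ _ S])
    fix x :: 'a
    define n where "n = nat \<lfloor>norm x\<rfloor>"
    have n: "real n \<le> norm x" "norm x < real n + 1" unfolding n_def by simp_all
    have "exp (- t * norm x powr \<theta>) \<le> ?c n"
      using t \<theta> n by (auto intro!: mult_left_mono powr_mono2)
    then have "ennreal (exp (- t * norm x powr \<theta>)) \<le> ennreal (?c n) * indicator (ball 0 (real n + 1)) x"
      using n by (simp add: ennreal_leI indicator_def)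
    also have "\<dots> \<le> (\<Sum>n. ennreal (?c n) * indicator (ball 0 (real n + 1)) x)"
      by (rule suminf_ennreal_ge_term)
    finally show "ennreal (exp (- t * norm x powr \<theta>)) \<le> (\<Sum>n. ennreal (?c n) * indicator (ball 0 (real n + 1)) x)" .
  qed auto
  then show ?thesis by (simp add: le_less_trans)
qed

lemma integrable_exp_norm_powr:
  fixes t \<theta> :: real
  assumes "0 < t" "0 < \<theta>"
  shows "integrable lborel (\<lambda>\<xi>::'a::euclidean_space. exp (- t * norm \<xi> powr \<theta>))"
  using nn_integral_exp_norm_powr_finite[OF assms, where 'a='a] by (simp add: integrable_iff_bounded)

text \<open>The dyadic shells R/2^(n+1) \<le> |y| < R/2^n contribute a geometric series of ratio
  2^(a-N), convergent because a < N. The power of R is forced by scaling; C is uniform in R.\<close>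

lemma nn_integral_norm_powr_ball_le:
  assumes "a < real DIM('a::euclidean_space)" "0 \<le> a"
  shows "\<exists>C>0. \<forall>R>0. (\<integral>\<^sup>+y. ennreal (norm (y::'a) powr - a) * indicator (ball 0 R) y \<partial>lborel)
           \<le> ennreal (C * R powr (real DIM('a) - a))"
proof -
  let ?N = "DIM('a)"
  define q where "q = 2 powr (a - real ?N)"
  have q: "0 < q" "q < 1" using assms by (auto simp: q_def powr_less_one)
  define C where "C = unit_ball_vol ?N * (2 powr a / (1 - q))"
  have "C > 0" using q by (auto simp: C_def intro!: mult_pos_pos divide_pos_pos)
  moreover have "(\<integral>\<^sup>+y. ennreal (norm (y::'a) powr - a) * indicator (ball 0 R) y \<partial>lborel) \<le> ennreal (C * R powr (real ?N - a))"
    if R: "R > 0" for R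
  proof -
    let ?\<rho> = "\<lambda>n::nat. R / 2 ^ n" and ?c = "\<lambda>n::nat. (R / 2 ^ (Suc n)) powr - a"
    have e: "?c n * ?\<rho> n ^ ?N = (2 powr a * R powr (real ?N - a)) * q ^ n" for n
    proof -
      have "?c n * ?\<rho> n ^ ?N = (R / (2 powr (real n + 1))) powr - a * (R / 2 powr real n) powr real ?N"
        using R by (simp add: powr_realpow powr_add mult.commute)
      also have "\<dots> = (2 powr a * R powr (real ?N - a)) * (2 powr (a - real ?N)) powr real n"
        using R by (simp add: powr_def exp_add[symmetric] ln_div ln_mult algebra_simps flip: exp_diff)
      finally show ?thesis using q by (simp add: q_def powr_realpow)
    qed
    have S: "(\<lambda>n. ?c n * ?\<rho> n ^ ?N) sums ((2 powr a * R powr (real ?N - a)) * (1 / (1 - q)))"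
      unfolding e using q by (intro sums_mult geometric_sums) auto
    have "(\<integral>\<^sup>+y. ennreal (norm (y::'a) powr - a) * indicator (ball 0 R) y \<partial>lborel)
        \<le> ennreal (unit_ball_vol ?N * ((2 powr a * R powr (real ?N - a)) * (1 / (1 - q))))"
    proof (rule nn_integral_le_suminf_balls[OF _ _ _ S])
      fix x :: 'a
      show "ennreal (norm x powr - a) * indicator (ball 0 R) x
             \<le> (\<Sum>n. ennreal (?c n) * indicator (ball 0 (R / 2 ^ n)) x)"
      proof (cases "x \<noteq> 0 \<and> norm x < R")
        case True
        define n where "n = nat \<lfloor>log 2 (R / norm x)\<rfloor>"
        have l: "log 2 (R / norm x) \<ge> 0" using True R by (subst zero_le_log_cancel_iff) auto
        then have n: "real n \<le> log 2 (R / norm x)" "log 2 (R / norm x) < real n + 1"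
          unfolding n_def by simp_all
        have n1: "2 ^ n \<le> R / norm x"
          using n True R by (simp add: le_log_iff powr_realpow)
        have n2: "R / norm x < 2 ^ Suc n"
          using n True R by (simp add: log_less_iff powr_add powr_realpow)
        show ?thesis
        \<comment> \<open>In the case of equality x lies on the sphere of radius R/2^n, hence
          outside the open ball with index n; the ball with index n - 1 serves instead, and n is not
          0 because |x| < R.\<close>
        proof (cases "2 ^ n = R / norm x")
          case False
          then have "norm x < R / 2 ^ n" using n1 True by (simp add: field_simps)
          moreover have "R / 2 ^ Suc n \<le> norm x" using n2 True by (simp add: field_simps)
          then have "norm x powr - a \<le> ?c n" using R assms True by (intro powr_mono2') auto
          ultimately have "ennreal (norm x powr - a) * indicator (ball 0 R) x \<le> ennreal (?c n) * indicator (ball 0 (R / 2 ^ n)) x"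
            by (simp add: ennreal_leI indicator_def)
          also have "\<dots> \<le> (\<Sum>n. ennreal (?c n) * indicator (ball 0 (R / 2 ^ n)) x)"
            by (rule suminf_ennreal_ge_term)
          finally show ?thesis .
        next
          case eq: True
          have "n \<noteq> 0"
          proof
            assume "n = 0" then show False using eq True by (simp add: field_simps)
          qed
          then obtain k where k: "n = Suc k" by (cases n) auto
          have nx: "norm x = R / 2 ^ Suc k" using eq True by (simp add: field_simps k)
          have "norm x < R / 2 ^ k" using R nx by (simp add: field_simps)
          moreover have "norm x powr - a = ?c k" unfolding nx ..
          ultimately have "ennreal (norm x powr - a) * indicator (ball 0 R) x \<le> ennreal (?c k) * indicator (ball 0 (R / 2 ^ k)) x"
            by (simp add: ennreal_leI indicator_def)
          also have "\<dots> \<le> (\<Sum>n. ennreal (?c n) * indicator (ball 0 (R / 2 ^ n)) x)"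
            by (rule suminf_ennreal_ge_term)
          finally show ?thesis .
        qed
      qed (auto simp: indicator_def)
    qed (use R in auto)
    then show ?thesis by (simp add: C_def ac_simps)
  qed
  ultimately show ?thesis by blast
qed

text \<open>This is the characteristic function of the standard normal law after the substitution
  \<open>y = c \<xi>\<close>, with \<open>c = sqrt (2 * \<delta>)\<close> turning y^2/2 into
  \<delta> \<xi>^2.\<close>

lemma integral_gaussian_iexp:
  fixes x \<delta> :: real
  assumes "0 < \<delta>"
  shows "integrable lborel (\<lambda>\<xi>. iexp (x * \<xi>) * complex_of_real (exp (- \<delta> * \<xi>\<^sup>2)))" (is ?A)
    and "(CLBINT \<xi>. iexp (x * \<xi>) * complex_of_real (exp (- \<delta> * \<xi>\<^sup>2))) =
           complex_of_real (sqrt (pi / \<delta>) * exp (- x\<^sup>2 / (4 * \<delta>)))" (is ?B)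
proof -
  define c where "c = sqrt (2 * \<delta>)"
  have c: "c > 0" "c\<^sup>2 = 2 * \<delta>" using assms by (auto simp: c_def)
  define h where "h = (\<lambda>y. complex_of_real (std_normal_density y) * iexp ((x / c) * y))"
  have int: "integrable lborel h"
  proof (rule Bochner_Integration.integrable_bound)
    show "integrable lborel std_normal_density"
      using integrable_normal_density[of 1 0] by simp
  qed (auto simp: h_def norm_mult)
  have val: "(CLBINT y. h y) = complex_of_real (exp (- (x / c)\<^sup>2 / 2))"
  proof -
    have "char std_normal_distribution (x / c) = (CLBINT y. std_normal_density y *\<^sub>R iexp ((x / c) * y))"
      unfolding char_def by (subst integral_density) auto
    then show ?thesis by (simp add: h_def char_std_normal_distribution scaleR_conv_of_real)
  qed
  have sub: "h (0 + c * \<xi>) * complex_of_real (sqrt (2 * pi)) = iexp (x * \<xi>) * complex_of_real (exp (- \<delta> * \<xi>\<^sup>2))" for \<xi>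
    using c by (simp add: h_def std_normal_density_def power_mult_distrib field_simps)
  have "integrable lborel (\<lambda>\<xi>. h (0 + c * \<xi>) * complex_of_real (sqrt (2 * pi)))"
    using int c by (intro integrable_mult_left lborel_integrable_real_affine) auto
  then show ?A unfolding sub .
  have "(CLBINT y. h y) = \<bar>c\<bar> *\<^sub>R (CLBINT \<xi>. h (0 + c * \<xi>))"
    using c by (intro lborel_integral_real_affine) auto
  then have "(CLBINT \<xi>. h (0 + c * \<xi>)) = complex_of_real (exp (- (x / c)\<^sup>2 / 2) / c)"
    using c val by (simp add: scaleR_conv_of_real field_simps)
  then have "(CLBINT \<xi>. h (0 + c * \<xi>) * complex_of_real (sqrt (2 * pi)))
      = complex_of_real (exp (- (x / c)\<^sup>2 / 2) / c * sqrt (2 * pi))"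
    by simp
  also have "exp (- (x / c)\<^sup>2 / 2) / c * sqrt (2 * pi) = sqrt (pi / \<delta>) * exp (- x\<^sup>2 / (4 * \<delta>))"
    using assms by (simp add: power_divide c) (simp add: c_def real_sqrt_mult real_sqrt_divide field_simps)
  finally show ?B unfolding sub .
qed

text \<open>The complex exponential factorises over the coordinates, which the cosine does not; the
  real part is taken only at the end.\<close>

lemma gaussian_fourier:
  fixes x :: "'a::euclidean_space" and \<delta> :: real
  assumes \<delta>: "0 < \<delta>"
  shows "integrable lborel (\<lambda>\<xi>. cos (x \<bullet> \<xi>) * exp (- \<delta> * (norm \<xi>)\<^sup>2))"
    and "(LBINT \<xi>. cos (x \<bullet> \<xi>) * exp (- \<delta> * (norm \<xi>)\<^sup>2)) =
           sqrt (pi / \<delta>) ^ DIM('a) * exp (- (norm x)\<^sup>2 / (4 * \<delta>))"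
proof -
  define h where "h = (\<lambda>b \<xi>. iexp ((x \<bullet> b) * \<xi>) * complex_of_real (exp (- \<delta> * \<xi>\<^sup>2)))"
  interpret product_sigma_finite "\<lambda>b::'a. lborel :: real measure" ..
  have sq: "(norm y)\<^sup>2 = (\<Sum>b\<in>Basis. (y \<bullet> b)\<^sup>2)" for y :: 'a
    unfolding power2_norm_eq_inner by (subst euclidean_inner) (simp add: power2_eq_square)
  have prod: "(\<Prod>b\<in>Basis. h b (\<xi> \<bullet> b)) = iexp (x \<bullet> \<xi>) * complex_of_real (exp (- \<delta> * (norm \<xi>)\<^sup>2))" for \<xi>
    unfolding h_def prod.distrib sq
    by (subst (3) euclidean_inner) (simp add: exp_sum[symmetric] sum_distrib_left sum_negf flip: of_real_prod)
  have hm[measurable]: "h b \<in> borel_measurable borel" for b unfolding h_def by measurable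
  have coord: "(\<Prod>b\<in>Basis. h b ((\<Sum>c\<in>Basis. y c *\<^sub>R c) \<bullet> b)) = (\<Prod>b\<in>Basis. h b (y b))" for y
    by (intro prod.cong refl) (simp add: inner_sum_left inner_Basis if_distrib sum.If_cases cong: if_cong)
  have hi: "integrable lborel (h b)" for b unfolding h_def by (rule integral_gaussian_iexp[OF \<delta>])
  have I: "integrable lborel (\<lambda>\<xi>::'a. \<Prod>b\<in>Basis. h b (\<xi> \<bullet> b))"
    by (subst lborel_eq, subst integrable_distr_eq) (auto simp: coord intro!: product_integrable_prod hi)
  have "(CLBINT \<xi>. (\<Prod>b\<in>Basis. h b ((\<xi>::'a) \<bullet> b))) = (\<Prod>b\<in>Basis. (CLBINT s. h b s))"
    by (subst lborel_eq, subst integral_distr) (auto simp: coord intro!: product_integral_prod hi)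
  also have "\<dots> = (\<Prod>b\<in>Basis. complex_of_real (sqrt (pi / \<delta>) * exp (- (x \<bullet> b)\<^sup>2 / (4 * \<delta>))))"
    unfolding h_def using \<delta> by (intro prod.cong refl integral_gaussian_iexp(2))
  also have "\<dots> = complex_of_real (sqrt (pi / \<delta>) ^ DIM('a) * exp (- (norm x)\<^sup>2 / (4 * \<delta>)))"
    unfolding sq by (simp add: prod.distrib exp_sum[symmetric] sum_negf sum_divide_distrib flip: of_real_prod)
  finally have V: "(CLBINT \<xi>. iexp (x \<bullet> \<xi>) * complex_of_real (exp (- \<delta> * (norm \<xi>)\<^sup>2))) = \<dots>"
    unfolding prod .
  have re: "Re (iexp (x \<bullet> \<xi>) * complex_of_real (exp (- \<delta> * (norm \<xi>)\<^sup>2))) = cos (x \<bullet> \<xi>) * exp (- \<delta> * (norm \<xi>)\<^sup>2)" for \<xi>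
    by (simp add: Re_exp)
  show "integrable lborel (\<lambda>\<xi>. cos (x \<bullet> \<xi>) * exp (- \<delta> * (norm \<xi>)\<^sup>2))"
    using integrable_Re[OF I] unfolding prod re .
  show "(LBINT \<xi>. cos (x \<bullet> \<xi>) * exp (- \<delta> * (norm \<xi>)\<^sup>2)) =
           sqrt (pi / \<delta>) ^ DIM('a) * exp (- (norm x)\<^sup>2 / (4 * \<delta>))"
    using integral_Re[OF I] unfolding prod re V by simp
qed

section \<open>The fractional heat kernel\<close>

lemma integral_lborel_affine:
  fixes h :: "'a::euclidean_space \<Rightarrow> real"
  assumes c: "c \<noteq> 0" and [measurable]: "h \<in> borel_measurable borel"
  shows "(LBINT x. h x) = \<bar>c\<bar> ^ DIM('a) * (LBINT x. h (t + c *\<^sub>R x))"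
  by (subst lborel_affine[OF c, of t], subst integral_density) (auto simp: integral_distr)

lemma integrable_tensor:
  fixes f :: "'a::euclidean_space \<Rightarrow> real" and g :: "'b::euclidean_space \<Rightarrow> real"
  assumes "integrable lborel f" "integrable lborel g"
  shows "integrable (lborel \<Otimes>\<^sub>M lborel) (\<lambda>(x, y). f x * g y)"
proof -
  have [measurable]: "f \<in> borel_measurable borel" "g \<in> borel_measurable borel"
    using assms[THEN borel_measurable_integrable] by auto
  show ?thesis
    using assms by (intro lborel_pair.Fubini_integrable) (auto simp: abs_mult)
qed

lemma integrable_gaussian:
  assumes "0 < \<delta>"
  shows "integrable lborel (\<lambda>\<xi>::'a::euclidean_space. exp (- \<delta> * (norm \<xi>)\<^sup>2))"
  using gaussian_fourier(1)[OF assms, of 0] by simp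

lemma integral_gaussian:
  assumes "0 < \<delta>"
  shows "(LBINT \<xi>::'a::euclidean_space. exp (- \<delta> * (norm \<xi>)\<^sup>2)) = sqrt (pi / \<delta>) ^ DIM('a)"
  using gaussian_fourier(2)[OF assms, of "0::'a"] by simp

section \<open>Positive definiteness of \<open>exp (- t |\<xi>|^\<theta>)\<close>\<close>

text \<open>Positive definiteness of the radial function h(|xi|^2), tested on all Gaussian cut-offs at once;
  this makes the class trivially stable under multiplication by exponentials.\<close>
definition posdef :: "'a::euclidean_space itself \<Rightarrow> (real \<Rightarrow> real) \<Rightarrow> bool" where
  "posdef _ h \<longleftrightarrow> h \<in> borel_measurable borel \<and> (\<exists>B. \<forall>s\<ge>0. \<bar>h s\<bar> \<le> B) \<and>
     (\<forall>x::'a. \<forall>\<delta>>0. 0 \<le> (LBINT \<xi>. cos (x \<bullet> \<xi>) * h ((norm \<xi>)\<^sup>2) * exp (- \<delta> * (norm \<xi>)\<^sup>2)))"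

lemma posdef_integrable:
  fixes x :: "'a::euclidean_space"
  assumes h: "posdef TYPE('a) h" and \<delta>: "0 < \<delta>"
  shows "integrable lborel (\<lambda>\<xi>. cos (x \<bullet> \<xi>) * h ((norm \<xi>)\<^sup>2) * exp (- \<delta> * (norm \<xi>)\<^sup>2))"
proof -
  from h obtain B where B: "\<And>s. s \<ge> 0 \<Longrightarrow> \<bar>h s\<bar> \<le> B" and [measurable]: "h \<in> borel_measurable borel"
    by (auto simp: posdef_def)
  show ?thesis
  proof (rule Bochner_Integration.integrable_bound)
    show "integrable lborel (\<lambda>\<xi>::'a. B * exp (- \<delta> * (norm \<xi>)\<^sup>2))"
      using integrable_gaussian[OF \<delta>, where 'a='a] by (intro integrable_mult_right)
    show "AE \<xi> in lborel. norm (cos (x \<bullet> \<xi>) * h ((norm \<xi>)\<^sup>2) * exp (- \<delta> * (norm \<xi>)\<^sup>2))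
        \<le> norm (B * exp (- \<delta> * (norm \<xi>)\<^sup>2))"
    proof (rule AE_I2)
      fix \<xi> :: 'a
      have "\<bar>cos (x \<bullet> \<xi>)\<bar> * \<bar>h ((norm \<xi>)\<^sup>2)\<bar> \<le> 1 * B"
        using B[of "(norm \<xi>)\<^sup>2"] by (intro mult_mono) auto
      moreover have "0 \<le> B" using B[of 0] by auto
      ultimately show "norm (cos (x \<bullet> \<xi>) * h ((norm \<xi>)\<^sup>2) * exp (- \<delta> * (norm \<xi>)\<^sup>2)) \<le> norm (B * exp (- \<delta> * (norm \<xi>)\<^sup>2))"
        by (simp add: abs_mult)
    qed
  qed measurable
qed

lemma posdef_one: "posdef TYPE('a::euclidean_space) (\<lambda>_. 1)"
  using gaussian_fourier(2)[where 'a='a] by (auto simp: posdef_def intro!: exI[of _ 1])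

lemma posdef_add:
  assumes "posdef TYPE('a::euclidean_space) h" "posdef TYPE('a) k"
  shows "posdef TYPE('a) (\<lambda>s. h s + k s)"
  unfolding posdef_def
proof (intro conjI allI impI)
  from assms obtain B C where "\<And>s. s \<ge> 0 \<Longrightarrow> \<bar>h s\<bar> \<le> B" "\<And>s. s \<ge> 0 \<Longrightarrow> \<bar>k s\<bar> \<le> C"
    by (auto simp: posdef_def)
  then have "\<forall>s\<ge>0. \<bar>h s + k s\<bar> \<le> B + C" by (auto intro!: order_trans[OF abs_triangle_ineq] add_mono)
  then show "\<exists>B. \<forall>s\<ge>0. \<bar>h s + k s\<bar> \<le> B" by blast
  show "(\<lambda>s. h s + k s) \<in> borel_measurable borel" using assms by (auto simp: posdef_def)
  fix x :: 'a and \<delta> :: real assume \<delta>: "0 < \<delta>"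
  have "(LBINT \<xi>. cos (x \<bullet> \<xi>) * (h ((norm \<xi>)\<^sup>2) + k ((norm \<xi>)\<^sup>2)) * exp (- \<delta> * (norm \<xi>)\<^sup>2))
      = (LBINT \<xi>. cos (x \<bullet> \<xi>) * h ((norm \<xi>)\<^sup>2) * exp (- \<delta> * (norm \<xi>)\<^sup>2))
      + (LBINT \<xi>. cos (x \<bullet> \<xi>) * k ((norm \<xi>)\<^sup>2) * exp (- \<delta> * (norm \<xi>)\<^sup>2))"
    using assms[THEN posdef_integrable, OF \<delta>] by (subst Bochner_Integration.integral_add[symmetric]) (auto simp: algebra_simps)
  then show "0 \<le> (LBINT \<xi>. cos (x \<bullet> \<xi>) * (h ((norm \<xi>)\<^sup>2) + k ((norm \<xi>)\<^sup>2)) * exp (- \<delta> * (norm \<xi>)\<^sup>2))"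
    using assms \<delta> by (auto simp: posdef_def)
qed

lemma posdef_cmult_exp:
  assumes h: "posdef TYPE('a::euclidean_space) h" and c: "0 \<le> c" and l: "0 \<le> l"
  shows "posdef TYPE('a) (\<lambda>s. c * exp (- l * s) * h s)"
  unfolding posdef_def
proof (intro conjI allI impI)
  from h obtain B where B: "\<And>s. s \<ge> 0 \<Longrightarrow> \<bar>h s\<bar> \<le> B" by (auto simp: posdef_def)
  then have "\<forall>s\<ge>0. \<bar>c * exp (- l * s) * h s\<bar> \<le> c * 1 * B"
    using c l by (auto simp: abs_mult intro!: mult_mono mult_left_le)
  then show "\<exists>B. \<forall>s\<ge>0. \<bar>c * exp (- l * s) * h s\<bar> \<le> B" by blast
  show "(\<lambda>s. c * exp (- l * s) * h s) \<in> borel_measurable borel" using h by (auto simp: posdef_def)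
  fix x :: 'a and \<delta> :: real assume \<delta>: "0 < \<delta>"
  have "(LBINT \<xi>. cos (x \<bullet> \<xi>) * (c * exp (- l * (norm \<xi>)\<^sup>2) * h ((norm \<xi>)\<^sup>2)) * exp (- \<delta> * (norm \<xi>)\<^sup>2))
      = c * (LBINT \<xi>. cos (x \<bullet> \<xi>) * h ((norm \<xi>)\<^sup>2) * exp (- (\<delta> + l) * (norm \<xi>)\<^sup>2))"
    by (subst integral_mult_right_zero[symmetric])
       (intro Bochner_Integration.integral_cong refl, simp add: algebra_simps flip: exp_add)
  also have "\<dots> \<ge> 0"
  proof (rule mult_nonneg_nonneg[OF c])
    have "0 < \<delta> + l" using \<delta> l by simp
    then show "0 \<le> (LBINT \<xi>. cos (x \<bullet> \<xi>) * h ((norm \<xi>)\<^sup>2) * exp (- (\<delta> + l) * (norm \<xi>)\<^sup>2))"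
      using h unfolding posdef_def by blast
  qed
  finally show "0 \<le> (LBINT \<xi>. cos (x \<bullet> \<xi>) * (c * exp (- l * (norm \<xi>)\<^sup>2) * h ((norm \<xi>)\<^sup>2)) * exp (- \<delta> * (norm \<xi>)\<^sup>2))" .
qed

text \<open>Dominated convergence against the Gaussian cut-off. Convergence is asked only for s > 0,
  since \<xi> = 0 is a null set: the binomial series used below is available only where exp(-l s) <
  1.\<close>

lemma posdef_lim:
  assumes h: "\<And>n::nat. posdef TYPE('a::euclidean_space) (h n)"
    and B: "\<And>n s. 0 \<le> s \<Longrightarrow> \<bar>h n s\<bar> \<le> B"
    and [measurable]: "k \<in> borel_measurable borel" and kB: "\<And>s. 0 \<le> s \<Longrightarrow> \<bar>k s\<bar> \<le> B"
    and lim: "\<And>s. 0 < s \<Longrightarrow> (\<lambda>n. h n s) \<longlonglongrightarrow> k s"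
  shows "posdef TYPE('a) k"
  unfolding posdef_def
proof (intro conjI allI impI)
  have [measurable]: "h n \<in> borel_measurable borel" for n using h by (auto simp: posdef_def)
  show "\<exists>B. \<forall>s\<ge>0. \<bar>k s\<bar> \<le> B" using kB by blast
  show "k \<in> borel_measurable borel" by fact
  fix x :: 'a and \<delta> :: real assume \<delta>: "0 < \<delta>"
  have "(\<lambda>n. LBINT \<xi>. cos (x \<bullet> \<xi>) * h n ((norm \<xi>)\<^sup>2) * exp (- \<delta> * (norm \<xi>)\<^sup>2))
      \<longlonglongrightarrow> (LBINT \<xi>. cos (x \<bullet> \<xi>) * k ((norm \<xi>)\<^sup>2) * exp (- \<delta> * (norm \<xi>)\<^sup>2))"
  proof (rule integral_dominated_convergence)
    show "integrable lborel (\<lambda>\<xi>::'a. B * exp (- \<delta> * (norm \<xi>)\<^sup>2))"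
      using integrable_gaussian[OF \<delta>, where 'a='a] by (intro integrable_mult_right)
    show "AE \<xi> in lborel. (\<lambda>n. cos (x \<bullet> \<xi>) * h n ((norm \<xi>)\<^sup>2) * exp (- \<delta> * (norm \<xi>)\<^sup>2))
            \<longlonglongrightarrow> cos (x \<bullet> \<xi>) * k ((norm \<xi>)\<^sup>2) * exp (- \<delta> * (norm \<xi>)\<^sup>2)"
      using AE_lborel_singleton[of "0::'a"] by eventually_elim (intro tendsto_intros lim, simp)
    fix n
    show "AE \<xi> in lborel. norm (cos (x \<bullet> \<xi>) * h n ((norm \<xi>)\<^sup>2) * exp (- \<delta> * (norm \<xi>)\<^sup>2)) \<le> B * exp (- \<delta> * (norm \<xi>)\<^sup>2)"
    proof (rule AE_I2)
      fix \<xi> :: 'a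
      have "\<bar>cos (x \<bullet> \<xi>)\<bar> * \<bar>h n ((norm \<xi>)\<^sup>2)\<bar> \<le> 1 * B"
        using B[of "(norm \<xi>)\<^sup>2"] by (intro mult_mono) auto
      then show "norm (cos (x \<bullet> \<xi>) * h n ((norm \<xi>)\<^sup>2) * exp (- \<delta> * (norm \<xi>)\<^sup>2)) \<le> B * exp (- \<delta> * (norm \<xi>)\<^sup>2)"
        by (simp add: abs_mult)
    qed
  qed measurable
  then show "0 \<le> (LBINT \<xi>. cos (x \<bullet> \<xi>) * k ((norm \<xi>)\<^sup>2) * exp (- \<delta> * (norm \<xi>)\<^sup>2))"
    by (rule LIMSEQ_le_const) (use h \<delta> in \<open>auto simp: posdef_def\<close>)
qed

text \<open>Consecutive terms have the ratio (n + 1 - \<alpha>)/(n + 2) \<ge> 0, so all keep the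
  sign of the first one, -\<alpha>. With \<alpha> = \<theta>/2 this is where \<theta> \<le> 2 enters
  the positivity of the kernel.\<close>

lemma gbinomial_minus_one_power_nonpos:
  fixes \<alpha> :: real
  assumes "0 < \<alpha>" "\<alpha> \<le> 1"
  shows "(\<alpha> gchoose Suc n) * (- 1) ^ Suc n \<le> 0"
proof (induction n)
  case 0 then show ?case using assms by simp
next
  case (Suc n)
  have "(\<alpha> gchoose Suc (Suc n)) * (- 1) ^ Suc (Suc n) =
      ((\<alpha> gchoose Suc n) * (- 1) ^ Suc n) * ((real (Suc n) - \<alpha>) / real (Suc (Suc n)))"
  proof -
    have "real (Suc (Suc n)) * (\<alpha> gchoose Suc (Suc n)) = (\<alpha> gchoose Suc n) * (\<alpha> - real (Suc n))"
      using gbinomial_mult_1[of \<alpha> "Suc n"] by (simp add: algebra_simps)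
    then have e: "(\<alpha> gchoose Suc (Suc n)) = (\<alpha> gchoose Suc n) * (\<alpha> - real (Suc n)) / real (Suc (Suc n))"
      by (simp add: divide_simps mult.commute)
    show ?thesis unfolding e by (simp add: divide_simps algebra_simps)
  qed
  also have "\<dots> \<le> 0" by (rule mult_nonpos_nonneg[OF Suc]) (use assms in simp)
  finally show ?case .
qed

text \<open>Times exp a, this is exp(a (1 - (1 - x)^alpha)) with x = exp(-l s), a power series in x with
  nonnegative coefficients.\<close>
lemma posdef_exp_one_minus_powr:
  assumes \<alpha>: "0 < \<alpha>" "\<alpha> \<le> 1" and a: "0 \<le> a" and l: "0 < l"
  shows "posdef TYPE('a::euclidean_space) (\<lambda>s. exp (- a * (1 - exp (- l * \<bar>s\<bar>)) powr \<alpha>))"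
proof -
  define p where "p = (\<lambda>s. 1 - (1 - exp (- l * \<bar>s\<bar>)) powr \<alpha>)"
  have pm[measurable]: "p \<in> borel_measurable borel" unfolding p_def by measurable
  have p01: "0 \<le> p s" "p s \<le> 1" for s
    using \<alpha> l powr_mono2[of \<alpha> "1 - exp (- l * \<bar>s\<bar>)" 1] by (auto simp: p_def)
  define c where "c = (\<lambda>n. - ((\<alpha> gchoose Suc n) * (- 1) ^ Suc n))"
  have c: "c n \<ge> 0" for n using gbinomial_minus_one_power_nonpos[OF \<alpha>] by (simp add: c_def)
  have psums: "(\<lambda>n. c n * exp (- l * s) ^ Suc n) sums p s" if "s > 0" for s
  proof -
    have "(\<lambda>n. (\<alpha> gchoose n) * (- exp (- l * s)) ^ n) sums (1 + (- exp (- l * s))) powr \<alpha>"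
      using that l by (intro gen_binomial_real) auto
    then have "(\<lambda>n. (\<alpha> gchoose Suc n) * (- exp (- l * s)) ^ Suc n) sums ((1 - exp (- l * s)) powr \<alpha> - 1)"
      by (subst sums_Suc_iff) simp
    then have "(\<lambda>n. - ((\<alpha> gchoose Suc n) * (- exp (- l * s)) ^ Suc n)) sums (- ((1 - exp (- l * s)) powr \<alpha> - 1))"
      by (rule sums_minus)
    moreover have "- ((\<alpha> gchoose Suc n) * (- exp (- l * s)) ^ Suc n) = c n * exp (- l * s) ^ Suc n" for n
      by (subst power_minus) (simp add: c_def)
    moreover have "- ((1 - exp (- l * s)) powr \<alpha> - 1) = p s" using that by (simp add: p_def)
    ultimately show ?thesis by (simp only:)
  qed
  \<comment> \<open>Each term of the series of p is a nonnegative multiple of some exp(-l n s), and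
    such a factor is absorbed into the Gaussian cut-off. Induction then yields all powers of p,
    hence the exponential series.\<close>
  have step: "posdef TYPE('a) (\<lambda>s. h s * p s)" if h: "posdef TYPE('a) h" for h
  proof -
    from h obtain B where B: "\<And>s. s \<ge> 0 \<Longrightarrow> \<bar>h s\<bar> \<le> B" and [measurable]: "h \<in> borel_measurable borel"
      by (auto simp: posdef_def)
    have B0: "0 \<le> B" using B[of 0] by auto
    have fin: "posdef TYPE('a) (\<lambda>s. \<Sum>n<m. c n * exp (- l * s) ^ Suc n * h s)" for m
    proof (induction m)
      case 0 show ?case using posdef_cmult_exp[OF h, of 0 0] by simp
    next
      case (Suc m)
      have "posdef TYPE('a) (\<lambda>s. c m * exp (- (l * real (Suc m)) * s) * h s)"
        using c l by (intro posdef_cmult_exp h) auto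
      moreover have "exp (- (l * real (Suc m)) * s) = exp (- l * s) ^ Suc m" for s
        by (subst exp_of_nat_mult[symmetric]) (simp add: algebra_simps)
      ultimately show ?case using posdef_add[OF Suc] by (simp add: add.commute)
    qed
    \<comment> \<open>The comparison of partial sums with p holds for s > 0. Resetting the value at
      s = 0 gives a bound uniform in m on all of s \<ge> 0 and changes no integral.\<close>
    define cut where "cut = (\<lambda>m s. if s = 0 then 0 else \<Sum>n<m. c n * exp (- l * s) ^ Suc n * h s)"
    have cut_le: "\<bar>\<Sum>n<m. c n * exp (- l * s) ^ Suc n * h s\<bar> \<le> B" if s: "s > 0" for m s
    proof -
      have "(\<Sum>n<m. c n * exp (- l * s) ^ Suc n) \<le> p s"
        using psums[OF s] c by (subst sums_unique[OF psums[OF s]], intro sum_le_suminf) (auto simp: sums_iff)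
      moreover have "0 \<le> (\<Sum>n<m. c n * exp (- l * s) ^ Suc n)" using c by (intro sum_nonneg) auto
      ultimately have "\<bar>\<Sum>n<m. c n * exp (- l * s) ^ Suc n\<bar> * \<bar>h s\<bar> \<le> 1 * B"
        using p01[of s] B[of s] s by (intro mult_mono) auto
      then show ?thesis by (simp add: sum_distrib_right[symmetric] abs_mult)
    qed
    have "posdef TYPE('a) (cut m)" for m
    proof -
      from fin[of m] obtain B' where B': "\<And>s. s \<ge> 0 \<Longrightarrow> \<bar>\<Sum>n<m. c n * exp (- l * s) ^ Suc n * h s\<bar> \<le> B'"
        by (auto simp: posdef_def)
      show ?thesis
      proof (rule posdef_lim[where h="\<lambda>_. \<lambda>s. \<Sum>n<m. c n * exp (- l * s) ^ Suc n * h s"])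
      show "\<bar>\<Sum>n<m. c n * exp (- l * s) ^ Suc n * h s\<bar> \<le> max B B'" if "s \<ge> 0" for s
        using B'[OF that] by simp
      show "\<bar>cut m s\<bar> \<le> max B B'" if "s \<ge> 0" for s
        using B'[OF that] B0 by (auto simp: cut_def)
      qed (rule fin, auto simp: cut_def)
    qed
    then show ?thesis
    proof (rule posdef_lim)
      show "\<bar>cut m s\<bar> \<le> B" if "s \<ge> 0" for m s using cut_le[of s m] that B0 by (auto simp: cut_def)
      show "\<bar>h s * p s\<bar> \<le> B" if "s \<ge> 0" for s
        using mult_mono[OF B[OF that], of "\<bar>p s\<bar>" 1] p01[of s] B0 by (auto simp: abs_mult)
      show "(\<lambda>n. cut n s) \<longlonglongrightarrow> h s * p s" if "s > 0" for s
        using sums_mult2[OF psums[OF that], of "h s"] that by (simp add: cut_def sums_def mult.commute)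
    qed simp
  qed
  have pow: "posdef TYPE('a) (\<lambda>s. p s ^ n)" for n
  proof (induction n)
    case 0 show ?case using posdef_one by simp
  next
    case (Suc n) show ?case using step[OF Suc] by (simp add: mult.commute)
  qed
  have fin: "posdef TYPE('a) (\<lambda>s. \<Sum>n<m. a ^ n / fact n * p s ^ n)" for m
  proof (induction m)
    case 0 show ?case using posdef_cmult_exp[OF posdef_one, of 0 0] by simp
  next
    case (Suc m)
    have "posdef TYPE('a) (\<lambda>s. a ^ m / fact m * exp (- 0 * s) * p s ^ m)"
      using a by (intro posdef_cmult_exp pow) auto
    then show ?case using posdef_add[OF Suc] by (simp add: add.commute)
  qed
  have es: "(\<lambda>n. a ^ n / fact n * p s ^ n) sums exp (a * p s)" for s
    using exp_converges[of "a * p s"] by (simp add: power_mult_distrib field_simps)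
  have "posdef TYPE('a) (\<lambda>s. exp (a * p s))"
    using fin
  proof (rule posdef_lim)
    have e: "exp (a * p s) \<le> exp a" for s using a p01(2)[of s] by (simp add: mult_left_le)
    then show "\<bar>exp (a * p s)\<bar> \<le> exp a" for s by simp
    show "\<bar>\<Sum>n<m. a ^ n / fact n * p s ^ n\<bar> \<le> exp a" for m s
    proof -
      have "(\<Sum>n<m. a ^ n / fact n * p s ^ n) \<le> exp (a * p s)"
        using a p01 es[of s] by (subst sums_unique[OF es[of s]], intro sum_le_suminf) (auto simp: sums_iff)
      moreover have "0 \<le> (\<Sum>n<m. a ^ n / fact n * p s ^ n)" using a p01 by (intro sum_nonneg) auto
      ultimately show ?thesis using order_trans[OF _ e[of s]] by (simp only: abs_of_nonneg)
    qed
    show "(\<lambda>m. \<Sum>n<m. a ^ n / fact n * p s ^ n) \<longlonglongrightarrow> exp (a * p s)" for s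
      using es[of s] by (simp add: sums_def)
  qed measurable
  from posdef_cmult_exp[OF this, of "exp (- a)" 0]
  have "posdef TYPE('a) (\<lambda>s. exp (- a) * exp (a * p s))" by simp
  then show ?thesis by (simp add: p_def algebra_simps flip: exp_add)
qed

text \<open>Subordination by discretisation: n (1 - exp(-s/n)) tends to s, so the factor n^\<alpha>
  is put into the parameter a of the previous lemma and l is taken to be 1/n.\<close>

lemma posdef_exp_powr:
  assumes \<alpha>: "0 < \<alpha>" "\<alpha> \<le> 1" and t: "0 < t"
  shows "posdef TYPE('a::euclidean_space) (\<lambda>s. exp (- t * \<bar>s\<bar> powr \<alpha>))"
proof (rule posdef_lim[where B = 1])
  show "posdef TYPE('a) (\<lambda>s. exp (- (t * real (Suc n) powr \<alpha>) * (1 - exp (- (1 / real (Suc n)) * \<bar>s\<bar>)) powr \<alpha>))" for n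
    using \<alpha> t by (intro posdef_exp_one_minus_powr) auto
  fix s :: real assume s: "s > 0"
  have "(\<lambda>n. real (Suc n) * (1 - exp (- (1 / real (Suc n)) * s))) \<longlonglongrightarrow> s"
    using s by real_asymp
  then have "(\<lambda>n. exp (- t * (real (Suc n) * (1 - exp (- (1 / real (Suc n)) * s))) powr \<alpha>)) \<longlonglongrightarrow> exp (- t * s powr \<alpha>)"
    using s by (intro tendsto_intros) auto
  then show "(\<lambda>n. exp (- (t * real (Suc n) powr \<alpha>) * (1 - exp (- (1 / real (Suc n)) * \<bar>s\<bar>)) powr \<alpha>)) \<longlonglongrightarrow> exp (- t * \<bar>s\<bar> powr \<alpha>)"
    using s by (simp add: powr_mult mult.assoc)
qed (use t in \<open>auto intro!: mult_nonneg_nonneg\<close>)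

section \<open>Sign, mass, Fourier transform and semigroup law of the kernel\<close>

lemma frac_heat_kernel_nonneg:
  fixes x :: "'a::euclidean_space"
  assumes \<theta>: "0 < \<theta>" "\<theta> \<le> 2" and t: "0 < t"
  shows "0 \<le> frac_heat_kernel \<theta> x t"
proof -
  let ?m = "\<lambda>\<xi>::'a. exp (- t * norm \<xi> powr \<theta>)"
  have sq: "\<bar>(norm \<xi>)\<^sup>2\<bar> powr (\<theta> / 2) = norm \<xi> powr \<theta>" for \<xi> :: 'a
    by (simp add: powr_powr flip: powr_numeral)
  have "(\<lambda>n. LBINT \<xi>. cos (x \<bullet> \<xi>) * ?m \<xi> * exp (- (1 / real (Suc n)) * (norm \<xi>)\<^sup>2))
      \<longlonglongrightarrow> (LBINT \<xi>. cos (x \<bullet> \<xi>) * ?m \<xi>)"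
  proof (rule integral_dominated_convergence)
    show "integrable lborel ?m" using t \<theta> by (intro integrable_exp_norm_powr)
    show "AE \<xi> in lborel. (\<lambda>n. cos (x \<bullet> \<xi>) * ?m \<xi> * exp (- (1 / real (Suc n)) * (norm \<xi>)\<^sup>2)) \<longlonglongrightarrow> cos (x \<bullet> \<xi>) * ?m \<xi>"
    proof (rule AE_I2)
      fix \<xi> :: 'a
      have "(\<lambda>n. exp (- (1 / real (Suc n)) * (norm \<xi>)\<^sup>2)) \<longlonglongrightarrow> 1" by real_asymp
      from tendsto_mult[OF tendsto_const this, of "cos (x \<bullet> \<xi>) * ?m \<xi>"]
      show "(\<lambda>n. cos (x \<bullet> \<xi>) * ?m \<xi> * exp (- (1 / real (Suc n)) * (norm \<xi>)\<^sup>2)) \<longlonglongrightarrow> cos (x \<bullet> \<xi>) * ?m \<xi>" by simp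
    qed
    show "AE \<xi> in lborel. norm (cos (x \<bullet> \<xi>) * ?m \<xi> * exp (- (1 / real (Suc n)) * (norm \<xi>)\<^sup>2)) \<le> ?m \<xi>" for n
    proof (rule AE_I2)
      fix \<xi> :: 'a
      have "\<bar>cos (x \<bullet> \<xi>)\<bar> * (?m \<xi> * exp (- (1 / real (Suc n)) * (norm \<xi>)\<^sup>2)) \<le> 1 * (?m \<xi> * 1)"
        by (intro mult_mono) auto
      then show "norm (cos (x \<bullet> \<xi>) * ?m \<xi> * exp (- (1 / real (Suc n)) * (norm \<xi>)\<^sup>2)) \<le> ?m \<xi>"
        by (simp add: abs_mult mult.assoc)
    qed
  qed measurable
  moreover have "\<forall>x::'a. \<forall>\<delta>>0. 0 \<le> (LBINT \<xi>. cos (x \<bullet> \<xi>) * ?m \<xi> * exp (- \<delta> * (norm \<xi>)\<^sup>2))"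
    using posdef_exp_powr[of "\<theta> / 2" t, where 'a='a] \<theta> t unfolding posdef_def sq by fastforce
  then have "0 \<le> (LBINT \<xi>. cos (x \<bullet> \<xi>) * ?m \<xi> * exp (- (1 / real (Suc n)) * (norm \<xi>)\<^sup>2))" for n
    by (elim allE[of _ x] allE[of _ "1 / real (Suc n)"]) simp
  ultimately have "0 \<le> (LBINT \<xi>. cos (x \<bullet> \<xi>) * ?m \<xi>)"
    by (intro LIMSEQ_le_const) auto
  then show ?thesis by (simp add: frac_heat_kernel_def)
qed

lemma frac_heat_kernel_minus: "frac_heat_kernel \<theta> (- x) t = frac_heat_kernel \<theta> x t"
  by (simp add: frac_heat_kernel_def)

lemma borel_measurable_frac_heat_kernel [measurable]:
  fixes X :: "'b \<Rightarrow> 'a::euclidean_space"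
  assumes [measurable]: "X \<in> borel_measurable M" "\<tau> \<in> borel_measurable M"
  shows "(\<lambda>z. frac_heat_kernel \<theta> (X z) (\<tau> z)) \<in> borel_measurable M"
proof -
  have "(\<lambda>z. LBINT \<xi>::'a. cos (fst z \<bullet> \<xi>) * exp (- snd z * norm \<xi> powr \<theta>)) \<in> borel_measurable (borel \<Otimes>\<^sub>M borel)"
    by (rule lborel.borel_measurable_lebesgue_integral) (unfold split_beta', measurable)
  then have "(\<lambda>z::'a \<times> real. frac_heat_kernel \<theta> (fst z) (snd z)) \<in> borel_measurable (borel \<Otimes>\<^sub>M borel)"
    unfolding frac_heat_kernel_def by (intro borel_measurable_times borel_measurable_const)
  from measurable_compose[OF measurable_Pair[OF assms] this] show ?thesis by simp
qed

lemma abs_frac_heat_kernel_le: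
  fixes x :: "'a::euclidean_space"
  assumes "0 < t" "0 < \<theta>"
  shows "\<bar>frac_heat_kernel \<theta> x t\<bar> \<le> frac_heat_kernel \<theta> (0::'a) t"
proof -
  have "\<bar>LBINT \<xi>. cos (x \<bullet> \<xi>) * exp (- t * norm \<xi> powr \<theta>)\<bar> \<le> (LBINT \<xi>. exp (- t * norm (\<xi>::'a) powr \<theta>))"
    by (rule integral_abs_bound[THEN order_trans], rule integral_mono')
       (auto simp: abs_mult mult_left_le_one_le intro: integrable_exp_norm_powr[OF assms, simplified])
  then show ?thesis by (simp add: frac_heat_kernel_def abs_mult mult_left_mono)
qed

lemma frac_heat_kernel_zero_scale:
  assumes t: "0 < t" and \<theta>: "0 < \<theta>"
  shows "frac_heat_kernel \<theta> (0::'a::euclidean_space) t =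
    t powr (- (real DIM('a) / \<theta>)) * frac_heat_kernel \<theta> (0::'a) 1"
proof -
  define c where "c = t powr (- 1 / \<theta>)"
  have c: "c > 0" "t * c powr \<theta> = 1" using t \<theta> by (auto simp: c_def powr_powr powr_neg_one)
  have "(LBINT \<xi>. exp (- t * norm (\<xi>::'a) powr \<theta>)) = \<bar>c\<bar> ^ DIM('a) * (LBINT \<xi>. exp (- t * norm (0 + c *\<^sub>R \<xi>::'a) powr \<theta>))"
    using c by (intro integral_lborel_affine) auto
  also have "(LBINT \<xi>. exp (- t * norm (0 + c *\<^sub>R \<xi>::'a) powr \<theta>)) = (LBINT \<xi>. exp (- 1 * norm (\<xi>::'a) powr \<theta>))"
    using c by (intro Bochner_Integration.integral_cong refl) (simp add: powr_mult mult.assoc[symmetric])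
  also have "\<bar>c\<bar> ^ DIM('a) = t powr (- (real DIM('a) / \<theta>))"
    using t by (simp add: c_def powr_powr flip: powr_realpow)
  finally show ?thesis by (simp add: frac_heat_kernel_def)
qed

text \<open>Fourier inversion, regularised by a Gaussian so that Fubini applies.\<close>
lemma frac_heat_kernel_fourier_gaussian:
  fixes \<eta> :: "'a::euclidean_space"
  assumes t: "0 < t" and \<theta>: "0 < \<theta>" and \<delta>: "0 < \<delta>"
  shows "(LBINT x. frac_heat_kernel \<theta> x t * (cos (x \<bullet> \<eta>) * exp (- \<delta> * (norm x)\<^sup>2))) =
    (LBINT \<zeta>. exp (- t * norm (\<eta> + (2 * sqrt \<delta>) *\<^sub>R \<zeta>) powr \<theta>) * exp (- (norm \<zeta>)\<^sup>2)) / sqrt pi ^ DIM('a)"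
proof -
  let ?N = "DIM('a)"
  let ?m = "\<lambda>\<xi>::'a. exp (- t * norm \<xi> powr \<theta>)"
  let ?e = "\<lambda>x::'a. exp (- \<delta> * (norm x)\<^sup>2)"
  let ?K = "(2 * pi) powr (- real ?N)"
  \<comment> \<open>The Gaussian transforms to \<open>g\<close>, of width proportional to c; the
    substitution \<open>\<xi> = \<eta> + c \<zeta>\<close> normalises it to
    exp(-|\<zeta>|^2).\<close>
  define c where "c = 2 * sqrt \<delta>"
  have c: "c > 0" "c\<^sup>2 = 4 * \<delta>" using \<delta> by (auto simp: c_def power_mult_distrib)
  note im = integrable_exp_norm_powr[OF t \<theta>, where 'a='a]
  note ie = integrable_gaussian[OF \<delta>, where 'a='a]
  have I: "integrable (lborel \<Otimes>\<^sub>M lborel) (\<lambda>(x, \<xi>). (cos (x \<bullet> \<xi>) * ?m \<xi>) * (cos (x \<bullet> \<eta>) * ?e x))"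
  proof (rule Bochner_Integration.integrable_bound[OF integrable_tensor[OF ie im]])
    show "AE z in lborel \<Otimes>\<^sub>M lborel. norm (case z of (x, \<xi>) \<Rightarrow> cos (x \<bullet> \<xi>) * ?m \<xi> * (cos (x \<bullet> \<eta>) * ?e x))
       \<le> norm (case z of (x, \<xi>) \<Rightarrow> ?e x * ?m \<xi>)"
    proof (rule AE_I2, clarify)
      fix x \<xi> :: 'a
      have "(\<bar>cos (x \<bullet> \<xi>)\<bar> * \<bar>cos (x \<bullet> \<eta>)\<bar>) * (?e x * ?m \<xi>) \<le> (1 * 1) * (?e x * ?m \<xi>)"
        by (intro mult_right_mono mult_mono) auto
      then show "norm (cos (x \<bullet> \<xi>) * ?m \<xi> * (cos (x \<bullet> \<eta>) * ?e x)) \<le> norm (?e x * ?m \<xi>)"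
        by (simp add: abs_mult ac_simps)
    qed
  qed measurable
  define g where "g = (\<lambda>\<xi>::'a. exp (- (norm \<xi>)\<^sup>2 / (4 * \<delta>)))"
  have gm[measurable]: "g \<in> borel_measurable borel" unfolding g_def by measurable
  have g1: "\<bar>g \<xi>\<bar> \<le> 1" for \<xi> using \<delta> by (simp add: g_def)
  have img: "integrable lborel (\<lambda>\<xi>. ?m \<xi> * g (\<xi> - a))" for a
    by (rule Bochner_Integration.integrable_bound[OF im]) (use g1 in \<open>auto simp: abs_mult mult_left_le\<close>)
  \<comment> \<open>The product of the two cosines is half the sum of the cosines with frequencies
    \<xi> - \<eta> and \<xi> + \<eta>. This produces Gaussians centred at \<eta> and -\<eta>, whose
    contributions agree because the symbol is even.\<close>
  have inner: "(LBINT x. cos (x \<bullet> \<xi>) * ?m \<xi> * (cos (x \<bullet> \<eta>) * ?e x)) =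
      sqrt (pi / \<delta>) ^ ?N / 2 * (?m \<xi> * g (\<xi> - \<eta>) + ?m \<xi> * g (\<xi> - (- \<eta>)))" for \<xi>
  proof -
    have "(LBINT x. cos (x \<bullet> \<xi>) * ?m \<xi> * (cos (x \<bullet> \<eta>) * ?e x)) =
       (LBINT x. ?m \<xi> / 2 * (cos ((\<xi> - \<eta>) \<bullet> x) * ?e x + cos ((\<xi> + \<eta>) \<bullet> x) * ?e x))"
      by (intro Bochner_Integration.integral_cong refl)
         (simp add: inner_diff_left inner_add_left inner_diff_right inner_add_right cos_add cos_diff inner_commute field_simps)
    also have "\<dots> = ?m \<xi> / 2 * ((LBINT x. cos ((\<xi> - \<eta>) \<bullet> x) * ?e x) + (LBINT x. cos ((\<xi> + \<eta>) \<bullet> x) * ?e x))"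
      by (subst integral_mult_right_zero, subst Bochner_Integration.integral_add)
         (intro gaussian_fourier(1)[OF \<delta>] refl)+
    also have "\<dots> = ?m \<xi> / 2 * (sqrt (pi / \<delta>) ^ ?N * g (\<xi> - \<eta>) + sqrt (pi / \<delta>) ^ ?N * g (\<xi> + \<eta>))"
      unfolding gaussian_fourier(2)[OF \<delta>] g_def ..
    finally show ?thesis by (simp add: algebra_simps)
  qed
  have even: "(LBINT \<xi>. ?m \<xi> * g (\<xi> - (- \<eta>))) = (LBINT \<xi>. ?m \<xi> * g (\<xi> - \<eta>))"
  proof -
    have "(LBINT \<xi>. ?m \<xi> * g (\<xi> - (- \<eta>))) = \<bar>- 1\<bar> ^ ?N * (LBINT \<xi>. ?m (0 + (- 1) *\<^sub>R \<xi>) * g ((0 + (- 1) *\<^sub>R \<xi>) - (- \<eta>)))"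
      by (intro integral_lborel_affine) auto
    then show ?thesis by (simp add: g_def norm_minus_commute)
  qed
  have "(LBINT x. frac_heat_kernel \<theta> x t * (cos (x \<bullet> \<eta>) * ?e x)) =
     ?K * (LBINT x. LBINT \<xi>. cos (x \<bullet> \<xi>) * ?m \<xi> * (cos (x \<bullet> \<eta>) * ?e x))"
  proof -
    have "frac_heat_kernel \<theta> x t * (cos (x \<bullet> \<eta>) * ?e x) = ?K * (LBINT \<xi>. cos (x \<bullet> \<xi>) * ?m \<xi> * (cos (x \<bullet> \<eta>) * ?e x))" for x
      by (subst integral_mult_left_zero) (simp only: frac_heat_kernel_def[of \<theta> x] mult.assoc)
    then show ?thesis by (simp only: integral_mult_right_zero)
  qed
  also have "(LBINT x. LBINT \<xi>. cos (x \<bullet> \<xi>) * ?m \<xi> * (cos (x \<bullet> \<eta>) * ?e x)) =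
     (LBINT \<xi>. LBINT x. cos (x \<bullet> \<xi>) * ?m \<xi> * (cos (x \<bullet> \<eta>) * ?e x))"
    by (rule lborel_pair.Fubini_integral[OF I, symmetric])
  also have "\<dots> = sqrt (pi / \<delta>) ^ ?N / 2 * ((LBINT \<xi>. ?m \<xi> * g (\<xi> - \<eta>)) + (LBINT \<xi>. ?m \<xi> * g (\<xi> - (- \<eta>))))"
    unfolding inner by (subst integral_mult_right_zero, subst Bochner_Integration.integral_add) (intro img refl)+
  also have "\<dots> = sqrt (pi / \<delta>) ^ ?N * (LBINT \<xi>. ?m \<xi> * g (\<xi> - \<eta>))"
    unfolding even by simp
  also have "(LBINT \<xi>. ?m \<xi> * g (\<xi> - \<eta>)) = \<bar>c\<bar> ^ ?N * (LBINT \<zeta>. ?m (\<eta> + c *\<^sub>R \<zeta>) * g ((\<eta> + c *\<^sub>R \<zeta>) - \<eta>))"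
    using c by (intro integral_lborel_affine) auto
  also have "(LBINT \<zeta>. ?m (\<eta> + c *\<^sub>R \<zeta>) * g ((\<eta> + c *\<^sub>R \<zeta>) - \<eta>)) = (LBINT \<zeta>. ?m (\<eta> + c *\<^sub>R \<zeta>) * exp (- (norm \<zeta>)\<^sup>2))"
    using c \<delta> by (simp add: g_def power_mult_distrib)
  also have "?K * (sqrt (pi / \<delta>) ^ ?N * (\<bar>c\<bar> ^ ?N * (LBINT \<zeta>. ?m (\<eta> + c *\<^sub>R \<zeta>) * exp (- (norm \<zeta>)\<^sup>2)))) =
     (LBINT \<zeta>. ?m (\<eta> + c *\<^sub>R \<zeta>) * exp (- (norm \<zeta>)\<^sup>2)) / sqrt pi ^ ?N"
  proof -
    have "?K = 1 / (2 * pi) ^ ?N" by (simp add: powr_minus powr_realpow divide_simps)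
    moreover have "1 / (2 * pi) ^ ?N * (sqrt (pi / \<delta>) ^ ?N * \<bar>c\<bar> ^ ?N) = 1 / sqrt pi ^ ?N"
    proof -
      have "1 / (2 * pi) * (sqrt (pi / \<delta>) * \<bar>c\<bar>) = 1 / sqrt pi"
        using \<delta> by (simp add: c_def real_sqrt_divide field_simps)
      then have "(1 / (2 * pi) * (sqrt (pi / \<delta>) * \<bar>c\<bar>)) ^ ?N = (1 / sqrt pi) ^ ?N" by simp
      then show ?thesis by (simp add: power_mult_distrib power_divide)
    qed
    ultimately show ?thesis by (metis (no_types, lifting) mult.assoc times_divide_eq_left mult_1)
  qed
  finally show ?thesis unfolding c_def .
qed

lemma integral_gaussian_one: "(LBINT \<zeta>::'a::euclidean_space. exp (- (norm \<zeta>)\<^sup>2)) = sqrt pi ^ DIM('a)"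
  using integral_gaussian[of 1, where 'a='a] by simp

lemma integrable_gaussian_one: "integrable lborel (\<lambda>\<zeta>::'a::euclidean_space. exp (- (norm \<zeta>)\<^sup>2))"
  using integrable_gaussian[of 1, where 'a='a] by simp

text \<open>The regularised inversion formula averages a continuous bounded function over a Gaussian
  whose width shrinks to zero.\<close>

lemma gaussian_average_tendsto:
  fixes \<eta> :: "'a::euclidean_space"
  assumes t: "0 < t" and \<theta>: "0 < \<theta>" and \<delta>: "\<delta> \<longlonglongrightarrow> 0"
  shows "(\<lambda>n. (LBINT \<zeta>. exp (- t * norm (\<eta> + (2 * sqrt (\<delta> n)) *\<^sub>R \<zeta>) powr \<theta>) * exp (- (norm \<zeta>)\<^sup>2)) / sqrt pi ^ DIM('a))
     \<longlonglongrightarrow> exp (- t * norm \<eta> powr \<theta>)"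
proof -
  have "(\<lambda>n. LBINT \<zeta>. exp (- t * norm (\<eta> + (2 * sqrt (\<delta> n)) *\<^sub>R \<zeta>) powr \<theta>) * exp (- (norm \<zeta>)\<^sup>2))
     \<longlonglongrightarrow> (LBINT \<zeta>::'a. exp (- t * norm \<eta> powr \<theta>) * exp (- (norm \<zeta>)\<^sup>2))"
  proof (rule integral_dominated_convergence[OF _ _ integrable_gaussian_one])
    show "AE \<zeta> in lborel. (\<lambda>n. exp (- t * norm (\<eta> + (2 * sqrt (\<delta> n)) *\<^sub>R \<zeta>) powr \<theta>) * exp (- (norm \<zeta>)\<^sup>2))
       \<longlonglongrightarrow> exp (- t * norm \<eta> powr \<theta>) * exp (- (norm \<zeta>)\<^sup>2)"
    proof (rule AE_I2)
      fix \<zeta> :: 'a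
      have "(\<lambda>n. norm (\<eta> + (2 * sqrt (\<delta> n)) *\<^sub>R \<zeta>)) \<longlonglongrightarrow> norm (\<eta> + (2 * sqrt 0) *\<^sub>R \<zeta>)"
        by (intro tendsto_intros \<delta>)
      then have "(\<lambda>n. norm (\<eta> + (2 * sqrt (\<delta> n)) *\<^sub>R \<zeta>) powr \<theta>) \<longlonglongrightarrow> norm \<eta> powr \<theta>"
        using \<theta> by (intro tendsto_powr2) auto
      then show "(\<lambda>n. exp (- t * norm (\<eta> + (2 * sqrt (\<delta> n)) *\<^sub>R \<zeta>) powr \<theta>) * exp (- (norm \<zeta>)\<^sup>2))
         \<longlonglongrightarrow> exp (- t * norm \<eta> powr \<theta>) * exp (- (norm \<zeta>)\<^sup>2)"
        by (intro tendsto_mult tendsto_exp tendsto_const)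
    qed
    show "AE \<zeta> in lborel. norm (exp (- t * norm (\<eta> + (2 * sqrt (\<delta> n)) *\<^sub>R \<zeta>) powr \<theta>) * exp (- (norm \<zeta>)\<^sup>2)) \<le> exp (- (norm \<zeta>)\<^sup>2)" for n
      using t by (auto simp: mult_left_le_one_le)
  qed measurable
  then have "(\<lambda>n. LBINT \<zeta>. exp (- t * norm (\<eta> + (2 * sqrt (\<delta> n)) *\<^sub>R \<zeta>) powr \<theta>) * exp (- (norm \<zeta>)\<^sup>2))
     \<longlonglongrightarrow> exp (- t * norm \<eta> powr \<theta>) * sqrt pi ^ DIM('a)"
    by (simp add: integral_gaussian_one)
  from tendsto_divide[OF this tendsto_const[of "sqrt pi ^ DIM('a)"]] show ?thesis by simp
qed

context
  fixes \<theta> :: real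
  assumes \<theta>: "0 < \<theta>" "\<theta> \<le> 2"
begin

text \<open>Since the kernel is nonnegative, removing the Gaussian cut-off is a monotone limit. The
  inversion formula at \<eta> = 0 therefore yields integrability and total mass together, without
  any decay estimate.\<close>

lemma frac_heat_kernel_integral:
  fixes t :: real
  assumes t: "0 < t"
  shows "integrable lborel (\<lambda>x::'a::euclidean_space. frac_heat_kernel \<theta> x t)"
    and "(LBINT x::'a. frac_heat_kernel \<theta> x t) = 1"
proof -
  let ?G = "\<lambda>x::'a. frac_heat_kernel \<theta> x t"
  define \<delta> where "\<delta> = (\<lambda>n. 1 / real (Suc n))"
  have \<delta>: "\<delta> \<longlonglongrightarrow> 0" "\<And>n. \<delta> n > 0" unfolding \<delta>_def by real_asymp auto
  have G0: "0 \<le> ?G x" for x using frac_heat_kernel_nonneg[OF \<theta> t] .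
  have lim: "(\<lambda>n. LBINT x. ?G x * exp (- \<delta> n * (norm x)\<^sup>2)) \<longlonglongrightarrow> 1"
    using gaussian_average_tendsto[OF t \<theta>(1) \<delta>(1), of 0] frac_heat_kernel_fourier_gaussian[OF t \<theta>(1) \<delta>(2), of "0::'a"] \<theta>
    by simp
  have int: "integrable lborel (\<lambda>x. ?G x * exp (- \<delta> n * (norm x)\<^sup>2))" for n
  proof (rule Bochner_Integration.integrable_bound)
    show "integrable lborel (\<lambda>x::'a. frac_heat_kernel \<theta> (0::'a) t * exp (- \<delta> n * (norm x)\<^sup>2))"
      using integrable_gaussian[OF \<delta>(2), where 'a='a] by (intro integrable_mult_right)
    show "AE x in lborel. norm (?G x * exp (- \<delta> n * (norm x)\<^sup>2)) \<le> norm (frac_heat_kernel \<theta> (0::'a) t * exp (- \<delta> n * (norm x)\<^sup>2))"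
      using abs_frac_heat_kernel_le[OF t \<theta>(1), where 'a='a] by (intro AE_I2) (auto simp: abs_mult intro!: mult_right_mono intro: order_trans[OF _ abs_ge_self])
  qed measurable
  have conv: "(\<lambda>n. ?G x * exp (- \<delta> n * (norm x)\<^sup>2)) \<longlonglongrightarrow> ?G x" for x
  proof -
    have "(\<lambda>n. ?G x * exp (- \<delta> n * (norm x)\<^sup>2)) \<longlonglongrightarrow> ?G x * exp (- 0 * (norm x)\<^sup>2)"
      by (intro tendsto_intros \<delta>)
    then show ?thesis by simp
  qed
  have "has_bochner_integral lborel ?G 1"
  proof (rule has_bochner_integral_monotone_convergence[OF int _ _ lim])
    show "AE x in lborel. mono (\<lambda>n. ?G x * exp (- \<delta> n * (norm x)\<^sup>2))"
    proof (intro AE_I2 monoI mult_left_mono)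
      fix x :: 'a and n m :: nat assume "n \<le> m"
      then have "\<delta> m \<le> \<delta> n" by (simp add: \<delta>_def divide_simps)
      then show "exp (- \<delta> n * (norm x)\<^sup>2) \<le> exp (- \<delta> m * (norm x)\<^sup>2)"
        by (simp add: mult_right_mono)
    qed (rule G0)
  qed (use conv in auto)
  then show "integrable lborel ?G" "(LBINT x. ?G x) = 1" by (auto simp: has_bochner_integral_iff)
qed

lemma frac_heat_kernel_fourier:
  fixes \<eta> :: "'a::euclidean_space"
  assumes t: "0 < t"
  shows "(LBINT x. frac_heat_kernel \<theta> x t * cos (x \<bullet> \<eta>)) = exp (- t * norm \<eta> powr \<theta>)"
proof -
  let ?G = "\<lambda>x::'a. frac_heat_kernel \<theta> x t"
  define \<delta> where "\<delta> = (\<lambda>n. 1 / real (Suc n))"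
  have \<delta>: "\<delta> \<longlonglongrightarrow> 0" "\<And>n. \<delta> n > 0" unfolding \<delta>_def by real_asymp auto
  have "(\<lambda>n. LBINT x. ?G x * (cos (x \<bullet> \<eta>) * exp (- \<delta> n * (norm x)\<^sup>2))) \<longlonglongrightarrow> (LBINT x. ?G x * cos (x \<bullet> \<eta>))"
  proof (rule integral_dominated_convergence[OF _ _ frac_heat_kernel_integral(1)[OF t]])
    show "AE x in lborel. (\<lambda>n. ?G x * (cos (x \<bullet> \<eta>) * exp (- \<delta> n * (norm x)\<^sup>2))) \<longlonglongrightarrow> ?G x * cos (x \<bullet> \<eta>)"
    proof (rule AE_I2)
      fix x :: 'a
      have "(\<lambda>n. ?G x * (cos (x \<bullet> \<eta>) * exp (- \<delta> n * (norm x)\<^sup>2))) \<longlonglongrightarrow> ?G x * (cos (x \<bullet> \<eta>) * exp (- 0 * (norm x)\<^sup>2))"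
        by (intro tendsto_intros \<delta>)
      then show "(\<lambda>n. ?G x * (cos (x \<bullet> \<eta>) * exp (- \<delta> n * (norm x)\<^sup>2))) \<longlonglongrightarrow> ?G x * cos (x \<bullet> \<eta>)" by simp
    qed
    show "AE x in lborel. norm (?G x * (cos (x \<bullet> \<eta>) * exp (- \<delta> n * (norm x)\<^sup>2))) \<le> ?G x" for n
    proof (rule AE_I2)
      fix x :: 'a
      have "\<bar>cos (x \<bullet> \<eta>)\<bar> * exp (- \<delta> n * (norm x)\<^sup>2) \<le> 1 * 1"
        using \<delta>(2)[of n] by (intro mult_mono) auto
      then show "norm (?G x * (cos (x \<bullet> \<eta>) * exp (- \<delta> n * (norm x)\<^sup>2))) \<le> ?G x"
        using frac_heat_kernel_nonneg[OF \<theta> t, of x] by (simp add: abs_mult mult_left_le)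
    qed
  qed measurable
  moreover have "(\<lambda>n. LBINT x. ?G x * (cos (x \<bullet> \<eta>) * exp (- \<delta> n * (norm x)\<^sup>2))) \<longlonglongrightarrow> exp (- t * norm \<eta> powr \<theta>)"
    using gaussian_average_tendsto[OF t \<theta>(1) \<delta>(1), of \<eta>] unfolding frac_heat_kernel_fourier_gaussian[OF t \<theta>(1) \<delta>(2)] .
  ultimately show ?thesis by (rule LIMSEQ_unique)
qed

text \<open>Only one of the two kernels is expanded as a Fourier integral; the other stays an
  integrable function with known transform, so the double integral converges absolutely. Its sine
  transform vanishes because the kernel is even.\<close>

lemma frac_heat_kernel_convolution:
  fixes x :: "'a::euclidean_space"
  assumes t: "0 < t" and s: "0 < s"
  shows "(LBINT y. frac_heat_kernel \<theta> (x - y) t * frac_heat_kernel \<theta> y s) = frac_heat_kernel \<theta> x (t + s)"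
proof -
  let ?m = "\<lambda>t. \<lambda>\<xi>::'a. exp (- t * norm \<xi> powr \<theta>)"
  let ?G = "\<lambda>y::'a. frac_heat_kernel \<theta> y s"
  let ?K = "(2 * pi) powr (- real DIM('a))"
  note im = integrable_exp_norm_powr[OF t \<theta>(1), where 'a='a]
  note iG = frac_heat_kernel_integral(1)[OF s, where 'a='a]
  have I: "integrable (lborel \<Otimes>\<^sub>M lborel) (\<lambda>(y, \<xi>). (cos ((x - y) \<bullet> \<xi>) * ?m t \<xi>) * ?G y)"
  proof (rule Bochner_Integration.integrable_bound[OF integrable_tensor[OF iG im]])
    show "AE z in lborel \<Otimes>\<^sub>M lborel. norm (case z of (y, \<xi>) \<Rightarrow> cos ((x - y) \<bullet> \<xi>) * ?m t \<xi> * ?G y)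
       \<le> norm (case z of (y, \<xi>) \<Rightarrow> ?G y * ?m t \<xi>)"
    proof (rule AE_I2, clarify)
      fix y \<xi> :: 'a
      have "\<bar>cos ((x - y) \<bullet> \<xi>)\<bar> * (\<bar>?G y\<bar> * ?m t \<xi>) \<le> 1 * (\<bar>?G y\<bar> * ?m t \<xi>)"
        by (intro mult_right_mono) auto
      then show "norm (cos ((x - y) \<bullet> \<xi>) * ?m t \<xi> * ?G y) \<le> norm (?G y * ?m t \<xi>)"
        by (simp add: abs_mult ac_simps)
    qed
  qed measurable
  have iGc: "integrable lborel (\<lambda>y. ?G y * h y)" if [measurable]: "h \<in> borel_measurable borel" and h: "\<And>y. \<bar>h y\<bar> \<le> 1" for h
    by (rule Bochner_Integration.integrable_bound[OF iG]) (auto simp: abs_mult h mult_left_le)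
  have odd: "(LBINT y. ?G y * sin (y \<bullet> \<xi>)) = 0" for \<xi>
  proof -
    have "(LBINT y. ?G y * sin (y \<bullet> \<xi>)) = \<bar>- 1\<bar> ^ DIM('a) * (LBINT y. ?G (0 + (- 1) *\<^sub>R y) * sin ((0 + (- 1) *\<^sub>R y) \<bullet> \<xi>))"
      by (intro integral_lborel_affine) auto
    then show ?thesis by (simp add: frac_heat_kernel_minus)
  qed
  have inner: "(LBINT y. cos ((x - y) \<bullet> \<xi>) * ?m t \<xi> * ?G y) = cos (x \<bullet> \<xi>) * ?m (t + s) \<xi>" for \<xi>
  proof -
    have "(LBINT y. cos ((x - y) \<bullet> \<xi>) * ?m t \<xi> * ?G y) =
       (LBINT y. ?m t \<xi> * cos (x \<bullet> \<xi>) * (?G y * cos (y \<bullet> \<xi>)) + ?m t \<xi> * sin (x \<bullet> \<xi>) * (?G y * sin (y \<bullet> \<xi>)))"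
      by (intro Bochner_Integration.integral_cong refl) (simp add: inner_diff_left cos_diff algebra_simps)
    also have "\<dots> = ?m t \<xi> * cos (x \<bullet> \<xi>) * (LBINT y. ?G y * cos (y \<bullet> \<xi>)) + ?m t \<xi> * sin (x \<bullet> \<xi>) * (LBINT y. ?G y * sin (y \<bullet> \<xi>))"
      by (subst Bochner_Integration.integral_add) (auto intro!: integrable_mult_right iGc)
    also have "\<dots> = cos (x \<bullet> \<xi>) * ?m (t + s) \<xi>"
      unfolding odd frac_heat_kernel_fourier[OF s] by (simp add: exp_add[symmetric] algebra_simps)
    finally show ?thesis .
  qed
  have "(LBINT y. frac_heat_kernel \<theta> (x - y) t * ?G y) = ?K * (LBINT y. LBINT \<xi>. cos ((x - y) \<bullet> \<xi>) * ?m t \<xi> * ?G y)"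
  proof -
    have "frac_heat_kernel \<theta> (x - y) t * ?G y = ?K * (LBINT \<xi>. cos ((x - y) \<bullet> \<xi>) * ?m t \<xi> * ?G y)" for y
      by (subst integral_mult_left_zero) (simp only: frac_heat_kernel_def[of \<theta> "x - y"] mult.assoc)
    then show ?thesis by (simp only: integral_mult_right_zero)
  qed
  also have "(LBINT y. LBINT \<xi>. cos ((x - y) \<bullet> \<xi>) * ?m t \<xi> * ?G y) = (LBINT \<xi>. LBINT y. cos ((x - y) \<bullet> \<xi>) * ?m t \<xi> * ?G y)"
    by (rule lborel_pair.Fubini_integral[OF I, symmetric])
  also have "?K * \<dots> = frac_heat_kernel \<theta> x (t + s)"
    by (simp only: inner frac_heat_kernel_def[of \<theta> x])
  finally show ?thesis .
qed

end

lemma nn_integral_lborel_reflect: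
  fixes h :: "'a::euclidean_space \<Rightarrow> ennreal"
  assumes [measurable]: "h \<in> borel_measurable borel"
  shows "(\<integral>\<^sup>+y. h (x - y) \<partial>lborel) = (\<integral>\<^sup>+y. h y \<partial>lborel)"
proof -
  have "(\<integral>\<^sup>+y. h y \<partial>lborel) = (\<integral>\<^sup>+y. h y \<partial>density (distr lborel borel (\<lambda>y. x + (- 1) *\<^sub>R y)) (\<lambda>_. ennreal (\<bar>- 1\<bar> ^ DIM('a))))"
    by (subst lborel_affine[of "- 1" x]) (simp_all only: neg_equal_0_iff_equal one_neq_zero not_False_eq_True)
  also have "\<dots> = (\<integral>\<^sup>+y. h (x + (- 1) *\<^sub>R y) \<partial>lborel)"
    by (subst nn_integral_density) (auto simp: nn_integral_distr)
  finally show ?thesis by simp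
qed

section \<open>Tail, moment and smoothing estimates for the kernel\<close>

lemma powr_norm_le_gaussian:
  assumes "0 < \<theta>" "\<theta> \<le> 2"
  shows "norm \<zeta> powr \<theta> * exp (- (norm \<zeta>)\<^sup>2) \<le> 2 * exp (- (1 / 2) * (norm \<zeta>)\<^sup>2)"
proof -
  have "norm \<zeta> powr \<theta> \<le> 1 + (norm \<zeta>)\<^sup>2"
  proof (cases "norm \<zeta> \<le> 1")
    case True
    then have "norm \<zeta> powr \<theta> \<le> 1" using assms powr_mono2[of \<theta> "norm \<zeta>" 1] by simp
    then show ?thesis by (simp add: add_increasing2)
  next
    case False
    then have "norm \<zeta> powr \<theta> \<le> norm \<zeta> powr 2" using assms by (intro powr_mono) auto
    then show ?thesis using False by simp
  qed
  also have "\<dots> \<le> 2 * exp ((norm \<zeta>)\<^sup>2 / 2)"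
    using exp_ge_add_one_self[of "(norm \<zeta>)\<^sup>2 / 2"] by linarith
  finally have "norm \<zeta> powr \<theta> * exp (- (norm \<zeta>)\<^sup>2) \<le> 2 * exp ((norm \<zeta>)\<^sup>2 / 2) * exp (- (norm \<zeta>)\<^sup>2)"
    by (intro mult_right_mono) auto
  also have "\<dots> = 2 * exp (- (1 / 2) * (norm \<zeta>)\<^sup>2)" by (simp flip: exp_add)
  finally show ?thesis .
qed

context
  fixes \<theta> :: real
  assumes \<theta>: "0 < \<theta>" "\<theta> \<le> 2"
begin

lemma frac_heat_kernel_mass:
  fixes x :: "'a::euclidean_space"
  assumes t: "0 < t"
  shows "(\<integral>\<^sup>+y. ennreal (frac_heat_kernel \<theta> (x - y) t) \<partial>lborel) = 1"
proof -
  have "(\<integral>\<^sup>+y. ennreal (frac_heat_kernel \<theta> (x - y) t) \<partial>lborel) = (\<integral>\<^sup>+y. ennreal (frac_heat_kernel \<theta> (y::'a) t) \<partial>lborel)"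
    by (rule nn_integral_lborel_reflect[where h="\<lambda>y. ennreal (frac_heat_kernel \<theta> y t)"]) measurable
  also have "\<dots> = 1"
    using frac_heat_kernel_integral[OF \<theta> t, where 'a='a] frac_heat_kernel_nonneg[OF \<theta> t, where 'a='a]
    by (subst nn_integral_eq_integral) auto
  finally show ?thesis .
qed

lemma frac_heat_kernel_semigroup:
  fixes x w :: "'a::euclidean_space"
  assumes t: "0 < t" and s: "0 < s"
  shows "(\<integral>\<^sup>+y. ennreal (frac_heat_kernel \<theta> (x - y) t) * ennreal (frac_heat_kernel \<theta> (y - w) s) \<partial>lborel) =
    ennreal (frac_heat_kernel \<theta> (x - w) (t + s))"
proof -
  let ?K = "frac_heat_kernel \<theta> :: 'a \<Rightarrow> real \<Rightarrow> real"
  note nn = frac_heat_kernel_nonneg[OF \<theta>, where 'a='a]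
  have "(\<integral>\<^sup>+y. ennreal (?K (x - y) t) * ennreal (?K (y - w) s) \<partial>lborel) =
        (\<integral>\<^sup>+y. ennreal (?K (x - w - (x - y)) s) * ennreal (?K (x - y) t) \<partial>lborel)"
    by (simp add: mult.commute)
  also have "\<dots> = (\<integral>\<^sup>+y. ennreal (?K (x - w - y) s * ?K y t) \<partial>lborel)"
    using nn[OF t] nn[OF s]
    by (subst nn_integral_lborel_reflect[where h="\<lambda>y. ennreal (?K (x - w - y) s) * ennreal (?K y t)"])
       (auto simp: ennreal_mult)
  also have "\<dots> = ennreal (LBINT y. ?K (x - w - y) s * ?K y t)"
  proof (rule nn_integral_eq_integral)
    show "integrable lborel (\<lambda>y. ?K (x - w - y) s * ?K y t)"
    proof (rule Bochner_Integration.integrable_bound)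
      show "integrable lborel (\<lambda>y. ?K 0 s * ?K y t)"
        by (intro integrable_mult_right frac_heat_kernel_integral[OF \<theta> t])
      show "AE y in lborel. norm (?K (x - w - y) s * ?K y t) \<le> norm (?K 0 s * ?K y t)"
        using abs_frac_heat_kernel_le[OF s \<theta>(1), where 'a='a]
        by (intro AE_I2) (auto simp: abs_mult intro!: mult_right_mono intro: order_trans[OF _ abs_ge_self])
    qed measurable
  qed (use nn[OF t] nn[OF s] in auto)
  also have "(LBINT y. ?K (x - w - y) s * ?K y t) = ?K (x - w) (t + s)"
    by (simp add: frac_heat_kernel_convolution[OF \<theta> s t] add.commute)
  finally show ?thesis .
qed

text \<open>The weight \<open>1 - exp (- \<delta> |x|^2)\<close> is a smooth substitute for the
  indicator of |x| \<ge> \<delta>^(-1/2). By the inversion formula at \<eta> = 0 its integral is a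
  Gaussian average of \<open>1 - exp (- t |2 \<surd>\<delta> \<zeta>|^\<theta>)\<close>, and 1 -
  exp(-a) \<le> a. The mass beyond radius R is thus O(t/R^\<theta>), with no pointwise decay
  involved.\<close>

lemma frac_heat_kernel_gaussian_tail:
  "\<exists>A\<ge>0. \<forall>t>0. \<forall>\<delta>>0. (\<integral>\<^sup>+x. ennreal (frac_heat_kernel \<theta> (x::'a::euclidean_space) t) * ennreal (1 - exp (- \<delta> * (norm x)\<^sup>2)) \<partial>lborel)
      \<le> ennreal (A * (t * \<delta> powr (\<theta> / 2)))"
proof -
  let ?N = "DIM('a)"
  let ?g = "\<lambda>\<zeta>::'a. exp (- (norm \<zeta>)\<^sup>2)"
  have iA: "integrable lborel (\<lambda>\<zeta>::'a. norm \<zeta> powr \<theta> * ?g \<zeta>)"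
    by (rule Bochner_Integration.integrable_bound[OF integrable_mult_right[OF integrable_gaussian[of "1 / 2"], of 2]])
       (use powr_norm_le_gaussian[OF \<theta>, where 'a='a] in auto)
  define A where "A = 2 powr \<theta> * (LBINT \<zeta>::'a. norm \<zeta> powr \<theta> * ?g \<zeta>) / sqrt pi ^ ?N"
  have "0 \<le> (LBINT \<zeta>::'a. norm \<zeta> powr \<theta> * ?g \<zeta>)" by (rule integral_nonneg_AE) auto
  then have A0: "A \<ge> 0" by (auto simp: A_def)
  moreover have "(\<integral>\<^sup>+x. ennreal (frac_heat_kernel \<theta> (x::'a) t) * ennreal (1 - exp (- \<delta> * (norm x)\<^sup>2)) \<partial>lborel)
      \<le> ennreal (A * (t * \<delta> powr (\<theta> / 2)))" if t: "t > 0" and \<delta>: "\<delta> > 0" for t \<delta>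
  proof -
    let ?K = "\<lambda>x::'a. frac_heat_kernel \<theta> x t"
    let ?e = "\<lambda>x::'a. exp (- \<delta> * (norm x)\<^sup>2)"
    have K0: "0 \<le> ?K x" for x using frac_heat_kernel_nonneg[OF \<theta> t] .
    note iK = frac_heat_kernel_integral[OF \<theta> t, where 'a='a]
    have iKe: "integrable lborel (\<lambda>x. ?K x * ?e x)"
      by (rule Bochner_Integration.integrable_bound[OF iK(1)]) (use \<delta> K0 in \<open>auto simp: abs_mult mult_left_le\<close>)
    have iKd: "integrable lborel (\<lambda>x. ?K x - ?K x * ?e x)" using iK(1) iKe by (rule Bochner_Integration.integrable_diff)
    define m where "m = (\<lambda>\<zeta>::'a. exp (- t * norm ((2 * sqrt \<delta>) *\<^sub>R \<zeta>) powr \<theta>))"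
    have mm[measurable]: "m \<in> borel_measurable borel" unfolding m_def by measurable
    have m1: "0 \<le> m \<zeta>" "m \<zeta> \<le> 1" for \<zeta> using t by (auto simp: m_def)
    have img: "integrable lborel (\<lambda>\<zeta>. m \<zeta> * ?g \<zeta>)"
      by (rule Bochner_Integration.integrable_bound[OF integrable_gaussian_one]) (use m1 in \<open>auto simp: abs_mult mult_left_le_one_le\<close>)
    have "(LBINT x. ?K x - ?K x * ?e x) = 1 - (LBINT x. ?K x * ?e x)"
      using iK iKe by simp
    also have "\<dots> = ((LBINT \<zeta>. ?g \<zeta>) - (LBINT \<zeta>. m \<zeta> * ?g \<zeta>)) / sqrt pi ^ ?N"
      using frac_heat_kernel_fourier_gaussian[OF t \<theta>(1) \<delta>, of "0::'a"]
      by (simp add: m_def integral_gaussian_one diff_divide_distrib)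
    also have "(LBINT \<zeta>. ?g \<zeta>) - (LBINT \<zeta>. m \<zeta> * ?g \<zeta>) = (LBINT \<zeta>. ?g \<zeta> - m \<zeta> * ?g \<zeta>)"
      using integrable_gaussian_one[where 'a='a] img by simp
    also have "\<dots> \<le> (LBINT \<zeta>. (t * (2 * sqrt \<delta>) powr \<theta>) * (norm \<zeta> powr \<theta> * ?g \<zeta>))"
    proof (rule integral_mono)
      show "integrable lborel (\<lambda>\<zeta>. ?g \<zeta> - m \<zeta> * ?g \<zeta>)" using integrable_gaussian_one img by (rule Bochner_Integration.integrable_diff)
      show "integrable lborel (\<lambda>\<zeta>::'a. (t * (2 * sqrt \<delta>) powr \<theta>) * (norm \<zeta> powr \<theta> * ?g \<zeta>))" using iA by (rule integrable_mult_right)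
      fix \<zeta> :: 'a
      have "1 - m \<zeta> \<le> t * norm ((2 * sqrt \<delta>) *\<^sub>R \<zeta>) powr \<theta>"
        using exp_ge_add_one_self[of "- t * norm ((2 * sqrt \<delta>) *\<^sub>R \<zeta>) powr \<theta>"] by (simp add: m_def)
      also have "\<dots> = (t * (2 * sqrt \<delta>) powr \<theta>) * norm \<zeta> powr \<theta>" using \<delta> by (simp add: powr_mult)
      finally have "(1 - m \<zeta>) * ?g \<zeta> \<le> ((t * (2 * sqrt \<delta>) powr \<theta>) * norm \<zeta> powr \<theta>) * ?g \<zeta>"
        by (rule mult_right_mono) simp
      then show "?g \<zeta> - m \<zeta> * ?g \<zeta> \<le> (t * (2 * sqrt \<delta>) powr \<theta>) * (norm \<zeta> powr \<theta> * ?g \<zeta>)"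
        by (simp add: algebra_simps)
    qed
    also have "\<dots> = (t * (2 * sqrt \<delta>) powr \<theta>) * (LBINT \<zeta>::'a. norm \<zeta> powr \<theta> * ?g \<zeta>)" by simp
    also have "(2 * sqrt \<delta>) powr \<theta> = 2 powr \<theta> * \<delta> powr (\<theta> / 2)"
      using \<delta> by (simp add: powr_mult powr_half_sqrt[symmetric] powr_powr)
    finally have le: "(LBINT x. ?K x - ?K x * ?e x) \<le> A * (t * \<delta> powr (\<theta> / 2))"
      by (simp add: A_def divide_right_mono ac_simps)
    have "(\<integral>\<^sup>+x. ennreal (?K x) * ennreal (1 - ?e x) \<partial>lborel) = (\<integral>\<^sup>+x. ennreal (?K x - ?K x * ?e x) \<partial>lborel)"
      using K0 \<delta> by (intro nn_integral_cong) (simp add: ennreal_mult[symmetric] algebra_simps)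
    also have "\<dots> = ennreal (LBINT x. ?K x - ?K x * ?e x)"
      using K0 \<delta> by (intro nn_integral_eq_integral iKd) (auto simp: mult_left_le)
    also have "\<dots> \<le> ennreal (A * (t * \<delta> powr (\<theta> / 2)))" by (rule ennreal_leI[OF le])
    finally show ?thesis .
  qed
  ultimately show ?thesis by blast
qed

text \<open>With R = t^(1/\<theta>), the shell of radius about R 2^n carries mass O(2^(-n \<theta>))
  and weight about \<surd>t 2^(n \<theta>/2). The series has ratio 2^(-\<theta>/2); at order
  \<theta> the ratio would be 1.\<close>

lemma frac_heat_kernel_half_moment_centered:
  "\<exists>C\<ge>0. \<forall>t>0. (\<integral>\<^sup>+y. ennreal (frac_heat_kernel \<theta> (y::'a::euclidean_space) t) * ennreal (norm y powr (\<theta> / 2)) \<partial>lborel) \<le> ennreal (C * sqrt t)"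
proof -
  obtain A where A: "A \<ge> 0" and tail: "\<And>t \<delta>. t > 0 \<Longrightarrow> \<delta> > 0 \<Longrightarrow>
    (\<integral>\<^sup>+x. ennreal (frac_heat_kernel \<theta> (x::'a) t) * ennreal (1 - exp (- \<delta> * (norm x)\<^sup>2)) \<partial>lborel) \<le> ennreal (A * (t * \<delta> powr (\<theta> / 2)))"
    using frac_heat_kernel_gaussian_tail[where 'a='a] by blast
  define q where "q = 2 powr (- \<theta> / 2)"
  have q: "0 < q" "q < 1" using \<theta> by (auto simp: q_def powr_less_one)
  \<comment> \<open>E bounds the smooth cut-off from below on the part of space where
    \<open>\<delta> |y|^2 \<ge> 1\<close>.\<close>
  define E where "E = 1 - exp (- 1 :: real)"
  have E: "E > 0" by (simp add: E_def)
  define C where "C = 1 + 2 powr (\<theta> / 2) / E * A / (1 - q)"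
  have "C \<ge> 0" using A E q by (auto simp: C_def intro!: add_nonneg_nonneg divide_nonneg_nonneg mult_nonneg_nonneg)
  moreover have "(\<integral>\<^sup>+y. ennreal (frac_heat_kernel \<theta> (y::'a) t) * ennreal (norm y powr (\<theta> / 2)) \<partial>lborel) \<le> ennreal (C * sqrt t)"
    if t: "t > 0" for t
  proof -
    let ?K = "\<lambda>x::'a. frac_heat_kernel \<theta> x t"
    define R where "R = t powr (1 / \<theta>)"
    have R: "R > 0" "R powr (\<theta> / 2) = sqrt t" "R powr \<theta> = t"
      using t \<theta> by (auto simp: R_def powr_powr powr_half_sqrt)
    define c where "c = (\<lambda>n::nat. (R * 2 ^ Suc n) powr (\<theta> / 2) / E)"
    define \<delta> where "\<delta> = (\<lambda>n::nat. 1 / (R * 2 ^ n)\<^sup>2)"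
    have c0: "c n \<ge> 0" for n using E by (simp add: c_def)
    have \<delta>0: "\<delta> n > 0" for n using R by (simp add: \<delta>_def)
    have pt: "ennreal (norm y powr (\<theta> / 2)) \<le> ennreal (sqrt t) + (\<Sum>n. ennreal (c n) * ennreal (1 - exp (- \<delta> n * (norm y)\<^sup>2)))" for y :: 'a
    proof (cases "norm y < R")
      case True
      then have "norm y powr (\<theta> / 2) \<le> R powr (\<theta> / 2)" using \<theta> by (intro powr_mono2) auto
      then show ?thesis unfolding R by (intro add_increasing2) (auto intro: ennreal_leI)
    next
      case False
      define n where "n = nat \<lfloor>log 2 (norm y / R)\<rfloor>"
      have pos: "norm y / R > 0" using False R(1) by (intro divide_pos_pos) linarith+
      have l: "log 2 (norm y / R) \<ge> 0" using pos False R(1) by (subst zero_le_log_cancel_iff) auto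
      then have n: "real n \<le> log 2 (norm y / R)" "log 2 (norm y / R) < real n + 1"
        unfolding n_def by simp_all
      have n1: "R * 2 ^ n \<le> norm y"
      proof -
        have "2 ^ n \<le> norm y / R" using n(1) pos by (simp add: le_log_iff powr_realpow)
        then show ?thesis using R by (simp add: field_simps)
      qed
      have n2: "norm y \<le> R * 2 ^ Suc n"
      proof -
        have "norm y / R < 2 ^ Suc n" using n(2) pos by (simp add: log_less_iff powr_add powr_realpow)
        then show ?thesis using R by (simp add: field_simps)
      qed
      have "(R * 2 ^ n)\<^sup>2 \<le> (norm y)\<^sup>2" using n1 R by (intro power_mono) auto
      then have "1 \<le> \<delta> n * (norm y)\<^sup>2" using R by (simp add: \<delta>_def field_simps)
      then have "E \<le> 1 - exp (- \<delta> n * (norm y)\<^sup>2)" by (simp add: E_def)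
      moreover have "norm y powr (\<theta> / 2) \<le> c n * E"
      proof -
        have "norm y powr (\<theta> / 2) \<le> (R * 2 ^ Suc n) powr (\<theta> / 2)" using n2 \<theta> by (intro powr_mono2) auto
        then show ?thesis using E by (simp add: c_def)
      qed
      ultimately have "norm y powr (\<theta> / 2) \<le> c n * (1 - exp (- \<delta> n * (norm y)\<^sup>2))"
        using mult_left_mono[OF _ c0[of n]] by (blast intro: order_trans)
      then have "ennreal (norm y powr (\<theta> / 2)) \<le> ennreal (c n) * ennreal (1 - exp (- \<delta> n * (norm y)\<^sup>2))"
        using c0[of n] \<delta>0[of n] by (subst ennreal_mult[symmetric]) (auto intro: ennreal_leI)
      also have "\<dots> \<le> (\<Sum>n. ennreal (c n) * ennreal (1 - exp (- \<delta> n * (norm y)\<^sup>2)))"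
        by (rule suminf_ennreal_ge_term)
      finally show ?thesis by (intro add_increasing) auto
    qed
    have summand: "c n * (A * (t * \<delta> n powr (\<theta> / 2))) = (sqrt t * (2 powr (\<theta> / 2) / E * A)) * q ^ n" for n
    proof -
      have 1: "(R * 2 ^ Suc n) powr (\<theta> / 2) = sqrt t * 2 powr (\<theta> / 2) * (2 powr (\<theta> / 2)) ^ n"
      proof -
        have "(2 ^ n) powr (\<theta> / 2) = (2 powr (\<theta> / 2)) ^ n"
          by (simp add: powr_realpow[symmetric] powr_powr mult.commute)
        then show ?thesis using R by (simp add: powr_mult)
      qed
      have "(R * 2 ^ n)\<^sup>2 powr (\<theta> / 2) = (R * 2 ^ n) powr \<theta>"
        using R by (subst powr_numeral[symmetric]) (simp_all add: powr_powr del: powr_numeral)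
      also have "\<dots> = t * (2 powr \<theta>) ^ n"
      proof -
        have "(2 ^ n) powr \<theta> = (2 powr \<theta>) ^ n"
          by (simp add: powr_realpow[symmetric] powr_powr mult.commute)
        then show ?thesis using R by (simp add: powr_mult)
      qed
      finally have 2: "t * \<delta> n powr (\<theta> / 2) = 1 / (2 powr \<theta>) ^ n"
        using R t by (simp add: \<delta>_def powr_divide)
      have "(2 powr (\<theta> / 2)) ^ n / (2 powr \<theta>) ^ n = q ^ n"
        unfolding q_def power_divide[symmetric] by (subst powr_diff[symmetric]) simp
      then show ?thesis unfolding c_def 1 2 by (simp add: field_simps)
    qed
    have sums: "(\<lambda>n. c n * (A * (t * \<delta> n powr (\<theta> / 2)))) sums ((sqrt t * (2 powr (\<theta> / 2) / E * A)) * (1 / (1 - q)))"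
      unfolding summand using q by (intro sums_mult geometric_sums) auto
    have "(\<integral>\<^sup>+y. ennreal (?K y) * ennreal (norm y powr (\<theta> / 2)) \<partial>lborel)
       \<le> (\<integral>\<^sup>+y. ennreal (?K y) * ennreal (sqrt t) + (\<Sum>n. ennreal (c n) * (ennreal (?K y) * ennreal (1 - exp (- \<delta> n * (norm y)\<^sup>2)))) \<partial>lborel)"
    proof (rule nn_integral_mono)
      fix y :: 'a
      have "ennreal (?K y) * ennreal (norm y powr (\<theta> / 2)) \<le> ennreal (?K y) * (ennreal (sqrt t) + (\<Sum>n. ennreal (c n) * ennreal (1 - exp (- \<delta> n * (norm y)\<^sup>2))))"
        by (intro mult_left_mono pt) simp
      also have "\<dots> = ennreal (?K y) * ennreal (sqrt t) + (\<Sum>n. ennreal (?K y) * (ennreal (c n) * ennreal (1 - exp (- \<delta> n * (norm y)\<^sup>2))))"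
        by (simp only: distrib_left ennreal_suminf_cmult)
      also have "\<dots> = ennreal (?K y) * ennreal (sqrt t) + (\<Sum>n. ennreal (c n) * (ennreal (?K y) * ennreal (1 - exp (- \<delta> n * (norm y)\<^sup>2))))"
        by (simp only: mult.left_commute)
      finally show "ennreal (?K y) * ennreal (norm y powr (\<theta> / 2)) \<le> \<dots>" .
    qed
    also have "\<dots> = (\<integral>\<^sup>+y. ennreal (?K y) \<partial>lborel) * ennreal (sqrt t) + (\<Sum>n. ennreal (c n) * (\<integral>\<^sup>+y. ennreal (?K y) * ennreal (1 - exp (- \<delta> n * (norm y)\<^sup>2)) \<partial>lborel))"
      by (simp add: nn_integral_add nn_integral_suminf nn_integral_multc nn_integral_cmult)
    also have "(\<integral>\<^sup>+y. ennreal (?K y) \<partial>lborel) = 1"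
      using frac_heat_kernel_mass[OF t, of "0::'a"] by (simp add: frac_heat_kernel_minus)
    also have "(\<Sum>n. ennreal (c n) * (\<integral>\<^sup>+y. ennreal (?K y) * ennreal (1 - exp (- \<delta> n * (norm y)\<^sup>2)) \<partial>lborel))
        \<le> (\<Sum>n. ennreal (c n) * ennreal (A * (t * \<delta> n powr (\<theta> / 2))))"
      by (intro suminf_le mult_left_mono tail t \<delta>0) auto
    also have "\<dots> = (\<Sum>n. ennreal (c n * (A * (t * \<delta> n powr (\<theta> / 2)))))"
      using c0 A t by (intro suminf_cong ennreal_mult[symmetric]) auto
    also have "\<dots> = ennreal ((sqrt t * (2 powr (\<theta> / 2) / E * A)) * (1 / (1 - q)))"
      using sums c0 A t by (subst suminf_ennreal2) (auto simp: sums_iff intro!: mult_nonneg_nonneg)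
    also have "1 * ennreal (sqrt t) + \<dots> = ennreal (C * sqrt t)"
    proof -
      have "(sqrt t * (2 powr (\<theta> / 2) / E * A)) * (1 / (1 - q)) \<ge> 0"
        using A E q t by (auto intro!: mult_nonneg_nonneg divide_nonneg_nonneg)
      moreover have "sqrt t + (sqrt t * (2 powr (\<theta> / 2) / E * A)) * (1 / (1 - q)) = C * sqrt t"
        by (simp add: C_def algebra_simps)
      ultimately show ?thesis using t by (metis ennreal_plus mult_1 real_sqrt_ge_zero less_imp_le)
    qed
    finally show ?thesis by (simp add: add_left_mono)
  qed
  ultimately show ?thesis by blast
qed

text \<open>Within distance t^(1/\<theta>) of the origin, moving the centre costs a constant factor.
  A whole neighbourhood is needed because a solution satisfies its equation only almost
  everywhere.\<close>

lemma frac_heat_kernel_half_moment: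
  "\<exists>C>0. \<forall>t>0. \<forall>x::'a::euclidean_space. norm x \<le> t powr (1 / \<theta>) \<longrightarrow>
     (\<integral>\<^sup>+y. ennreal (frac_heat_kernel \<theta> (x - y) t) * ennreal (norm y powr (\<theta> / 2)) \<partial>lborel) \<le> ennreal (C * sqrt t)"
proof -
  obtain C where C: "C \<ge> 0" and mom: "\<And>t. t > 0 \<Longrightarrow>
    (\<integral>\<^sup>+y. ennreal (frac_heat_kernel \<theta> (y::'a) t) * ennreal (norm y powr (\<theta> / 2)) \<partial>lborel) \<le> ennreal (C * sqrt t)"
    using frac_heat_kernel_half_moment_centered[where 'a='a] by blast
  define D where "D = 2 powr (\<theta> / 2) * (1 + C)"
  have "D > 0" using C by (simp add: D_def)
  moreover have "(\<integral>\<^sup>+y. ennreal (frac_heat_kernel \<theta> (x - y) t) * ennreal (norm y powr (\<theta> / 2)) \<partial>lborel) \<le> ennreal (D * sqrt t)"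
    if t: "t > 0" and x: "norm x \<le> t powr (1 / \<theta>)" for t and x :: 'a
  proof -
    let ?K = "\<lambda>x::'a. frac_heat_kernel \<theta> x t"
    let ?p = "2 powr (\<theta> / 2)"
    have xp: "norm x powr (\<theta> / 2) \<le> sqrt t"
    proof -
      have "norm x powr (\<theta> / 2) \<le> (t powr (1 / \<theta>)) powr (\<theta> / 2)" using x \<theta> by (intro powr_mono2) auto
      then show ?thesis using t \<theta> by (simp add: powr_powr powr_half_sqrt)
    qed
    have pt: "norm (x - w) powr (\<theta> / 2) \<le> ?p * (sqrt t + norm w powr (\<theta> / 2))" for w
    proof -
      have "norm (x - w) \<le> 2 * max (norm x) (norm w)" using norm_triangle_ineq4[of x w] by linarith
      then have "norm (x - w) powr (\<theta> / 2) \<le> (2 * max (norm x) (norm w)) powr (\<theta> / 2)" using \<theta> by (intro powr_mono2) auto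
      also have "\<dots> = ?p * max (norm x) (norm w) powr (\<theta> / 2)" by (simp add: powr_mult)
      also have "\<dots> \<le> ?p * (sqrt t + norm w powr (\<theta> / 2))"
        using xp t by (intro mult_left_mono) (auto simp: max_def intro: order_trans)
      finally show ?thesis .
    qed
    have "(\<integral>\<^sup>+y. ennreal (?K (x - y)) * ennreal (norm y powr (\<theta> / 2)) \<partial>lborel) =
          (\<integral>\<^sup>+y. ennreal (?K (x - y)) * ennreal (norm (x - (x - y)) powr (\<theta> / 2)) \<partial>lborel)" by simp
    also have "\<dots> = (\<integral>\<^sup>+w. ennreal (?K w) * ennreal (norm (x - w) powr (\<theta> / 2)) \<partial>lborel)"
      by (rule nn_integral_lborel_reflect[where h="\<lambda>w. ennreal (?K w) * ennreal (norm (x - w) powr (\<theta> / 2))"]) measurable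
    also have "\<dots> \<le> (\<integral>\<^sup>+w. ennreal ?p * (ennreal (sqrt t) * ennreal (?K w) + ennreal (?K w) * ennreal (norm w powr (\<theta> / 2))) \<partial>lborel)"
    proof (rule nn_integral_mono)
      fix w :: 'a
      have "ennreal (?K w) * ennreal (norm (x - w) powr (\<theta> / 2)) \<le> ennreal (?K w) * ennreal (?p * (sqrt t + norm w powr (\<theta> / 2)))"
        by (intro mult_left_mono ennreal_leI pt) simp
      also have "\<dots> = ennreal ?p * (ennreal (sqrt t) * ennreal (?K w) + ennreal (?K w) * ennreal (norm w powr (\<theta> / 2)))"
        using t by (simp add: ennreal_mult ennreal_plus distrib_left ac_simps)
      finally show "ennreal (?K w) * ennreal (norm (x - w) powr (\<theta> / 2)) \<le> \<dots>" .
    qed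
    also have "\<dots> = ennreal ?p * (ennreal (sqrt t) * (\<integral>\<^sup>+w. ennreal (?K w) \<partial>lborel) + (\<integral>\<^sup>+w. ennreal (?K w) * ennreal (norm w powr (\<theta> / 2)) \<partial>lborel))"
      by (simp add: nn_integral_add nn_integral_cmult)
    also have "(\<integral>\<^sup>+w. ennreal (?K w) \<partial>lborel) = 1"
      using frac_heat_kernel_mass[OF t, of "0::'a"] by (simp add: frac_heat_kernel_minus)
    also have "ennreal ?p * (ennreal (sqrt t) * 1 + (\<integral>\<^sup>+w. ennreal (?K w) * ennreal (norm w powr (\<theta> / 2)) \<partial>lborel)) \<le> ennreal ?p * (ennreal (sqrt t) * 1 + ennreal (C * sqrt t))"
      by (intro mult_left_mono add_left_mono mom t) simp
    also have "\<dots> = ennreal (D * sqrt t)"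
    proof -
      have "ennreal (sqrt t) * 1 + ennreal (C * sqrt t) = ennreal ((1 + C) * sqrt t)"
        using C t by (subst mult_1_right, subst ennreal_plus[symmetric]) (auto simp: distrib_right)
      then show ?thesis using C t by (simp only: D_def mult.assoc) (rule ennreal_mult[symmetric], auto)
    qed
    finally show ?thesis .
  qed
  ultimately show ?thesis by blast
qed

text \<open>Split at |y| = R = t^(1/\<theta>). Inside, the kernel is O(t^(-N/\<theta>)) and the
  weight integrates to O(R^(N - \<theta> r)), which uses \<theta> r < N; outside, the weight is at
  most t^(-r) and the kernel has mass 1.\<close>

lemma frac_heat_kernel_smoothing:
  assumes r: "0 \<le> r" "\<theta> * r < real DIM('a::euclidean_space)"
  shows "\<exists>C>0. \<forall>t>0. \<forall>x::'a.
     (\<integral>\<^sup>+y. ennreal (frac_heat_kernel \<theta> (x - y) t) * ennreal (norm y powr - (\<theta> * r)) \<partial>lborel) \<le> ennreal (C * t powr - r)"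
proof -
  let ?N = "DIM('a)"
  obtain C where C: "C > 0" and ball: "\<And>R. R > 0 \<Longrightarrow> (\<integral>\<^sup>+y. ennreal (norm (y::'a) powr - (\<theta> * r)) * indicator (ball 0 R) y \<partial>lborel)
           \<le> ennreal (C * R powr (real ?N - \<theta> * r))"
    using nn_integral_norm_powr_ball_le[of "\<theta> * r", where 'a='a] r \<theta> by auto
  define k where "k = frac_heat_kernel \<theta> (0::'a) 1"
  have k: "k \<ge> 0" using frac_heat_kernel_nonneg[OF \<theta>, of 1 "0::'a"] by (simp add: k_def)
  define D where "D = k * C + 1"
  have D: "D > 0" using C k by (simp add: D_def add_nonneg_pos)
  moreover have "(\<integral>\<^sup>+y. ennreal (frac_heat_kernel \<theta> (x - y) t) * ennreal (norm y powr - (\<theta> * r)) \<partial>lborel) \<le> ennreal (D * t powr - r)"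
    if t: "t > 0" for t and x :: 'a
  proof -
    let ?K = "\<lambda>x::'a. frac_heat_kernel \<theta> x t"
    define R where "R = t powr (1 / \<theta>)"
    have R: "R > 0" using t by (simp add: R_def)
    have [measurable]: "ball (0::'a) R \<in> sets borel" by simp
    have Rr: "R powr - (\<theta> * r) = t powr - r" using \<theta> by (simp add: R_def powr_powr)
    define k' where "k' = t powr (- (real ?N / \<theta>)) * k"
    have k': "k' \<ge> 0" using k by (simp add: k'_def)
    have Kk: "?K y \<le> k'" for y
      using abs_frac_heat_kernel_le[OF t \<theta>(1), of y] frac_heat_kernel_zero_scale[OF t \<theta>(1), where 'a='a]
      by (simp add: k'_def k_def)
    have "(\<integral>\<^sup>+y. ennreal (?K (x - y)) * ennreal (norm y powr - (\<theta> * r)) \<partial>lborel)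
       \<le> (\<integral>\<^sup>+y. ennreal k' * (ennreal (norm y powr - (\<theta> * r)) * indicator (ball 0 R) y) + ennreal (?K (x - y)) * ennreal (t powr - r) \<partial>lborel)"
    proof (rule nn_integral_mono)
      fix y :: 'a
      show "ennreal (?K (x - y)) * ennreal (norm y powr - (\<theta> * r))
         \<le> ennreal k' * (ennreal (norm y powr - (\<theta> * r)) * indicator (ball 0 R) y) + ennreal (?K (x - y)) * ennreal (t powr - r)"
      proof (cases "norm y < R")
        case True
        then have "ennreal (?K (x - y)) * ennreal (norm y powr - (\<theta> * r)) \<le> ennreal k' * (ennreal (norm y powr - (\<theta> * r)) * indicator (ball 0 R) y)"
          by (simp add: mult_right_mono ennreal_leI[OF Kk])
        then show ?thesis by (rule add_increasing2[rotated]) simp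
      next
        case False
        then have "norm y powr - (\<theta> * r) \<le> R powr - (\<theta> * r)" using R r \<theta> by (intro powr_mono2') auto
        then have "ennreal (?K (x - y)) * ennreal (norm y powr - (\<theta> * r)) \<le> ennreal (?K (x - y)) * ennreal (t powr - r)"
          unfolding Rr by (intro mult_left_mono ennreal_leI) auto
        then show ?thesis by (rule add_increasing[rotated]) simp
      qed
    qed
    also have "\<dots> = ennreal k' * (\<integral>\<^sup>+y. ennreal (norm (y::'a) powr - (\<theta> * r)) * indicator (ball 0 R) y \<partial>lborel) + (\<integral>\<^sup>+y. ennreal (?K (x - y)) \<partial>lborel) * ennreal (t powr - r)"
      by (simp add: nn_integral_add nn_integral_cmult nn_integral_multc)
    also have "\<dots> \<le> ennreal k' * ennreal (C * R powr (real ?N - \<theta> * r)) + 1 * ennreal (t powr - r)"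
      unfolding frac_heat_kernel_mass[OF t] by (intro add_right_mono mult_left_mono ball R) simp
    also have "\<dots> = ennreal (k' * (C * R powr (real ?N - \<theta> * r)) + t powr - r)"
      using k' C by (simp add: ennreal_mult ennreal_plus)
    also have "k' * (C * R powr (real ?N - \<theta> * r)) + t powr - r = D * t powr - r"
    proof -
      have "t powr (- (real ?N / \<theta>)) * R powr (real ?N - \<theta> * r) = t powr - r"
      proof -
        have "1 / \<theta> * (real ?N - \<theta> * r) = real ?N / \<theta> - r" using \<theta> by (simp add: field_simps)
        then show ?thesis by (simp add: R_def powr_powr powr_add[symmetric])
      qed
      then show ?thesis by (simp add: k'_def D_def algebra_simps)
    qed
    finally show ?thesis .
  qed
  ultimately show ?thesis by blast
qed

end

section \<open>The nonlinearity\<close>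

lemma above_tangent_of_mono_deriv:
  fixes h d :: "real \<Rightarrow> real"
  assumes der: "\<And>u. U \<le> u \<Longrightarrow> (h has_real_derivative d u) (at u)"
    and mono: "\<And>u v. U \<le> u \<Longrightarrow> u \<le> v \<Longrightarrow> d u \<le> d v"
    and vw: "U \<le> v" "U \<le> w"
  shows "h v + d v * (w - v) \<le> h w"
proof (cases v w rule: linorder_cases)
  case less
  then obtain z where z: "v < z" "z < w" "h w - h v = (w - v) * d z"
    using MVT2[of v w h d] der vw by auto
  have "(w - v) * d v \<le> (w - v) * d z" using z less vw by (intro mult_left_mono mono) auto
  then show ?thesis using z(3) by (simp add: algebra_simps)
next
  case greater
  then obtain z where z: "w < z" "z < v" "h v - h w = (v - w) * d z"
    using MVT2[of w v h d] der vw by auto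
  have "(v - w) * d z \<le> (v - w) * d v" using z greater vw by (intro mult_left_mono mono) auto
  then show ?thesis using z by (simp add: algebra_simps)
qed simp

text \<open>The bound \<open>1 \<le> q\<close> is deduced from supercriticality when the locale is
  interpreted. The companion bound \<open>q - 1 < N / \<theta>\<close> involves the dimension and is
  carried separately by the lemmas that use it.\<close>

locale nonlinearity =
  fixes f f' :: "real \<Rightarrow> real" and \<tau>0 \<tau>1 q :: real
  assumes f_nonneg: "\<And>u. 0 \<le> u \<Longrightarrow> 0 \<le> f u"
    and f_cont: "continuous_on {0..} f"
    and f_mono: "mono_on {0..} f"
    and f_pos: "\<And>u. 0 < u \<Longrightarrow> 0 < f u"
    and \<tau>0: "0 < \<tau>0"
    and f_deriv: "\<And>u. \<tau>0 \<le> u \<Longrightarrow> (f has_real_derivative f' u) (at u within {\<tau>0..})"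
    and f_int: "(\<integral>\<^sup>+ s \<in> {\<tau>0..}. ennreal (1 / f s) \<partial>lborel) < \<infinity>"
    and \<tau>1: "0 \<le> \<tau>1"
    and f_convex: "convex_on {\<tau>1..} f"
    and f_lim: "((\<lambda>u. f' u * F_fun f u) \<longlongrightarrow> q) at_top"
    and q: "1 \<le> q"
begin

section \<open>The function F and its inverse\<close>

abbreviation F :: "real \<Rightarrow> real" where "F \<equiv> F_fun f"

lemma f_inverse_cont: "continuous_on {\<tau>0..} (\<lambda>s. 1 / f s)"
  using f_pos \<tau>0 by (intro continuous_intros continuous_on_subset[OF f_cont]) (auto simp: less_imp_neq[symmetric] intro!: less_imp_neq[symmetric])

lemma f_inverse_integrable: "set_integrable lborel {\<tau>0..} (\<lambda>s. 1 / f s)"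
  unfolding set_integrable_def
proof (subst integrable_iff_bounded, intro conjI)
  show "(\<lambda>s. indicat_real {\<tau>0..} s *\<^sub>R (1 / f s)) \<in> borel_measurable lborel"
    using borel_measurable_continuous_on_indicator[OF _ f_inverse_cont] by simp
  have "(\<integral>\<^sup>+s. ennreal (norm (indicat_real {\<tau>0..} s *\<^sub>R (1 / f s))) \<partial>lborel) = (\<integral>\<^sup>+ s \<in> {\<tau>0..}. ennreal (1 / f s) \<partial>lborel)"
    using f_pos \<tau>0 by (intro nn_integral_cong) (auto simp: indicator_def less_imp_le)
  then show "(\<integral>\<^sup>+s. ennreal (norm (indicat_real {\<tau>0..} s *\<^sub>R (1 / f s))) \<partial>lborel) < \<infinity>"
    using f_int by simp
qed

lemma f_inverse_integrable_atLeast: "\<tau>0 \<le> u \<Longrightarrow> set_integrable lborel {u..} (\<lambda>s. 1 / f s)"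
  by (rule set_integrable_subset[OF f_inverse_integrable]) auto

lemma F_eq:
  assumes "\<tau>0 \<le> u"
  shows "F u = F \<tau>0 - integral {\<tau>0..u} (\<lambda>s. 1 / f s)"
proof -
  have "F \<tau>0 = (LINT s:{\<tau>0..u} \<union> {u<..}|lborel. 1 / f s)"
    using assms unfolding F_fun_def by (intro arg_cong2[where f="set_lebesgue_integral lborel"]) auto
  also have "\<dots> = (LINT s:{\<tau>0..u}|lborel. 1 / f s) + (LINT s:{u<..}|lborel. 1 / f s)"
    using assms by (intro set_integral_Un set_integrable_subset[OF f_inverse_integrable]) auto
  also have "(LINT s:{u<..}|lborel. 1 / f s) = F u"
    unfolding F_fun_def
  proof (rule set_integral_cong_set)
    show "AE s in lborel. (s \<in> {u..}) = (s \<in> {u<..})"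
      using AE_lborel_singleton[of u] by eventually_elim auto
    have "set_integrable lborel {u<..} (\<lambda>s. 1 / f s)"
      using assms by (intro set_integrable_subset[OF f_inverse_integrable]) auto
    then show "set_borel_measurable lborel {u<..} (\<lambda>s. 1 / f s)"
      unfolding set_borel_measurable_def set_integrable_def by (rule borel_measurable_integrable)
    show "set_borel_measurable lborel {u..} (\<lambda>s. 1 / f s)"
      using f_inverse_integrable_atLeast[OF assms]
      unfolding set_borel_measurable_def set_integrable_def by (rule borel_measurable_integrable)
  qed
  also have "(LINT s:{\<tau>0..u}|lborel. 1 / f s) = integral {\<tau>0..u} (\<lambda>s. 1 / f s)"
    by (intro set_borel_integral_eq_integral(2) set_integrable_subset[OF f_inverse_integrable]) auto
  finally show ?thesis by simp
qed

lemma F_deriv: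
  assumes "\<tau>0 < u"
  shows "(F has_real_derivative - (1 / f u)) (at u)"
proof -
  have cont: "continuous_on {\<tau>0..u + 1} (\<lambda>s. 1 / f s)" by (rule continuous_on_subset[OF f_inverse_cont]) auto
  have "((\<lambda>x. integral {\<tau>0..x} (\<lambda>s. 1 / f s)) has_real_derivative 1 / f u) (at u within {\<tau>0..u + 1})"
    using assms by (intro integral_has_real_derivative cont) auto
  then have "((\<lambda>x. integral {\<tau>0..x} (\<lambda>s. 1 / f s)) has_real_derivative 1 / f u) (at u)"
    using assms at_within_interior[of u "{\<tau>0..u + 1}"] by simp
  then have "((\<lambda>x. F \<tau>0 - integral {\<tau>0..x} (\<lambda>s. 1 / f s)) has_real_derivative 0 - 1 / f u) (at u)"
    by (intro derivative_intros)
  then have "((\<lambda>x. F \<tau>0 - integral {\<tau>0..x} (\<lambda>s. 1 / f s)) has_real_derivative - (1 / f u)) (at u)" by simp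
  then show ?thesis
  proof (rule has_field_derivative_transform_within_open[of _ _ _ "{\<tau>0<..}"])
    show "F \<tau>0 - integral {\<tau>0..x} (\<lambda>s. 1 / f s) = F x" if "x \<in> {\<tau>0<..}" for x using F_eq[of x] that by simp
  qed (use assms in auto)
qed

lemma F_strict_antimono: "\<tau>0 < u \<Longrightarrow> u < v \<Longrightarrow> F v < F u"
proof (rule DERIV_neg_imp_decreasing[of u v])
  fix x assume "\<tau>0 < u" "u \<le> x"
  then show "\<exists>y. (F has_real_derivative y) (at x) \<and> y < 0"
    using F_deriv[of x] f_pos[of x] \<tau>0 by (intro exI[of _ "- (1 / f x)"]) auto
qed

lemma F_antimono: "\<tau>0 < u \<Longrightarrow> u \<le> v \<Longrightarrow> F v \<le> F u"
  using F_strict_antimono[of u v] by (cases "u = v") auto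

lemma F_le_iff: "\<tau>0 < u \<Longrightarrow> \<tau>0 < v \<Longrightarrow> F v \<le> F u \<longleftrightarrow> u \<le> v"
  using F_strict_antimono[of v u] F_antimono[of u v] by (meson not_le)

lemma F_pos: assumes "\<tau>0 < u" shows "0 < F u"
proof -
  have "0 \<le> F (u + 1)"
    unfolding F_fun_def set_lebesgue_integral_def
    using f_pos \<tau>0 assms by (intro Bochner_Integration.integral_nonneg) (auto simp: indicator_def less_imp_le)
  also have "\<dots> < F u" using assms by (intro F_strict_antimono) auto
  finally show ?thesis .
qed

lemma F_tendsto_0: "(F \<longlongrightarrow> 0) at_top"
proof -
  have "((\<lambda>y. LINT s:{\<tau>0..y}|lborel. 1 / f s) \<longlongrightarrow> (LINT s:{\<tau>0..}|lborel. 1 / f s)) at_top"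
    by (rule tendsto_set_lebesgue_integral_at_top[OF _ f_inverse_integrable]) auto
  then have "((\<lambda>y. F \<tau>0 - (LINT s:{\<tau>0..y}|lborel. 1 / f s)) \<longlongrightarrow> F \<tau>0 - F \<tau>0) at_top"
    unfolding F_fun_def by (intro tendsto_intros)
  moreover have "\<forall>\<^sub>F y in at_top. F \<tau>0 - (LINT s:{\<tau>0..y}|lborel. 1 / f s) = F y"
    using eventually_ge_at_top[of \<tau>0]
  proof eventually_elim
    case (elim y)
    have "(LINT s:{\<tau>0..y}|lborel. 1 / f s) = integral {\<tau>0..y} (\<lambda>s. 1 / f s)"
      by (intro set_borel_integral_eq_integral(2) set_integrable_subset[OF f_inverse_integrable]) auto
    then show ?case using F_eq[OF elim] by simp
  qed
  ultimately show ?thesis by (simp add: tendsto_cong)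
qed

text \<open>This is the form in which the inverse of F is used throughout: near infinity F decreases
  continuously to 0, so small positive values have preimages.\<close>

lemma F_onto:
  assumes U: "\<tau>0 < U" and s: "0 < s" "s \<le> F U"
  shows "\<exists>v\<ge>U. F v = s"
proof -
  have "\<forall>\<^sub>F v in at_top. F v < s \<and> U \<le> v"
    using order_tendstoD(2)[OF F_tendsto_0 s(1)] eventually_ge_at_top[of U] by (rule eventually_conj)
  then obtain V where V: "F V < s" "U \<le> V" by (auto dest: eventually_happens)
  have "continuous_on {U..V} F"
    using U by (intro continuous_at_imp_continuous_on ballI DERIV_isCont[OF F_deriv]) auto
  then have "\<exists>x\<ge>U. x \<le> V \<and> F x = s" using V s by (intro IVT2') auto
  then show ?thesis by auto
qed

section \<open>Growth of f measured by powers of F\<close>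

lemma f_deriv_at: "\<tau>0 < u \<Longrightarrow> (f has_real_derivative f' u) (at u)"
  using f_deriv[of u] at_within_interior[of u "{\<tau>0..}"] by simp

lemma f'_nonneg: assumes "\<tau>0 < u" shows "0 \<le> f' u"
proof (rule ccontr)
  assume "\<not> 0 \<le> f' u"
  then obtain d where d: "d > 0" "\<And>h. 0 < h \<Longrightarrow> h < d \<Longrightarrow> f (u + h) < f u"
    using DERIV_neg_dec_right[OF f_deriv_at[OF assms]] by auto
  have "f u \<le> f (u + d / 2)" using d assms \<tau>0 by (intro mono_onD[OF f_mono]) auto
  then show False using d(2)[of "d / 2"] d(1) by simp
qed

text \<open>Since F' = -1/f, the sign of this derivative is that of f' F - \<rho>. The limit q of f'
  F is therefore the threshold exponent between eventual growth and eventual decay of f F^\<rho>,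
  which drives every convexity argument below.\<close>

lemma fF_deriv:
  assumes "\<tau>0 < u"
  shows "((\<lambda>u. f u * F u powr \<rho>) has_real_derivative F u powr (\<rho> - 1) * (f' u * F u - \<rho>)) (at u)"
proof -
  have "((\<lambda>u. f u * F u powr \<rho>) has_real_derivative f' u * F u powr \<rho> + (\<rho> * F u powr (\<rho> - 1) * - (1 / f u)) * f u) (at u)"
    using DERIV_mult[OF f_deriv_at[OF assms] DERIV_fun_powr[OF F_deriv[OF assms] F_pos[OF assms], of \<rho>]] by simp
  moreover have "F u powr \<rho> = F u powr (\<rho> - 1) * F u"
    using F_pos[OF assms] by (simp add: powr_diff)
  ultimately show ?thesis using f_pos[of u] assms \<tau>0 by (simp add: algebra_simps)
qed

lemma f'F_eventually:
  assumes "a < q" "q < b"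
  shows "\<exists>U>\<tau>0. \<forall>u\<ge>U. a < f' u * F u \<and> f' u * F u < b"
proof -
  have "\<forall>\<^sub>F u in at_top. a < f' u * F u \<and> f' u * F u < b"
    using order_tendstoD[OF f_lim] assms by (auto intro: eventually_conj)
  then obtain U where "\<And>u. u \<ge> U \<Longrightarrow> a < f' u * F u \<and> f' u * F u < b"
    by (auto simp: eventually_at_top_linorder)
  then show ?thesis by (intro exI[of _ "max U (\<tau>0 + 1)"]) auto
qed

lemma fF_mono_of_le:
  assumes U: "\<tau>0 < U" and a: "\<And>u. U \<le> u \<Longrightarrow> \<rho> \<le> f' u * F u" and uv: "U \<le> u" "u \<le> v"
  shows "f u * F u powr \<rho> \<le> f v * F v powr \<rho>"
proof (rule DERIV_nonneg_imp_nondecreasing[OF uv(2)])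
  fix x assume x: "u \<le> x" "x \<le> v"
  show "\<exists>y. ((\<lambda>u. f u * F u powr \<rho>) has_real_derivative y) (at x) \<and> 0 \<le> y"
    using x uv U a[of x] by (intro exI[of _ "F x powr (\<rho> - 1) * (f' x * F x - \<rho>)"] conjI fF_deriv) auto
qed

lemma fF_antimono_of_ge:
  assumes U: "\<tau>0 < U" and a: "\<And>u. U \<le> u \<Longrightarrow> f' u * F u \<le> \<rho>" and uv: "U \<le> u" "u \<le> v"
  shows "f v * F v powr \<rho> \<le> f u * F u powr \<rho>"
proof (rule DERIV_nonpos_imp_nonincreasing[OF uv(2)])
  fix x assume x: "u \<le> x" "x \<le> v"
  show "\<exists>y. ((\<lambda>u. f u * F u powr \<rho>) has_real_derivative y) (at x) \<and> y \<le> 0"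
    using x uv U a[of x] by (intro exI[of _ "F x powr (\<rho> - 1) * (f' x * F x - \<rho>)"] conjI fF_deriv) (auto intro: mult_nonneg_nonpos)
qed

text \<open>As q \<ge> 1, eventually f' F > 3/4, so the derivative exceeds F^(-1/2)/4. This is at
  least its value at U because F decreases, and growth is at least linear with slope c.\<close>

lemma fF_half_at_top: "filterlim (\<lambda>u. f u * F u powr (1 / 2)) at_top at_top"
proof -
  obtain U where U: "U > \<tau>0" "\<And>u. u \<ge> U \<Longrightarrow> 3 / 4 < f' u * F u"
    using f'F_eventually[of "3 / 4" "q + 1"] q by auto
  define c where "c = F U powr (- 1 / 2) / 4"
  have c: "c > 0" using F_pos[OF U(1)] by (simp add: c_def)
  have lower: "f U * F U powr (1 / 2) + c * (u - U) \<le> f u * F u powr (1 / 2)" if u: "u \<ge> U" for u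
  proof -
    have "f U * F U powr (1 / 2) - c * U \<le> f u * F u powr (1 / 2) - c * u"
    proof (rule DERIV_nonneg_imp_nondecreasing[OF u])
      fix x assume x: "U \<le> x" "x \<le> u"
      have "((\<lambda>u. f u * F u powr (1 / 2) - c * u) has_real_derivative F x powr (1 / 2 - 1) * (f' x * F x - 1 / 2) - c * 1) (at x)"
        using x U by (intro DERIV_diff fF_deriv DERIV_cmult DERIV_ident) auto
      moreover have "0 \<le> F x powr (1 / 2 - 1) * (f' x * F x - 1 / 2) - c * 1"
      proof -
        have "F U powr (- 1 / 2) * (1 / 4) \<le> F x powr (- 1 / 2) * (f' x * F x - 1 / 2)"
          using U(2)[of x] x U(1) F_pos[of x] F_antimono[of U x] by (intro mult_mono powr_mono2') auto
        then show ?thesis by (simp add: c_def)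
      qed
      ultimately show "\<exists>y. ((\<lambda>u. f u * F u powr (1 / 2) - c * u) has_real_derivative y) (at x) \<and> 0 \<le> y" by blast
    qed
    then show ?thesis by (simp add: algebra_simps)
  qed
  have "filterlim (\<lambda>u. f U * F U powr (1 / 2) + c * (u - U)) at_top at_top"
    by (intro filterlim_tendsto_add_at_top[OF tendsto_const]
        filterlim_tendsto_pos_mult_at_top[OF tendsto_const c]) real_asymp
  then show ?thesis
    by (rule filterlim_at_top_mono) (rule eventually_mono[OF eventually_ge_at_top[of U]], rule lower)
qed

text \<open>The tangent at a high level stays below f on all of [0, \<open>\<infinity>\<close>), although f is convex only near
  infinity: superlinearity pushes the tangent below zero before it leaves the region of convexity.\<close>
lemma f_above_tangent: "\<exists>U>\<tau>0. \<forall>v\<ge>U. \<forall>w\<ge>0. f v + f' v * w \<le> f w + f' v * v"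
proof -
  obtain U where U: "U > \<tau>0" "\<And>u. u \<ge> U \<Longrightarrow> q - 1 / 4 < f' u * F u \<and> f' u * F u < q + 1 / 2"
    using f'F_eventually[of "q - 1 / 4" "q + 1 / 2"] by auto
  \<comment> \<open>The derivative of f F is f' F - 1, so f F grows with slope at most q - 1/2,
    whereas f' F stays above q - 1/4.\<close>
  have fF: "f v * F v \<le> f U * F U + (q - 1 / 2) * (v - U)" if v: "v \<ge> U" for v
  proof -
    have "f v * F v - (q - 1 / 2) * v \<le> f U * F U - (q - 1 / 2) * U"
    proof (rule DERIV_nonpos_imp_nonincreasing[OF v])
      fix x assume x: "U \<le> x" "x \<le> v"
      have xp: "x > \<tau>0" using x U by simp
      have "((\<lambda>u. f u * F u - (q - 1 / 2) * u) has_real_derivative (f' x * F x + - (1 / f x) * f x) - (q - 1 / 2) * 1) (at x)"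
        using xp by (intro DERIV_diff DERIV_mult f_deriv_at F_deriv DERIV_cmult DERIV_ident)
      moreover have "(f' x * F x + - (1 / f x) * f x) - (q - 1 / 2) * 1 \<le> 0"
        using U(2)[of x] x f_pos[of x] xp \<tau>0 by simp
      ultimately show "\<exists>y. ((\<lambda>u. f u * F u - (q - 1 / 2) * u) has_real_derivative y) (at x) \<and> y \<le> 0" by blast
    qed
    then show ?thesis by (simp only: right_diff_distrib)
  qed
  \<comment> \<open>A collects the constants: f F \<le> (q - 1/4)(v - \<tau>1) + A - v/4, so v \<ge>
    4A leaves f \<le> f' (v - \<tau>1). The tangent at v has then already reached zero at \<tau>1 or
    to its right.\<close>
  define A where "A = f U * F U - (q - 1 / 2) * U + (q - 1 / 4) * \<tau>1"
  define W where "W = max (max U (\<tau>1 + 1)) (4 * A)"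
  have "f v + f' v * w \<le> f w + f' v * v" if v: "v \<ge> W" and w: "w \<ge> 0" for v w
  proof (cases "w \<ge> \<tau>1")
    have vU: "v \<ge> U" "v > \<tau>0" "v > \<tau>1" using v U by (auto simp: W_def)
    {
      case True
      have "f w \<ge> f v + f' v * (w - v)"
        using convex_on_imp_above_tangent[OF f_convex _ _ _ f_deriv_at[THEN has_field_derivative_at_within], of v w] vU True
        by (auto simp: algebra_simps)
      then show ?thesis by (simp add: algebra_simps)
    next
      case False
      have "f v * F v \<le> (q - 1 / 4) * (v - \<tau>1)"
      proof -
        have "4 * A \<le> v" using v by (simp add: W_def)
        moreover have "f v * F v \<le> A - (q - 1 / 4) * \<tau>1 + (q - 1 / 2) * v"
          using fF[OF vU(1)] by (simp add: A_def right_diff_distrib)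
        moreover have "(q - 1 / 2) * v = (q - 1 / 4) * v - v / 4" by (simp add: field_simps)
        ultimately show ?thesis by (simp add: right_diff_distrib)
      qed
      also have "\<dots> \<le> f' v * F v * (v - \<tau>1)" using U(2)[OF vU(1)] vU by (intro mult_right_mono) auto
      finally have "F v * f v \<le> F v * (f' v * (v - \<tau>1))" by (simp add: algebra_simps)
      then have "f v \<le> f' v * (v - \<tau>1)" using F_pos[OF vU(2)] by simp
      also have "\<dots> \<le> f' v * (v - w)" using False f'_nonneg[OF vU(2)] by (intro mult_left_mono) auto
      finally show ?thesis using f_nonneg[OF w] by (simp add: algebra_simps)
    }
  qed
  moreover have "W > \<tau>0" using U by (simp add: W_def)
  ultimately show ?thesis by blast
qed

end

section \<open>Supersolutions and comparison\<close>

text \<open>With values in [0, \<infinity>] the formula makes sense before any finiteness is known,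
  and comparison and monotone convergence apply directly.\<close>

definition duhamel ::
  "real \<Rightarrow> (real \<Rightarrow> real) \<Rightarrow> ('a::euclidean_space \<Rightarrow> real) \<Rightarrow> ('a \<Rightarrow> real \<Rightarrow> real) \<Rightarrow> 'a \<Rightarrow> real \<Rightarrow> ennreal" where
  "duhamel \<theta> f \<mu> u x t =
     (\<integral>\<^sup>+ y. ennreal (frac_heat_kernel \<theta> (x - y) t) * ennreal (\<mu> y) \<partial>lborel)
     + (\<integral>\<^sup>+ s \<in> {0<..<t}. (\<integral>\<^sup>+ y. ennreal (frac_heat_kernel \<theta> (x - y) (t - s)) * ennreal (f (u y s)) \<partial>lborel) \<partial>lborel)"

lemma she_solution_iff:
  fixes u :: "'a::euclidean_space \<Rightarrow> real \<Rightarrow> real"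
  shows "she_solution \<theta> f \<mu> T u \<longleftrightarrow>
    (\<lambda>z. u (fst z) (snd z)) \<in> borel_measurable borel \<and> (\<forall>x t. 0 < t \<and> t < T \<longrightarrow> 0 \<le> u x t) \<and>
    (AE z in lborel. 0 < snd z \<and> snd z < T \<longrightarrow> ennreal (u (fst z) (snd z)) = duhamel \<theta> f \<mu> u (fst z) (snd z))"
  by (simp add: she_solution_def duhamel_def)

text \<open>The arbitrary measure space M lets the parameters be a point (x, t), a time alone, or a
  point together with an integration time; all three occur later.\<close>

lemma borel_measurable_heat_convolution:
  fixes h :: "'a::euclidean_space \<Rightarrow> real \<Rightarrow> ennreal"
  assumes h: "(\<lambda>z. h (fst z) (snd z)) \<in> borel_measurable borel"
    and [measurable]: "X \<in> borel_measurable M" "\<sigma> \<in> borel_measurable M" "\<tau> \<in> borel_measurable M"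
  shows "(\<lambda>z. \<integral>\<^sup>+ y. ennreal (frac_heat_kernel \<theta> (X z - y) (\<tau> z)) * h y (\<sigma> z) \<partial>lborel) \<in> borel_measurable M"
proof (rule lborel.borel_measurable_nn_integral)
  have "(\<lambda>p. (snd p, \<sigma> (fst p))) \<in> measurable (M \<Otimes>\<^sub>M lborel) (borel \<Otimes>\<^sub>M borel)" by measurable
  then have "(\<lambda>p. (snd p, \<sigma> (fst p))) \<in> measurable (M \<Otimes>\<^sub>M lborel) borel" by (simp add: borel_prod)
  from measurable_compose[OF this h] have [measurable]: "(\<lambda>p. h (snd p) (\<sigma> (fst p))) \<in> borel_measurable (M \<Otimes>\<^sub>M lborel)" by simp
  show "(\<lambda>(z, y). ennreal (frac_heat_kernel \<theta> (X z - y) (\<tau> z)) * h y (\<sigma> z)) \<in> borel_measurable (M \<Otimes>\<^sub>M lborel)"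
    unfolding split_beta' by measurable
qed

lemma borel_measurable_duhamel:
  fixes u :: "'a::euclidean_space \<Rightarrow> real \<Rightarrow> real"
  assumes [measurable]: "\<mu> \<in> borel_measurable borel"
    and fu: "(\<lambda>z. f (u (fst z) (snd z))) \<in> borel_measurable borel"
  shows "(\<lambda>z. duhamel \<theta> f \<mu> u (fst z) (snd z)) \<in> borel_measurable borel"
proof -
  have "(\<lambda>z. \<integral>\<^sup>+ y. ennreal (frac_heat_kernel \<theta> (fst z - y) (snd z)) * ennreal (\<mu> y) \<partial>lborel) \<in> borel_measurable (borel \<Otimes>\<^sub>M borel :: ('a \<times> real) measure)"
  proof (rule borel_measurable_heat_convolution[where h="\<lambda>y s. ennreal (\<mu> y)" and \<sigma>=snd])
    show "(\<lambda>z::'a \<times> real. ennreal (\<mu> (fst z))) \<in> borel_measurable borel"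
      by (subst borel_prod[symmetric]) measurable
  qed measurable
  moreover have "(\<lambda>z. \<integral>\<^sup>+ s \<in> {0<..<snd z}. (\<integral>\<^sup>+ y. ennreal (frac_heat_kernel \<theta> (fst z - y) (snd z - s)) * ennreal (f (u y s)) \<partial>lborel) \<partial>lborel) \<in> borel_measurable (borel \<Otimes>\<^sub>M borel :: ('a \<times> real) measure)"
  proof (rule lborel.borel_measurable_nn_integral)
    let ?M = "(borel \<Otimes>\<^sub>M borel) \<Otimes>\<^sub>M lborel :: (('a \<times> real) \<times> real) measure"
    have [measurable]: "(\<lambda>p. \<integral>\<^sup>+ y. ennreal (frac_heat_kernel \<theta> (fst (fst p) - y) (snd (fst p) - snd p)) * ennreal (f (u y (snd p))) \<partial>lborel) \<in> borel_measurable ?M"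
      using fu by (intro borel_measurable_heat_convolution[where h="\<lambda>y s. ennreal (f (u y s))"]; measurable)
    have "(\<lambda>p. (\<integral>\<^sup>+ y. ennreal (frac_heat_kernel \<theta> (fst (fst p) - y) (snd (fst p) - snd p)) * ennreal (f (u y (snd p))) \<partial>lborel)
        * (if 0 < snd p \<and> snd p < snd (fst p) then 1 else 0)) \<in> borel_measurable ?M" by measurable
    moreover have "(\<integral>\<^sup>+ y. ennreal (frac_heat_kernel \<theta> (fst (fst p) - y) (snd (fst p) - snd p)) * ennreal (f (u y (snd p))) \<partial>lborel)
        * (if 0 < snd p \<and> snd p < snd (fst p) then 1 else 0) =
      (case p of (z, s) \<Rightarrow> (\<integral>\<^sup>+ y. ennreal (frac_heat_kernel \<theta> (fst z - y) (snd z - s)) * ennreal (f (u y s)) \<partial>lborel) * indicator {0<..<snd z} s)" for p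
      by (simp add: split_beta' indicator_def)
    ultimately show "(\<lambda>(z, s). (\<integral>\<^sup>+ y. ennreal (frac_heat_kernel \<theta> (fst z - y) (snd z - s)) * ennreal (f (u y s)) \<partial>lborel) * indicator {0<..<snd z} s) \<in> borel_measurable ?M"
      by simp
  qed
  ultimately show ?thesis
    unfolding duhamel_def borel_prod by (rule borel_measurable_add)
qed

lemma duhamel_mono:
  assumes "\<And>y. \<mu> y \<le> \<mu>' y"
    and "\<And>y s. 0 < s \<Longrightarrow> s < t \<Longrightarrow> f (u y s) \<le> f (u' y s)"
  shows "duhamel \<theta> f \<mu> u x t \<le> duhamel \<theta> f \<mu>' u' x t"
  unfolding duhamel_def
  using assms by (intro add_mono nn_integral_mono mult_left_mono ennreal_leI)
    (auto simp: indicator_def intro!: nn_integral_mono mult_left_mono ennreal_leI)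

lemma duhamel_tendsto:
  fixes u :: "'a::euclidean_space \<Rightarrow> real \<Rightarrow> real"
  assumes meas: "\<And>n::nat. (\<lambda>z. f (U n (fst z) (snd z))) \<in> borel_measurable borel"
    and incr: "\<And>y s. incseq (\<lambda>n. f (U n y s))"
    and lim: "\<And>y s. (\<lambda>n. f (U n y s)) \<longlonglongrightarrow> f (u y s)"
  shows "(\<lambda>n. duhamel \<theta> f \<mu> (U n) x t) \<longlonglongrightarrow> duhamel \<theta> f \<mu> u x t"
  unfolding duhamel_def
proof (rule tendsto_add[OF tendsto_const nn_integral_LIMSEQ])
  let ?I = "\<lambda>v s. \<integral>\<^sup>+ y. ennreal (frac_heat_kernel \<theta> (x - y) (t - s)) * ennreal (f (v y s)) \<partial>lborel"
  have mI: "?I (U n) \<in> borel_measurable borel" for n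
    using meas[of n] by (intro borel_measurable_heat_convolution[where h="\<lambda>y s. ennreal (f (U n y s))"]; measurable)
  show "(\<lambda>s. ?I (U n) s * indicator {0<..<t} s) \<in> borel_measurable lborel" for n
    using mI[of n] by (simp add: borel_measurable_times_ennreal)
  show "incseq (\<lambda>n s. ?I (U n) s * indicator {0<..<t} s)"
    using incr unfolding incseq_def
    by (intro allI impI le_funI mult_right_mono nn_integral_mono mult_left_mono ennreal_leI) auto
  fix s
  have mu: "(\<lambda>y. f (U n y s)) \<in> borel_measurable borel" for n
  proof -
    have "(\<lambda>y::'a. (y, s)) \<in> measurable borel borel"
      by (intro borel_measurable_continuous_onI continuous_intros)
    from measurable_compose[OF this meas[of n]] show ?thesis by simp
  qed
  have "(\<lambda>n. ?I (U n) s) \<longlonglongrightarrow> ?I u s"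
  proof (rule nn_integral_LIMSEQ)
    show "incseq (\<lambda>n y. ennreal (frac_heat_kernel \<theta> (x - y) (t - s)) * ennreal (f (U n y s)))"
      using incr unfolding incseq_def by (intro allI impI le_funI mult_left_mono ennreal_leI) auto
    show "(\<lambda>y. ennreal (frac_heat_kernel \<theta> (x - y) (t - s)) * ennreal (f (U n y s))) \<in> borel_measurable lborel" for n
      using mu[of n] by measurable
    show "(\<lambda>n. ennreal (frac_heat_kernel \<theta> (x - y) (t - s)) * ennreal (f (U n y s))) \<longlonglongrightarrow> ennreal (frac_heat_kernel \<theta> (x - y) (t - s)) * ennreal (f (u y s))" for y
      by (intro ennreal_tendsto_cmult tendsto_ennrealI lim) simp
  qed
  then show "(\<lambda>n. ?I (U n) s * indicator {0<..<t} s) \<longlonglongrightarrow> ?I u s * indicator {0<..<t} s"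
    by (auto simp: indicator_def)
qed

lemma locally_solvable_of_supersolution:
  fixes \<mu> :: "'a::euclidean_space \<Rightarrow> real" and v :: "'a \<Rightarrow> real \<Rightarrow> real"
  assumes T: "0 < T"
    and f: "continuous_on {0..} f" "mono_on {0..} f" "\<And>u. 0 \<le> u \<Longrightarrow> 0 \<le> f u"
    and \<mu>: "\<mu> \<in> borel_measurable borel"
    and v: "(\<lambda>z. v (fst z) (snd z)) \<in> borel_measurable borel" "\<And>x t. 0 < t \<Longrightarrow> t < T \<Longrightarrow> 0 \<le> v x t"
    and super: "AE z in lborel. 0 < snd z \<and> snd z < T \<longrightarrow> duhamel \<theta> f \<mu> v (fst z) (snd z) \<le> ennreal (v (fst z) (snd z))"
  shows "locally_solvable \<theta> f \<mu>"
proof -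
  \<comment> \<open>The sign of v is known only for 0 < t < T, while the iterates are defined for
    all times.\<close>
  define v0 where "v0 = (\<lambda>x t. max 0 (v x t))"
  have v0[simp]: "0 \<le> v0 x t" for x t by (simp add: v0_def)
  have f0c: "continuous_on UNIV (\<lambda>a. f (max 0 a))"
    by (rule continuous_on_compose2[OF f(1)]) (auto intro!: continuous_intros)
  then have [measurable]: "(\<lambda>a. f (max 0 a)) \<in> borel_measurable borel" by (rule borel_measurable_continuous_onI)
  have fmeas: "(\<lambda>z. f (w (fst z) (snd z))) \<in> borel_measurable borel"
    if w: "(\<lambda>z. w (fst z) (snd z)) \<in> borel_measurable borel" "\<And>x t. 0 \<le> w x t" for w :: "'a \<Rightarrow> real \<Rightarrow> real"
  proof -
    have "(\<lambda>z. f (max 0 (w (fst z) (snd z)))) \<in> borel_measurable borel"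
      using w(1) by (rule measurable_compose) measurable
    then show ?thesis using w(2) by (simp add: max_absorb2)
  qed
  \<comment> \<open>The minimum with v0 keeps every iterate finite everywhere, also on the null set
    where the supersolution inequality fails. At the other points of the strip the minimum is
    inactive, so the limit solves the untruncated equation there.\<close>
  define U where "U = rec_nat (\<lambda>(x::'a) (t::real). 0 :: real) (\<lambda>n w x t. enn2real (min (duhamel \<theta> f \<mu> w x t) (ennreal (v0 x t))))"
  have U0: "U 0 x t = 0" for x t by (simp add: U_def)
  have US: "U (Suc n) x t = enn2real (min (duhamel \<theta> f \<mu> (U n) x t) (ennreal (v0 x t)))" for n x t by (simp add: U_def)
  have Unn: "0 \<le> U n x t" for n x t by (cases n) (auto simp: U0 US)
  have Ue: "ennreal (U (Suc n) x t) = min (duhamel \<theta> f \<mu> (U n) x t) (ennreal (v0 x t))" for n x t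
    unfolding US by (intro ennreal_enn2real) (simp add: min_less_iff_disj)
  have Ule: "U n x t \<le> v0 x t" for n x t
  proof (cases n)
    case (Suc m)
    have "ennreal (U (Suc m) x t) \<le> ennreal (v0 x t)" unfolding Ue by simp
    then show ?thesis by (simp add: Suc)
  qed (simp add: U0)
  have Um: "(\<lambda>z. U n (fst z) (snd z)) \<in> borel_measurable borel" for n
  proof (induction n)
    case 0 then show ?case by (simp add: U0)
  next
    case (Suc n)
    have [measurable]: "(\<lambda>z. duhamel \<theta> f \<mu> (U n) (fst z) (snd z)) \<in> borel_measurable borel"
      by (intro borel_measurable_duhamel \<mu> fmeas Suc Unn)
    have [measurable]: "(\<lambda>z. v0 (fst z) (snd z)) \<in> borel_measurable borel"
      using v(1) unfolding v0_def by measurable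
    show ?case unfolding US by measurable
  qed
  have Umono: "U n x t \<le> U (Suc n) x t" for n x t
  proof (induction n arbitrary: x t)
    case 0 then show ?case using Unn by (simp add: U0)
  next
    case (Suc n)
    have "duhamel \<theta> f \<mu> (U n) x t \<le> duhamel \<theta> f \<mu> (U (Suc n)) x t"
      by (intro duhamel_mono order_refl mono_onD[OF f(2)]) (auto simp: Unn Suc)
    then have "ennreal (U (Suc n) x t) \<le> ennreal (U (Suc (Suc n)) x t)"
      unfolding Ue by (intro min.mono order_refl)
    then show ?case by (simp add: Unn)
  qed
  have inc: "incseq (\<lambda>n. U n x t)" for x t by (intro incseq_SucI Umono)
  define u where "u = (\<lambda>x t. lim (\<lambda>n. U n x t))"
  have ulim: "(\<lambda>n. U n x t) \<longlonglongrightarrow> u x t" for x t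
    unfolding u_def using incseq_convergent[OF inc] Ule by (metis limI)
  have unn: "0 \<le> u x t" for x t using LIMSEQ_le_const[OF ulim] Unn by blast
  have um: "(\<lambda>z. u (fst z) (snd z)) \<in> borel_measurable borel"
    using Um ulim by (rule borel_measurable_LIMSEQ_real[rotated])
  have flim: "(\<lambda>n. f (U n x t)) \<longlonglongrightarrow> f (u x t)" for x t
    using continuous_on_tendsto_compose[OF f(1) ulim] Unn unn by auto
  have dlim: "(\<lambda>n. duhamel \<theta> f \<mu> (U n) x t) \<longlonglongrightarrow> duhamel \<theta> f \<mu> u x t" for x t
  proof (rule duhamel_tendsto)
    show "incseq (\<lambda>n. f (U n y s))" for y s
      by (intro incseq_SucI mono_onD[OF f(2)]) (auto simp: Unn Umono)
  qed (intro fmeas Um Unn flim)+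
  have "AE z in lborel. 0 < snd z \<and> snd z < T \<longrightarrow> ennreal (u (fst z) (snd z)) = duhamel \<theta> f \<mu> u (fst z) (snd z)"
    using super
  proof eventually_elim
    case (elim z)
    show ?case
    proof
      assume z: "0 < snd z \<and> snd z < T"
      have "duhamel \<theta> f \<mu> (U n) (fst z) (snd z) \<le> ennreal (v0 (fst z) (snd z))" for n
      proof -
        have "duhamel \<theta> f \<mu> (U n) (fst z) (snd z) \<le> duhamel \<theta> f \<mu> v (fst z) (snd z)"
        proof (intro duhamel_mono order_refl mono_onD[OF f(2)])
          fix y s assume s: "0 < s" "s < snd z"
          then show "v y s \<in> {0..}" using v(2) z by simp
          then show "U n y s \<le> v y s" using Ule[of n y s] by (simp add: v0_def)
        qed (simp add: Unn)
        also have "\<dots> \<le> ennreal (v (fst z) (snd z))" using elim z by simp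
        also have "\<dots> \<le> ennreal (v0 (fst z) (snd z))" by (intro ennreal_leI) (simp add: v0_def)
        finally show ?thesis .
      qed
      then have "ennreal (U (Suc n) (fst z) (snd z)) = duhamel \<theta> f \<mu> (U n) (fst z) (snd z)" for n
        unfolding Ue by (simp add: min_absorb1)
      moreover have "(\<lambda>n. ennreal (U (Suc n) (fst z) (snd z))) \<longlonglongrightarrow> ennreal (u (fst z) (snd z))"
        by (intro tendsto_ennrealI LIMSEQ_Suc ulim)
      ultimately show "ennreal (u (fst z) (snd z)) = duhamel \<theta> f \<mu> u (fst z) (snd z)"
        using dlim by (metis (no_types, lifting) LIMSEQ_unique ext)
    qed
  qed
  then have "she_solution \<theta> f \<mu> T u" unfolding she_solution_iff using um unn by auto
  then show ?thesis using T by (auto simp: locally_solvable_def)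
qed

text \<open>A solution for the larger datum is a supersolution for the smaller one.\<close>

lemma locally_solvable_mono:
  fixes \<mu> \<mu>' :: "'a::euclidean_space \<Rightarrow> real"
  assumes f: "continuous_on {0..} f" "mono_on {0..} f" "\<And>u. 0 \<le> u \<Longrightarrow> 0 \<le> f u"
    and \<mu>: "\<mu> \<in> borel_measurable borel" "\<And>x. \<mu> x \<le> \<mu>' x"
    and solv: "locally_solvable \<theta> f \<mu>'"
  shows "locally_solvable \<theta> f \<mu>"
proof -
  obtain T u where T: "T > 0" and u: "she_solution \<theta> f \<mu>' T u"
    using solv by (auto simp: locally_solvable_def)
  show ?thesis
  proof (rule locally_solvable_of_supersolution[OF T f \<mu>(1)])
    show "AE z in lborel. 0 < snd z \<and> snd z < T \<longrightarrow> duhamel \<theta> f \<mu> u (fst z) (snd z) \<le> ennreal (u (fst z) (snd z))"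
      using u unfolding she_solution_iff
      by (elim conjE eventually_mono) (auto intro!: duhamel_mono \<mu>)
  qed (use u in \<open>auto simp: she_solution_iff\<close>)
qed

lemma frac_heat_kernel_semigroup_nn_integral:
  fixes x :: "'a::euclidean_space"
  assumes \<theta>: "0 < \<theta>" "\<theta> \<le> 2" and t: "0 < t" and s: "0 < s" and [measurable]: "h \<in> borel_measurable borel"
  shows "(\<integral>\<^sup>+y. ennreal (frac_heat_kernel \<theta> (x - y) t) * (\<integral>\<^sup>+w. ennreal (frac_heat_kernel \<theta> (y - w) s) * h w \<partial>lborel) \<partial>lborel) =
    (\<integral>\<^sup>+w. ennreal (frac_heat_kernel \<theta> (x - w) (t + s)) * h w \<partial>lborel)"
proof -
  let ?k = "\<lambda>x t. ennreal (frac_heat_kernel \<theta> (x::'a) t)"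
  have "(\<integral>\<^sup>+y. ?k (x - y) t * (\<integral>\<^sup>+w. ?k (y - w) s * h w \<partial>lborel) \<partial>lborel) =
        (\<integral>\<^sup>+y. (\<integral>\<^sup>+w. ?k (x - y) t * (?k (y - w) s * h w) \<partial>lborel) \<partial>lborel)"
    by (intro nn_integral_cong nn_integral_cmult[symmetric]) measurable
  also have "\<dots> = (\<integral>\<^sup>+w. (\<integral>\<^sup>+y. ?k (x - y) t * (?k (y - w) s * h w) \<partial>lborel) \<partial>lborel)"
    by (rule lborel_pair.Fubini'[symmetric]) measurable
  also have "\<dots> = (\<integral>\<^sup>+w. (\<integral>\<^sup>+y. ?k (x - y) t * ?k (y - w) s \<partial>lborel) * h w \<partial>lborel)"
    by (intro nn_integral_cong) (simp add: mult.assoc[symmetric] nn_integral_multc)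
  also have "\<dots> = (\<integral>\<^sup>+w. ?k (x - w) (t + s) * h w \<partial>lborel)"
    by (simp add: frac_heat_kernel_semigroup[OF \<theta> t s])
  finally show ?thesis .
qed

section \<open>Existence\<close>

lemma nn_integral_powr_from_0:
  assumes "0 < \<kappa>" "0 < (t::real)"
  shows "(\<integral>\<^sup>+ s \<in> {0<..<t}. ennreal (s powr (\<kappa> - 1)) \<partial>lborel) \<le> ennreal (t powr \<kappa> / \<kappa>)"
proof -
  have "((\<lambda>s. s powr (\<kappa> - 1)) has_integral (t powr (\<kappa> - 1 + 1) / (\<kappa> - 1 + 1))) {0..t}"
    using assms by (intro has_integral_powr_from_0) auto
  then have "((\<lambda>s. s powr (\<kappa> - 1)) has_integral (t powr \<kappa> / \<kappa>)) {0..t}" by simp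
  then have "(\<integral>\<^sup>+ s. ennreal (s powr (\<kappa> - 1)) * indicator {0..t} s \<partial>lborel) = ennreal (t powr \<kappa> / \<kappa>)"
    by (intro nn_integral_has_integral_lebesgue') auto
  moreover have "(\<integral>\<^sup>+ s \<in> {0<..<t}. ennreal (s powr (\<kappa> - 1)) \<partial>lborel) \<le> (\<integral>\<^sup>+ s. ennreal (s powr (\<kappa> - 1)) * indicator {0..t} s \<partial>lborel)"
    by (intro nn_integral_mono) (auto simp: indicator_def)
  ultimately show ?thesis by simp
qed

section \<open>Admissible exponents and convexity inequalities\<close>

context nonlinearity
begin

text \<open>Used with p = N/\<theta>. The exponent r is the midpoint of the interval from q - 1 to
  min q p, and \<kappa> is half of the slack r + 1 - q. Eventually f F^r increases and f
  F^(r+1-\<kappa>) decreases; the spare \<kappa> will make the weight s^(\<kappa>-1) integrable at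
  time 0.\<close>

lemma critical_exponents:
  assumes "q - 1 < p"
  obtains r \<kappa> U where "0 < r" "r < p" "0 < \<kappa>" "\<tau>0 < U"
    "\<And>u. U \<le> u \<Longrightarrow> r \<le> f' u * F u \<and> f' u * F u \<le> r + 1 - \<kappa>"
proof -
  define r where "r = (q - 1 + min q p) / 2"
  define \<kappa> where "\<kappa> = (r + 1 - q) / 2"
  have r: "0 < r" "r < p" "r < q" "q - 1 < r" using q assms by (auto simp: r_def)
  have \<kappa>: "0 < \<kappa>" "q < r + 1 - \<kappa>" using r(4) by (auto simp: \<kappa>_def field_simps)
  obtain U where "U > \<tau>0" "\<And>u. u \<ge> U \<Longrightarrow> r < f' u * F u \<and> f' u * F u < r + 1 - \<kappa>"
    using f'F_eventually[OF r(3) \<kappa>(2)] by auto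
  then show ?thesis using that r \<kappa> by (meson less_imp_le)
qed

text \<open>F^(-r) has derivative r/(f F^(r+1)), so the hypothesis \<open>dec\<close> says that this
  derivative increases.\<close>

lemma F_powr_above_tangent:
  assumes U: "\<tau>0 < U" and r: "0 < r" and dec: "\<And>u v. U \<le> u \<Longrightarrow> u \<le> v \<Longrightarrow> f v * F v powr (r + 1) \<le> f u * F u powr (r + 1)"
    and vw: "U \<le> v" "U \<le> w"
  shows "F v powr - r + r / (f v * F v powr (r + 1)) * (w - v) \<le> F w powr - r"
proof (rule above_tangent_of_mono_deriv[where U = U, OF _ _ vw])
  have pos: "0 < f u * F u powr (r + 1)" if "U \<le> u" for u
    using that U F_pos[of u] f_pos[of u] \<tau>0 by simp
  show "((\<lambda>u. F u powr - r) has_real_derivative r / (f u * F u powr (r + 1))) (at u)" if "U \<le> u" for u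
  proof -
    have u: "\<tau>0 < u" using that U by simp
    have "((\<lambda>u. F u powr - r) has_real_derivative - r * F u powr (- r - of_nat 1) * - (1 / f u)) (at u)"
      by (rule DERIV_fun_powr[OF F_deriv F_pos]) (rule u)+
    moreover have "F u powr (- r - of_nat 1) = 1 / F u powr (r + 1)"
      using powr_minus_divide[of "F u" "r + 1"] by simp
    ultimately show ?thesis by (simp add: field_simps)
  qed
  show "r / (f u * F u powr (r + 1)) \<le> r / (f v * F v powr (r + 1))" if "U \<le> u" "u \<le> v" for u v
    using dec[OF that] pos[of u] pos[of v] that r by (intro divide_left_mono) auto
qed

lemma sqrt_F_above_tangent:
  assumes U: "\<tau>0 < U" and inc: "\<And>u v. U \<le> u \<Longrightarrow> u \<le> v \<Longrightarrow> f u * F u powr (1 / 2) \<le> f v * F v powr (1 / 2)"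
    and vw: "U \<le> v" "U \<le> w"
  shows "2 * (f v * F v powr (1 / 2)) * (F v powr (1 / 2) - F w powr (1 / 2)) \<le> w - v"
proof -
  have pos: "0 < f u * F u powr (1 / 2)" if "U \<le> u" for u
    using that U F_pos[of u] f_pos[of u] \<tau>0 by simp
  have "2 * F v powr (1 / 2) + - (1 / (f v * F v powr (1 / 2))) * (w - v) \<le> 2 * F w powr (1 / 2)"
  proof (rule above_tangent_of_mono_deriv[where U = U, OF _ _ vw])
    show "((\<lambda>u. 2 * F u powr (1 / 2)) has_real_derivative - (1 / (f u * F u powr (1 / 2)))) (at u)" if "U \<le> u" for u
    proof -
      have u: "\<tau>0 < u" using that U by simp
      have "((\<lambda>u. 2 * F u powr (1 / 2)) has_real_derivative 2 * (1 / 2 * F u powr (1 / 2 - of_nat 1) * - (1 / f u))) (at u)"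
        by (intro DERIV_cmult DERIV_fun_powr[OF F_deriv F_pos]) (rule u)+
      moreover have "F u powr (1 / 2 - of_nat 1) = 1 / F u powr (1 / 2)"
        by (subst powr_minus_divide[symmetric]) simp
      ultimately show ?thesis by (simp add: field_simps)
    qed
    show "- (1 / (f u * F u powr (1 / 2))) \<le> - (1 / (f v * F v powr (1 / 2)))" if "U \<le> u" "u \<le> v" for u v
      using inc[OF that] pos[of u] pos[of v] that by (simp add: divide_left_mono)
  qed
  then have "2 * (F v powr (1 / 2) - F w powr (1 / 2)) \<le> (w - v) / (f v * F v powr (1 / 2))" by simp
  then have "(2 * (F v powr (1 / 2) - F w powr (1 / 2))) * (f v * F v powr (1 / 2)) \<le> w - v"
    by (simp only: pos_le_divide_eq[OF pos[OF vw(1)]])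
  then show ?thesis by (simp only: mult_ac)
qed

text \<open>The convex function J = F^(-r) lies above a tangent of positive slope d, so \<mu> is at
  most a constant plus J(\<mu>)/d. The hypothesis bounds J(\<mu>) by a multiple of |x|^(-\<theta>
  r), which is locally integrable as \<theta> r < N.\<close>

lemma locally_integrable_of_G_le:
  fixes \<mu> :: "'a::euclidean_space \<Rightarrow> real"
  assumes \<theta>: "0 < \<theta>" and sup: "q - 1 < real DIM('a) / \<theta>" and U: "\<tau>0 < U" and b: "0 < b"
    and \<mu>[measurable]: "\<mu> \<in> borel_measurable borel" and \<mu>0: "\<And>x. 0 \<le> \<mu> x"
    and G: "\<And>x. U < \<mu> x \<Longrightarrow> 1 / F (\<mu> x) \<le> b * norm x powr - \<theta>"
  shows "locally_integrable \<mu>"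
proof -
  obtain r \<kappa> U0 where r: "0 < r" "r < real DIM('a) / \<theta>" and \<kappa>: "0 < \<kappa>" and U0: "\<tau>0 < U0"
    and f'F: "\<And>u. U0 \<le> u \<Longrightarrow> r \<le> f' u * F u \<and> f' u * F u \<le> r + 1 - \<kappa>"
    using critical_exponents[OF sup] by blast
  define U1 where "U1 = max U U0"
  have U1: "\<tau>0 < U1" "U \<le> U1" "U0 \<le> U1" using U by (auto simp: U1_def)
  have dec: "f v * F v powr (r + 1) \<le> f u * F u powr (r + 1)" if "U1 \<le> u" "u \<le> v" for u v
    using f'F \<kappa> that U1 by (intro fF_antimono_of_ge[OF U0]) (force, auto)
  define d where "d = r / (f U1 * F U1 powr (r + 1))"
  have d: "d > 0" using r F_pos[OF U1(1)] f_pos[of U1] U1 \<tau>0 by (simp add: d_def)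
  have le: "\<mu> x \<le> U1 + b powr r / d * norm x powr - (\<theta> * r)" for x
  proof (cases "U1 < \<mu> x")
    case True
    have "F (\<mu> x) > 0" using True U1 by (intro F_pos) auto
    have "F U1 powr - r + d * (\<mu> x - U1) \<le> F (\<mu> x) powr - r"
      unfolding d_def using True by (intro F_powr_above_tangent[OF U1(1) r(1) dec]) auto
    then have "d * (\<mu> x - U1) \<le> F (\<mu> x) powr - r" using powr_ge_zero[of "F U1" "- r"] by linarith
    also have "\<dots> = (1 / F (\<mu> x)) powr r" using \<open>F (\<mu> x) > 0\<close> by (simp add: powr_minus_divide powr_divide)
    also have "\<dots> \<le> (b * norm x powr - \<theta>) powr r"
      using G[of x] True U1 r \<open>F (\<mu> x) > 0\<close> by (intro powr_mono2) auto
    also have "\<dots> = b powr r * norm x powr - (\<theta> * r)" using b by (simp add: powr_mult powr_powr)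
    finally have "\<mu> x - U1 \<le> b powr r * norm x powr - (\<theta> * r) / d" using d by (simp add: field_simps)
    then show ?thesis by simp
  next
    case False
    have "0 \<le> b powr r / d * norm x powr - (\<theta> * r)" using d by simp
    then show ?thesis using False by linarith
  qed
  show ?thesis
    unfolding locally_integrable_def
  proof (intro allI impI)
    fix K :: "'a set" assume K: "compact K"
    obtain R where R: "R > 0" "K \<subseteq> ball 0 R" using bounded_subset_ballD[OF compact_imp_bounded[OF K], of 0] by auto
    have [measurable]: "K \<in> sets borel" using K by (simp add: borel_compact)
    have [measurable]: "ball (0::'a) R \<in> sets borel" by simp
    have r': "\<theta> * r < real DIM('a)" "0 \<le> \<theta> * r" using r \<theta> by (auto simp: field_simps)
    obtain C where C: "C > 0" "(\<integral>\<^sup>+y. ennreal (norm (y::'a) powr - (\<theta> * r)) * indicator (ball 0 R) y \<partial>lborel) \<le> ennreal (C * R powr (real DIM('a) - \<theta> * r))"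
      using nn_integral_norm_powr_ball_le[OF r'] R by blast
    let ?c = "b powr r / d"
    have "(\<integral>\<^sup>+x. ennreal (norm (indicat_real K x *\<^sub>R \<mu> x)) \<partial>lborel)
       \<le> (\<integral>\<^sup>+x. ennreal U1 * indicator (ball 0 R) (x::'a) + ennreal ?c * (ennreal (norm x powr - (\<theta> * r)) * indicator (ball 0 R) x) \<partial>lborel)"
    proof (rule nn_integral_mono)
      fix x :: 'a
      have "ennreal (\<mu> x) \<le> ennreal U1 + ennreal ?c * ennreal (norm x powr - (\<theta> * r))"
      proof -
        have "ennreal (U1 + ?c * norm x powr - (\<theta> * r)) = ennreal U1 + ennreal ?c * ennreal (norm x powr - (\<theta> * r))"
          using d U1 \<tau>0 by (subst ennreal_plus) (auto simp: ennreal_mult[symmetric])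
        then show ?thesis using ennreal_leI[OF le[of x]] by simp
      qed
      then show "ennreal (norm (indicat_real K x *\<^sub>R \<mu> x)) \<le> ennreal U1 * indicator (ball 0 R) x + ennreal ?c * (ennreal (norm x powr - (\<theta> * r)) * indicator (ball 0 R) x)"
        using R \<mu>0[of x] by (cases "x \<in> K") (auto simp: indicator_def)
    qed
    also have "\<dots> = ennreal U1 * emeasure lborel (ball (0::'a) R) + ennreal ?c * (\<integral>\<^sup>+y. ennreal (norm (y::'a) powr - (\<theta> * r)) * indicator (ball 0 R) y \<partial>lborel)"
      by (simp add: nn_integral_add nn_integral_cmult nn_integral_cmult_indicator)
    also have "\<dots> < \<infinity>"
      using C emeasure_lborel_ball_finite[of "0::'a" R]
      by (simp add: ennreal_mult_less_top le_less_trans)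
    finally show "set_integrable lborel K \<mu>"
      unfolding set_integrable_def integrable_iff_bounded by simp
  qed
qed

text \<open>With \<open>J = F\<^bsup>-r\<^esup>\<close> and z the caloric extension of \<open>J(\<mu>)\<close>, the function \<open>J\<^bsup>-1\<^esup>(2z)\<close> is a supersolution:
  Jensen's inequality leaves \<open>J\<^bsup>-1\<^esup>(2z) - J\<^bsup>-1\<^esup>(z)\<close> of room for the Duhamel term.\<close>
lemma locally_solvable_of_G_le:
  assumes \<theta>: "0 < \<theta>" "\<theta> \<le> 2" and sup: "q - 1 < real DIM('a::euclidean_space) / \<theta>"
  shows "\<exists>b0>0. \<forall>b U. \<forall>\<mu>::'a \<Rightarrow> real. 0 < b \<longrightarrow> b \<le> b0 \<longrightarrow> \<tau>0 < U \<longrightarrow> \<mu> \<in> borel_measurable borel \<longrightarrow> (\<forall>x. 0 \<le> \<mu> x) \<longrightarrow>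
     (\<forall>x. U < \<mu> x \<longrightarrow> 1 / F (\<mu> x) \<le> b * norm x powr - \<theta>) \<longrightarrow> locally_solvable \<theta> f \<mu>"
proof -
  obtain r \<kappa> U0 where r: "0 < r" "r < real DIM('a) / \<theta>" and \<kappa>: "0 < \<kappa>" and U0: "\<tau>0 < U0"
    and f'F: "\<And>u. U0 \<le> u \<Longrightarrow> r \<le> f' u * F u \<and> f' u * F u \<le> r + 1 - \<kappa>"
    using critical_exponents[OF sup] by blast
  have r': "\<theta> * r < real DIM('a)" "0 \<le> r" using r \<theta> by (auto simp: field_simps)
  let ?k = "\<lambda>x t. ennreal (frac_heat_kernel \<theta> (x::'a) t)"
  obtain C where C: "C > 0" and smooth: "\<And>t x. t > 0 \<Longrightarrow> (\<integral>\<^sup>+y. ?k (x - y) t * ennreal (norm y powr - (\<theta> * r)) \<partial>lborel) \<le> ennreal (C * t powr - r)"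
    using frac_heat_kernel_smoothing[OF \<theta> r'(2,1)] by blast
  \<comment> \<open>Chosen so that \<open>E = (4 C)^(1/r) b\<close> below satisfies
    \<open>2 E / \<kappa> \<le> 1 / r\<close>, the inequality that closes the estimate of the
    Duhamel term.\<close>
  define b0 where "b0 = \<kappa> / (2 * r * (4 * C) powr (1 / r))"
  have "b0 > 0" using \<kappa> r C by (simp add: b0_def)
  moreover have "locally_solvable \<theta> f \<mu>"
    if b: "0 < b" "b \<le> b0" and U: "\<tau>0 < U" and \<mu>[measurable]: "\<mu> \<in> borel_measurable borel" and \<mu>0: "\<And>x. 0 \<le> \<mu> x"
      and G: "\<And>x. U < \<mu> x \<Longrightarrow> 1 / F (\<mu> x) \<le> b * norm x powr - \<theta>" for b U and \<mu> :: "'a \<Rightarrow> real"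
  proof -
    define U1 where "U1 = max U U0"
    have U1: "\<tau>0 < U1" "U \<le> U1" "U0 \<le> U1" using U by (auto simp: U1_def)
    define P Q J where "P = (\<lambda>v. f v * F v powr r)" and "Q = (\<lambda>v. f v * F v powr (r + 1))" and "J = (\<lambda>v. F v powr - r)"
    have F0: "0 < F v" if "U1 \<le> v" for v using F_pos that U1 by simp
    have f0: "0 < f v" if "U1 \<le> v" for v using f_pos that U1 \<tau>0 by simp
    have Q0: "0 < Q v" if "U1 \<le> v" for v using F0[OF that] f0[OF that] by (simp add: Q_def)
    have Pinc: "P u \<le> P v" if "U1 \<le> u" "u \<le> v" for u v
      unfolding P_def using f'F that U1 by (intro fF_mono_of_le[OF U0]) auto
    have Qdec: "Q v \<le> Q u" if "U1 \<le> u" "u \<le> v" for u v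
      unfolding Q_def using f'F \<kappa> that U1 by (intro fF_antimono_of_ge[OF U0]) (force, auto)
    have Q\<kappa>dec: "f v * F v powr (r + 1 - \<kappa>) \<le> f u * F u powr (r + 1 - \<kappa>)" if "U1 \<le> u" "u \<le> v" for u v
      using f'F that U1 by (intro fF_antimono_of_ge[OF U0]) auto
    have tangent: "J v + r / Q v * (w - v) \<le> J w" if "U1 \<le> v" "U1 \<le> w" for v w
      unfolding J_def Q_def using Qdec[unfolded Q_def] that by (intro F_powr_above_tangent[OF U1(1) r(1)]) auto
    have Jmono: "J u \<le> J v" if "U1 \<le> u" "u \<le> v" for u v
      unfolding J_def using F_antimono[of u v] F0[of v] that U1 r by (intro powr_mono2') auto
    have Jless: "J u < J v" if "U1 \<le> u" "u < v" for u v
      unfolding J_def using F_strict_antimono[of u v] F0[of v] that U1 r by (intro powr_less_mono2_neg) auto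
    have J0: "0 < J U1" using F0[of U1] by (simp add: J_def)
    have "\<exists>v\<ge>U1. J v = y" if y: "J U1 \<le> y" for y
    proof -
      have y0: "y > 0" using J0 y by simp
      have "y powr (- 1 / r) \<le> J U1 powr (- 1 / r)" using y J0 r by (intro powr_mono2') auto
      also have "\<dots> = F U1" using r F0[of U1] by (simp add: J_def powr_powr)
      finally obtain v where v: "v \<ge> U1" "F v = y powr (- 1 / r)"
        using F_onto[OF U1(1), of "y powr (- 1 / r)"] y0 by auto
      have "J v = y" unfolding J_def v(2) using r y0 by (simp add: powr_powr)
      then show ?thesis using v by blast
    qed
    then obtain V0 where V0: "\<And>y. J U1 \<le> y \<Longrightarrow> U1 \<le> V0 y \<and> J (V0 y) = y" by metis
    \<comment> \<open>V is the inverse of J on [J U1, \<infinity>), continued by a constant below.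
      It is thus total and monotone, hence Borel.\<close>
    define V where "V = (\<lambda>y. V0 (max y (J U1)))"
    have VU: "U1 \<le> V y" for y using V0[of "max y (J U1)"] by (simp add: V_def)
    have JV: "J (V y) = y" if "J U1 \<le> y" for y using V0[of y] that by (simp add: V_def max_absorb1)
    have Vmono: "V x \<le> V y" if "x \<le> y" for x y
    proof (rule ccontr)
      assume "\<not> V x \<le> V y"
      then have "J (V y) < J (V x)" using Jless[OF VU] by simp
      then show False using V0[of "max y (J U1)"] V0[of "max x (J U1)"] that by (auto simp: V_def max_def split: if_splits)
    qed
    have [measurable]: "V \<in> borel_measurable borel" by (rule borel_measurable_mono) (auto intro!: monoI Vmono)
    \<comment> \<open>Raising the datum to at least U1 brings all its values into the region where J
      is convex, at the price of the constant J U1 in the bound for z.\<close>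
    define \<mu>' where "\<mu>' = (\<lambda>y. max (\<mu> y) U1)"
    have \<mu>'U: "U1 \<le> \<mu>' y" for y by (simp add: \<mu>'_def)
    define Jm where "Jm = (\<lambda>y. J (\<mu>' y))"
    have Jm_meas[measurable]: "Jm \<in> borel_measurable borel"
    proof -
      have "(\<lambda>v. J (max v U1)) \<in> borel_measurable borel"
        by (rule borel_measurable_mono) (auto intro!: monoI Jmono)
      then show ?thesis unfolding Jm_def \<mu>'_def by measurable
    qed
    have Jm_ge: "J U1 \<le> Jm y" for y unfolding Jm_def by (intro Jmono \<mu>'U order_refl)
    have Jm0: "0 \<le> Jm y" for y using Jm_ge[of y] J0 by simp
    have Jm_le: "Jm y \<le> J U1 + b powr r * norm y powr - (\<theta> * r)" for y
    proof (cases "U1 < \<mu> y")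
      case True
      have Fy: "F (\<mu> y) > 0" using True by (intro F0) auto
      have "Jm y = (1 / F (\<mu> y)) powr r" using True Fy by (simp add: Jm_def \<mu>'_def J_def powr_minus_divide powr_divide)
      also have "\<dots> \<le> (b * norm y powr - \<theta>) powr r" using G[of y] True U1 r Fy by (intro powr_mono2) auto
      also have "\<dots> = b powr r * norm y powr - (\<theta> * r)" using b by (simp add: powr_mult powr_powr)
      finally show ?thesis using J0 by simp
    next
      case False
      then have "Jm y = J U1" by (simp add: Jm_def \<mu>'_def max_absorb2)
      then show ?thesis by simp
    qed
    define z where "z = (\<lambda>x t. \<integral>\<^sup>+y. ?k (x - y) t * ennreal (Jm y) \<partial>lborel)"
    have z_ge: "ennreal (J U1) \<le> z x t" if "t > 0" for x t
    proof -
      have "ennreal (J U1) = (\<integral>\<^sup>+y. ?k (x - y) t * ennreal (J U1) \<partial>lborel)"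
        using frac_heat_kernel_mass[OF \<theta> that, of x] by (simp add: nn_integral_multc)
      also have "\<dots> \<le> z x t" unfolding z_def by (intro nn_integral_mono mult_left_mono ennreal_leI Jm_ge) simp
      finally show ?thesis .
    qed
    have z_le: "z x t \<le> ennreal (J U1 + b powr r * (C * t powr - r))" if t: "t > 0" for x t
    proof -
      have "z x t \<le> (\<integral>\<^sup>+y. ?k (x - y) t * ennreal (J U1) + ennreal (b powr r) * (?k (x - y) t * ennreal (norm y powr - (\<theta> * r))) \<partial>lborel)"
        unfolding z_def
      proof (rule nn_integral_mono)
        fix y :: 'a
        have "?k (x - y) t * ennreal (Jm y) \<le> ?k (x - y) t * ennreal (J U1 + b powr r * norm y powr - (\<theta> * r))"
          by (intro mult_left_mono ennreal_leI Jm_le) simp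
        also have "\<dots> = ?k (x - y) t * ennreal (J U1) + ennreal (b powr r) * (?k (x - y) t * ennreal (norm y powr - (\<theta> * r)))"
          using J0 by (simp add: ennreal_plus ennreal_mult distrib_left mult.left_commute)
        finally show "?k (x - y) t * ennreal (Jm y) \<le> \<dots>" .
      qed
      also have "\<dots> = ennreal (J U1) + ennreal (b powr r) * (\<integral>\<^sup>+y. ?k (x - y) t * ennreal (norm y powr - (\<theta> * r)) \<partial>lborel)"
        using frac_heat_kernel_mass[OF \<theta> t, of x] by (simp add: nn_integral_add nn_integral_cmult nn_integral_multc)
      also have "\<dots> \<le> ennreal (J U1) + ennreal (b powr r) * ennreal (C * t powr - r)"
        by (intro add_left_mono mult_left_mono smooth t) simp
      also have "\<dots> = ennreal (J U1 + b powr r * (C * t powr - r))"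
        using J0 C by (simp add: ennreal_plus ennreal_mult)
      finally show ?thesis .
    qed
    define Z where "Z = (\<lambda>x t. enn2real (z x t))"
    have Z: "z x t = ennreal (Z x t)" if "t > 0" for x t
      unfolding Z_def using z_le[OF that, of x] by (intro ennreal_enn2real[symmetric]) (simp add: le_less_trans)
    have Z_ge: "J U1 \<le> Z x t" if "t > 0" for x t
      using z_ge[OF that, of x] unfolding Z[OF that] by (simp add: Z_def)
    \<comment> \<open>T is the time at which C b^r t^(-r) has decreased to J U1; before it the
      constant is dominated by the singular part.\<close>
    define T where "T = (C * b powr r / J U1) powr (1 / r)"
    have T: "T > 0" using C b J0 by (simp add: T_def)
    have T_le: "J U1 \<le> C * b powr r * t powr - r" if t: "0 < t" "t < T" for t
    proof -
      have "T powr - r \<le> t powr - r" using t r by (intro powr_mono2') auto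
      moreover have "T powr - r = J U1 / (C * b powr r)"
        using r C b J0 by (simp add: T_def powr_powr powr_minus_divide)
      ultimately show ?thesis using C b by (simp add: pos_divide_le_eq mult.commute)
    qed
    \<comment> \<open>The 4 combines the doubling in 2z with the doubling that absorbs J U1. In
      terms of F, the resulting bound 2z \<le> (E/t)^r says that v is at most F^(-1)(t/E).\<close>
    define E where "E = (4 * C) powr (1 / r) * b"
    have E: "E > 0" using C b by (simp add: E_def)
    have Er: "E powr r = 4 * C * b powr r" using C b r by (simp add: E_def powr_mult powr_powr)
    have E\<kappa>: "2 * E / \<kappa> \<le> 1 / r"
    proof -
      have "E \<le> (4 * C) powr (1 / r) * b0" unfolding E_def using b C by (intro mult_left_mono) auto
      also have "\<dots> = \<kappa> / (2 * r)" using C by (simp add: b0_def)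
      finally show ?thesis using \<kappa> r by (simp add: field_simps)
    qed
    have Z_le: "2 * Z x t \<le> (E / t) powr r" if t: "0 < t" "t < T" for x t
    proof -
      have "ennreal (Z x t) \<le> ennreal (J U1 + b powr r * (C * t powr - r))" using z_le[OF t(1), of x] Z[OF t(1)] by simp
      moreover have "0 \<le> J U1 + b powr r * (C * t powr - r)" using J0 C by (intro add_nonneg_nonneg) auto
      ultimately have "Z x t \<le> J U1 + b powr r * (C * t powr - r)" by (simp add: ennreal_le_iff)
      also have "\<dots> \<le> 2 * (C * b powr r * t powr - r)" using T_le[OF t] by (simp add: mult_ac)
      finally have "2 * Z x t \<le> E powr r * t powr - r" by (simp add: Er)
      then show ?thesis using E t by (simp add: powr_divide powr_minus_divide)
    qed
    define v where "v = (\<lambda>x t. if 0 < t then V (2 * Z x t) else U1)"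
    have zm: "(\<lambda>p. z (fst p) (snd p)) \<in> borel_measurable borel"
      unfolding z_def borel_prod[symmetric]
    proof (rule borel_measurable_heat_convolution[where h="\<lambda>y s. ennreal (Jm y)" and \<sigma>=snd])
      show "(\<lambda>z::'a \<times> real. ennreal (Jm (fst z))) \<in> borel_measurable borel"
        by (subst borel_prod[symmetric]) measurable
    qed measurable
    have vm: "(\<lambda>p. v (fst p) (snd p)) \<in> borel_measurable borel"
    proof -
      have [measurable]: "snd \<in> borel_measurable (borel :: ('a \<times> real) measure)"
        by (intro borel_measurable_continuous_onI continuous_intros)
      show ?thesis unfolding v_def Z_def using zm by measurable
    qed
    show ?thesis
    proof (rule locally_solvable_of_supersolution[OF T f_cont f_mono f_nonneg \<mu> vm])
      show "0 \<le> v x t" for x t using VU[of "2 * Z x t"] U1 \<tau>0 by (auto simp: v_def)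
      have "duhamel \<theta> f \<mu> v x t \<le> ennreal (v x t)" if t: "0 < t" "t < T" for x t
      proof -
        define v1 v2 vt where "v1 = V (Z x t)" and "v2 = V (2 * Z x t)" and "vt = V ((E / t) powr r)"
        have ZJ: "J U1 \<le> Z x t" by (rule Z_ge[OF t(1)])
        have Zpos: "0 < Z x t" using ZJ J0 by simp
        have J1: "J v1 = Z x t" unfolding v1_def by (rule JV[OF ZJ])
        have J2: "J v2 = 2 * Z x t" unfolding v2_def using ZJ Zpos by (intro JV) simp
        have EtJ: "J U1 \<le> (E / t) powr r" using Z_le[OF t, of x] ZJ Zpos by linarith
        have v2t: "v2 \<le> vt" unfolding v2_def vt_def by (intro Vmono Z_le t)
        have v12: "v1 \<le> v2" unfolding v1_def v2_def using Zpos by (intro Vmono) simp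
        have VF: "F (V ((E / s) powr r)) = s / E" if s: "0 < s" "s \<le> t" for s
        proof -
          have "(E / t) powr r \<le> (E / s) powr r" using s t E r by (intro powr_mono2) (auto simp: frac_le)
          then have "J (V ((E / s) powr r)) = (E / s) powr r" using EtJ by (intro JV) simp
          then have "(F (V ((E / s) powr r)) powr - r) powr (- 1 / r) = ((E / s) powr r) powr (- 1 / r)" by (simp add: J_def)
          moreover have "(F (V ((E / s) powr r)) powr - r) powr (- 1 / r) = F (V ((E / s) powr r))"
            using r F0[OF VU, of "(E / s) powr r"] by (simp add: powr_powr)
          moreover have "((E / s) powr r) powr (- 1 / r) = s / E"
            using r E s by (simp add: powr_powr powr_neg_one)
          ultimately show ?thesis by simp
        qed
        \<comment> \<open>Jensen's inequality in tangent form: J v1 + d (\<mu>' - v1) \<le>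
          J(\<mu>') is integrated against the kernel, and J v1 = z cancels from both sides. Negative
          terms are first moved across, since the values lie in [0, \<infinity>].\<close>
        have first: "(\<integral>\<^sup>+ y. ?k (x - y) t * ennreal (\<mu> y) \<partial>lborel) \<le> ennreal v1"
        proof -
          define d where "d = r / Q v1"
          have d: "d > 0" using r Q0[OF VU] by (simp add: d_def v1_def)
          have v1U: "U1 \<le> v1" by (simp add: v1_def VU)
          have v10: "0 \<le> v1" using v1U U1 \<tau>0 by simp
          let ?S = "\<integral>\<^sup>+ y. ?k (x - y) t * ennreal (\<mu> y) \<partial>lborel"
          have "ennreal (J v1) + ennreal d * ?S = (\<integral>\<^sup>+ y. ?k (x - y) t * ennreal (J v1) + ennreal d * (?k (x - y) t * ennreal (\<mu> y)) \<partial>lborel)"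
            using frac_heat_kernel_mass[OF \<theta> t(1), of x] by (simp add: nn_integral_add nn_integral_cmult nn_integral_multc)
          also have "\<dots> \<le> (\<integral>\<^sup>+ y. ?k (x - y) t * ennreal (d * v1) + ?k (x - y) t * ennreal (Jm y) \<partial>lborel)"
          proof (rule nn_integral_mono)
            fix y :: 'a
            have "J v1 + d * \<mu> y \<le> d * v1 + Jm y"
            proof -
              have "J v1 + d * (\<mu>' y - v1) \<le> Jm y" unfolding d_def Jm_def by (intro tangent v1U \<mu>'U)
              moreover have "d * \<mu> y \<le> d * \<mu>' y" using d by (intro mult_left_mono) (auto simp: \<mu>'_def)
              ultimately show ?thesis by (simp add: algebra_simps)
            qed
            then have "ennreal (J v1 + d * \<mu> y) \<le> ennreal (d * v1 + Jm y)" by (rule ennreal_leI)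
            then have "ennreal (J v1) + ennreal d * ennreal (\<mu> y) \<le> ennreal (d * v1) + ennreal (Jm y)"
              using d \<mu>0[of y] v10 Jm0[of y] by (simp add: ennreal_plus ennreal_mult J_def)
            from mult_left_mono[OF this, of "?k (x - y) t"]
            show "?k (x - y) t * ennreal (J v1) + ennreal d * (?k (x - y) t * ennreal (\<mu> y)) \<le> ?k (x - y) t * ennreal (d * v1) + ?k (x - y) t * ennreal (Jm y)"
              by (simp add: distrib_left mult.left_commute)
          qed
          also have "\<dots> = ennreal (d * v1) + z x t"
            unfolding z_def using frac_heat_kernel_mass[OF \<theta> t(1), of x] by (simp add: nn_integral_add nn_integral_multc)
          finally have "ennreal (J v1) + ennreal d * ?S \<le> ennreal (J v1) + ennreal (d * v1)"
            by (simp add: Z[OF t(1)] J1 add.commute)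
          then have "ennreal d * ?S \<le> ennreal d * ennreal v1"
            using d v10 by (simp add: ennreal_add_left_cancel_le ennreal_mult)
          then show ?thesis using d by (simp add: ennreal_mult_le_mult_iff)
        qed
        define D where "D = Q vt * E * t powr - \<kappa>"
        have D0: "0 \<le> D" using Q0[OF VU, of "(E / t) powr r"] E by (simp add: D_def vt_def)
        \<comment> \<open>Write f(v) = P(v) J(v) with J(v) = 2z. As P increases, it may be evaluated
          at the upper bound vs = F^(-1)(s/E). There P is f F^(r+1-\<kappa>) times F^(\<kappa>-1);
          the first factor decreases, so it is at most its value at vt \<le> vs, and the second is a
          multiple of s^(\<kappa>-1).\<close>
        have fv: "f (v y s) \<le> D * s powr (\<kappa> - 1) * (2 * Z y s)" if s: "0 < s" "s < t" for y s
        proof -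
          define vs where "vs = V ((E / s) powr r)"
          have sT: "s < T" using s t by simp
          have Fs: "F vs = s / E" unfolding vs_def using s by (intro VF) auto
          have Ft: "F vt = t / E" unfolding vt_def using t by (intro VF) auto
          have vsU: "U1 \<le> vs" by (simp add: vs_def VU)
          have vtU: "U1 \<le> vt" by (simp add: vt_def VU)
          have "(E / t) powr r \<le> (E / s) powr r" using s t E r by (intro powr_mono2) (auto simp: frac_le)
          then have vst: "vt \<le> vs" unfolding vs_def vt_def by (rule Vmono)
          have vy: "v y s = V (2 * Z y s)" using s by (simp add: v_def)
          have JZ: "J (v y s) = 2 * Z y s" unfolding vy using Z_ge[OF s(1), of y] J0 by (intro JV) simp
          have vyU: "U1 \<le> v y s" by (simp add: vy VU)
          have "f (v y s) = P (v y s) * J (v y s)"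
            using F0[OF vyU] by (simp add: P_def J_def powr_minus_divide)
          also have "\<dots> \<le> P vs * J (v y s)"
            using s sT by (intro mult_right_mono Pinc vyU) (auto simp: vy vs_def J_def intro!: Vmono Z_le)
          also have "P vs = f vs * F vs powr (r + 1 - \<kappa>) * F vs powr (\<kappa> - 1)"
            unfolding P_def by (simp add: mult.assoc powr_add[symmetric])
          also have "\<dots> \<le> f vt * F vt powr (r + 1 - \<kappa>) * F vs powr (\<kappa> - 1)"
            by (intro mult_right_mono Q\<kappa>dec vtU vst) auto
          also have "\<dots> = D * s powr (\<kappa> - 1)"
          proof -
            have "Q vt = f vt * F vt powr (r + 1 - \<kappa>) * F vt powr \<kappa>"
              unfolding Q_def by (simp add: mult.assoc powr_add[symmetric])
            moreover have "F vt powr \<kappa> * (E * t powr - \<kappa> * s powr (\<kappa> - 1)) = F vs powr (\<kappa> - 1)"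
              unfolding Fs Ft using s t E by (simp add: powr_divide powr_minus_divide powr_diff)
            ultimately show ?thesis unfolding D_def by (simp add: mult.assoc)
          qed
          finally show ?thesis unfolding JZ using Z_ge[OF s(1), of y] J0 by (simp add: mult_right_mono)
        qed
        have second: "(\<integral>\<^sup>+ s \<in> {0<..<t}. (\<integral>\<^sup>+ y. ?k (x - y) (t - s) * ennreal (f (v y s)) \<partial>lborel) \<partial>lborel) \<le> ennreal (v2 - v1)"
        proof -
          have inner: "(\<integral>\<^sup>+ y. ?k (x - y) (t - s) * ennreal (f (v y s)) \<partial>lborel) \<le> ennreal (2 * D * Z x t) * ennreal (s powr (\<kappa> - 1))"
            if s: "0 < s" "s < t" for s
          proof -
            have [measurable]: "(\<lambda>y. z y s) \<in> borel_measurable borel"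
            proof -
              have "(\<lambda>y::'a. (y, s)) \<in> measurable borel borel"
                by (intro borel_measurable_continuous_onI continuous_intros)
              from measurable_compose[OF this zm] show ?thesis by simp
            qed
            have "(\<integral>\<^sup>+ y. ?k (x - y) (t - s) * ennreal (f (v y s)) \<partial>lborel) \<le> (\<integral>\<^sup>+ y. ennreal (2 * D * s powr (\<kappa> - 1)) * (?k (x - y) (t - s) * z y s) \<partial>lborel)"
            proof (rule nn_integral_mono)
              fix y :: 'a
              have "?k (x - y) (t - s) * ennreal (f (v y s)) \<le> ?k (x - y) (t - s) * ennreal ((2 * D * s powr (\<kappa> - 1)) * Z y s)"
                using fv[OF s, of y] by (intro mult_left_mono ennreal_leI) (auto simp: mult_ac)
              also have "\<dots> = ennreal (2 * D * s powr (\<kappa> - 1)) * (?k (x - y) (t - s) * z y s)"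
                unfolding Z[OF s(1)] using D0 by (subst ennreal_mult) (auto simp: Z_def mult_ac)
              finally show "?k (x - y) (t - s) * ennreal (f (v y s)) \<le> \<dots>" .
            qed
            also have "\<dots> = ennreal (2 * D * s powr (\<kappa> - 1)) * (\<integral>\<^sup>+ y. ?k (x - y) (t - s) * z y s \<partial>lborel)"
              by (rule nn_integral_cmult) measurable
            also have "(\<integral>\<^sup>+ y. ?k (x - y) (t - s) * z y s \<partial>lborel) = z x t"
              unfolding z_def using s by (subst frac_heat_kernel_semigroup_nn_integral[OF \<theta>]) auto
            also have "ennreal (2 * D * s powr (\<kappa> - 1)) * z x t = ennreal (2 * D * Z x t) * ennreal (s powr (\<kappa> - 1))"
              unfolding Z[OF t(1)] using D0 Zpos by (simp add: ennreal_mult[symmetric] mult_ac)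
            finally show ?thesis .
          qed
          have "(\<integral>\<^sup>+ s \<in> {0<..<t}. (\<integral>\<^sup>+ y. ?k (x - y) (t - s) * ennreal (f (v y s)) \<partial>lborel) \<partial>lborel)
             \<le> (\<integral>\<^sup>+ s. ennreal (2 * D * Z x t) * (ennreal (s powr (\<kappa> - 1)) * indicator {0<..<t} s) \<partial>lborel)"
            using inner by (intro nn_integral_mono) (auto simp: indicator_def)
          also have "\<dots> = ennreal (2 * D * Z x t) * (\<integral>\<^sup>+ s \<in> {0<..<t}. ennreal (s powr (\<kappa> - 1)) \<partial>lborel)"
            by (rule nn_integral_cmult) measurable
          also have "\<dots> \<le> ennreal (2 * D * Z x t) * ennreal (t powr \<kappa> / \<kappa>)"
            using \<kappa> t by (intro mult_left_mono nn_integral_powr_from_0) auto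
          also have "\<dots> = ennreal (2 * D * Z x t * (t powr \<kappa> / \<kappa>))"
            using D0 Zpos \<kappa> by (intro ennreal_mult[symmetric]) auto
          also have "\<dots> \<le> ennreal (v2 - v1)"
          proof (rule ennreal_leI)
            \<comment> \<open>The powers of t cancel by the choice of D. Since v2 \<le> vt and Q
              decreases, Q vt may be replaced by Q v2; the tangent to J at v2, evaluated at v1,
              converts Z = J v2 - J v1 into v2 - v1.\<close>
            have "2 * D * Z x t * (t powr \<kappa> / \<kappa>) = (2 * E / \<kappa>) * (Z x t * Q vt)"
              using t by (simp add: D_def powr_minus_divide field_simps)
            also have "\<dots> \<le> 1 / r * (Z x t * Q v2)"
              using E\<kappa> r Zpos Qdec[OF _ v2t] Q0[OF VU] by (intro mult_mono mult_left_mono) (auto simp: v2_def vt_def VU less_imp_le)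
            also have "\<dots> \<le> v2 - v1"
            proof -
              have "J v2 + r / Q v2 * (v1 - v2) \<le> J v1" by (intro tangent) (auto simp: v1_def v2_def VU)
              then have "Z x t \<le> r / Q v2 * (v2 - v1)" unfolding J1 J2 by (simp only: right_diff_distrib)
              then show ?thesis using r Q0[of v2] by (simp add: v2_def VU field_simps)
            qed
            finally show "2 * D * Z x t * (t powr \<kappa> / \<kappa>) \<le> v2 - v1" .
          qed
          finally show ?thesis .
        qed
        have "duhamel \<theta> f \<mu> v x t \<le> ennreal v1 + ennreal (v2 - v1)"
          unfolding duhamel_def by (intro add_mono first second)
        also have "\<dots> = ennreal v2" using v12 VU[of "Z x t"] U1 \<tau>0 by (subst ennreal_plus[symmetric]) (auto simp: v1_def)
        also have "v2 = v x t" using t by (simp add: v_def v2_def)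
        finally show ?thesis .
      qed
      then show "AE p in lborel. 0 < snd p \<and> snd p < T \<longrightarrow> duhamel \<theta> f \<mu> v (fst p) (snd p) \<le> ennreal (v (fst p) (snd p))"
        by simp
    qed
  qed
  ultimately show ?thesis by blast
qed

end

section \<open>Nonexistence\<close>

lemma ex_in_open_of_AE_lborel:
  fixes S :: "'a::euclidean_space set"
  assumes "open S" "S \<noteq> {}" and P: "AE x in lborel. P x"
  shows "\<exists>x\<in>S. P x"
proof (rule ccontr)
  assume "\<not> (\<exists>x\<in>S. P x)"
  obtain x e where e: "e > 0" "ball x e \<subseteq> S" using assms by (meson all_not_in_conv open_contains_ball)
  have "AE y in lborel. y \<notin> ball x e"
    using P by eventually_elim (use e \<open>\<not> (\<exists>x\<in>S. P x)\<close> in blast)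
  then have "emeasure lborel (ball x e) = 0"
    by (subst (asm) AE_iff_measurable[OF _ refl]) (auto simp: ball_def)
  moreover have "emeasure lborel (ball x e) > 0" using e by (simp add: emeasure_ball)
  ultimately show False by simp
qed

text \<open>A finite integral leaves w infinite only on a null set, so the real-valued version has
  the same indefinite integral, to which calculus applies.\<close>

lemma nn_integral_eq_indefinite_integral:
  fixes w :: "real \<Rightarrow> ennreal"
  assumes [measurable]: "w \<in> borel_measurable borel" and fin: "(\<integral>\<^sup>+ s \<in> {0<..<t}. w s \<partial>lborel) < \<infinity>"
  shows "(\<lambda>s. enn2real (w s)) integrable_on {0..t}"
    and "\<And>s. 0 \<le> s \<Longrightarrow> s \<le> t \<Longrightarrow> enn2real (\<integral>\<^sup>+ r \<in> {0<..<s}. w r \<partial>lborel) = integral {0..s} (\<lambda>r. enn2real (w r))"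
proof -
  have AEw: "AE r in lborel. r \<in> {0<..<t} \<longrightarrow> w r = ennreal (enn2real (w r))"
  proof -
    have "AE r in lborel. w r * indicator {0<..<t} r \<noteq> \<infinity>"
      using fin by (intro nn_integral_noteq_infinite) auto
    then show ?thesis by eventually_elim (auto simp: indicator_def less_top)
  qed
  have eq: "(\<integral>\<^sup>+ r \<in> {0<..<s}. w r \<partial>lborel) = (\<integral>\<^sup>+ r. ennreal (indicator {0..s} r * enn2real (w r)) \<partial>lborel)"
    if "s \<le> t" for s
  proof (rule nn_integral_cong_AE)
    show "AE r in lborel. w r * indicator {0<..<s} r = ennreal (indicator {0..s} r * enn2real (w r))"
      using AEw AE_lborel_singleton[of 0] AE_lborel_singleton[of s]
      by eventually_elim (use that in \<open>auto simp: indicator_def\<close>)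
  qed
  have int: "set_integrable lborel {0..s} (\<lambda>r. enn2real (w r))" if "s \<le> t" for s
  proof -
    have "(\<integral>\<^sup>+ r \<in> {0<..<s}. w r \<partial>lborel) \<le> (\<integral>\<^sup>+ s \<in> {0<..<t}. w s \<partial>lborel)"
      using that by (intro nn_integral_mono) (auto simp: indicator_def)
    then have "(\<integral>\<^sup>+ r. ennreal (indicator {0..s} r * enn2real (w r)) \<partial>lborel) < \<infinity>"
      using fin eq[OF that] by (simp add: le_less_trans)
    then show ?thesis unfolding set_integrable_def by (subst integrable_iff_bounded) (auto simp: abs_mult)
  qed
  show "(\<lambda>s. enn2real (w s)) integrable_on {0..t}" by (rule set_borel_integral_eq_integral(1)[OF int]) simp
  fix s assume s: "0 \<le> s" "s \<le> t"
  have "(\<integral>\<^sup>+ r \<in> {0<..<s}. w r \<partial>lborel) = ennreal (LINT r:{0..s}|lborel. enn2real (w r))"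
    unfolding eq[OF s(2)] set_lebesgue_integral_def
    using int[OF s(2)] by (subst nn_integral_eq_integral) (auto simp: set_integrable_def)
  moreover have "0 \<le> (LINT r:{0..s}|lborel. enn2real (w r))"
    unfolding set_lebesgue_integral_def by (intro Bochner_Integration.integral_nonneg) auto
  ultimately show "enn2real (\<integral>\<^sup>+ r \<in> {0<..<s}. w r \<partial>lborel) = integral {0..s} (\<lambda>r. enn2real (w r))"
    using set_borel_integral_eq_integral(2)[OF int[OF s(2)]] by simp
qed

context nonlinearity
begin

text \<open>Comparison with H' = f(H), H(0) = h: along H the quantity F(H) decreases at rate at
  least 1 yet stays positive, so it cannot last longer than F h.\<close>

lemma lifespan_le_F:
  fixes w :: "real \<Rightarrow> ennreal"
  assumes w: "w \<in> borel_measurable borel" and h: "\<tau>0 < h" and t: "0 < t"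
    and fin: "(\<integral>\<^sup>+ s \<in> {0<..<t}. w s \<partial>lborel) < \<infinity>"
    and ineq: "AE s in lborel. 0 < s \<and> s < t \<longrightarrow> ennreal (f (h + enn2real (\<integral>\<^sup>+ r \<in> {0<..<s}. w r \<partial>lborel))) \<le> w s"
  shows "t \<le> F h"
proof -
  define W where "W = (\<lambda>s. h + integral {0..s} (\<lambda>r. enn2real (w r)))"
  note I = nn_integral_eq_indefinite_integral[OF w fin]
  have Wc: "continuous_on {0..t} W" unfolding W_def
    by (intro continuous_intros indefinite_integral_continuous_1 I(1))
  have sub: "(\<lambda>r. enn2real (w r)) integrable_on {0..s}" if "s \<le> t" for s
    by (rule integrable_on_subinterval[OF I(1)]) (use that in auto)
  have Wh: "h \<le> W s" if "s \<le> t" for s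
    unfolding W_def using integral_nonneg[OF sub[OF that]] by simp
  have fWc: "continuous_on {0..t} (\<lambda>s. f (W s))"
    by (rule continuous_on_compose2[OF f_cont Wc]) (use Wh h \<tau>0 in force)
  \<comment> \<open>W is only an indefinite integral of an integrable function, but f(W) is
    continuous. Hence V is differentiable with V' = f(W) \<ge> f(V), and the mean value theorem
    applies to F(V) + s.\<close>
  define V where "V = (\<lambda>s. h + integral {0..s} (\<lambda>r. f (W r)))"
  have fWi: "(\<lambda>r. f (W r)) integrable_on {0..s}" if "s \<le> t" for s
    by (intro integrable_continuous_real continuous_on_subset[OF fWc]) (use that in auto)
  have fW0: "0 \<le> f (W r)" if "r \<le> t" for r using Wh[OF that] h \<tau>0 by (intro f_nonneg) simp
  have Vh: "h \<le> V s" if "s \<le> t" for s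
    unfolding V_def using integral_nonneg[OF fWi[OF that]] fW0 that by simp
  have VW: "V s \<le> W s" if s: "0 \<le> s" "s \<le> t" for s
  proof -
    have "ennreal (integral {0..s} (\<lambda>r. f (W r))) = (\<integral>\<^sup>+r. ennreal (f (W r)) * indicator {0..s} r \<partial>lborel)"
      using fW0 s by (intro nn_integral_has_integral_lebesgue'[symmetric] integrable_integral fWi) auto
    also have "\<dots> \<le> (\<integral>\<^sup>+ r \<in> {0<..<s}. w r \<partial>lborel)"
    proof (rule nn_integral_mono_AE)
      show "AE r in lborel. ennreal (f (W r)) * indicator {0..s} r \<le> w r * indicator {0<..<s} r"
        using ineq AE_lborel_singleton[of 0] AE_lborel_singleton[of s]
        by eventually_elim (use s I(2) in \<open>auto simp: indicator_def W_def\<close>)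
    qed
    finally have "ennreal (integral {0..s} (\<lambda>r. f (W r))) \<le> (\<integral>\<^sup>+ r \<in> {0<..<s}. w r \<partial>lborel)" .
    moreover have "(\<integral>\<^sup>+ r \<in> {0<..<s}. w r \<partial>lborel) < \<infinity>"
    proof -
      have "(\<integral>\<^sup>+ r \<in> {0<..<s}. w r \<partial>lborel) \<le> (\<integral>\<^sup>+ s \<in> {0<..<t}. w s \<partial>lborel)"
        using s by (intro nn_integral_mono) (auto simp: indicator_def)
      then show ?thesis using fin by (rule le_less_trans)
    qed
    ultimately have "enn2real (ennreal (integral {0..s} (\<lambda>r. f (W r)))) \<le> enn2real (\<integral>\<^sup>+ r \<in> {0<..<s}. w r \<partial>lborel)"
      by (intro enn2real_mono) auto
    moreover have "0 \<le> integral {0..s} (\<lambda>r. f (W r))"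
      using fW0 s by (intro integral_nonneg fWi) auto
    ultimately have "integral {0..s} (\<lambda>r. f (W r)) \<le> enn2real (\<integral>\<^sup>+ r \<in> {0<..<s}. w r \<partial>lborel)" by simp
    then show ?thesis using I(2)[OF s] by (simp add: V_def W_def)
  qed
  have Vd: "(V has_real_derivative f (W s)) (at s)" if s: "0 < s" "s < t" for s
  proof -
    have "((\<lambda>s. integral {0..s} (\<lambda>r. f (W r))) has_real_derivative f (W s)) (at s within {0..t})"
      using s by (intro integral_has_real_derivative fWc) auto
    then have "((\<lambda>s. integral {0..s} (\<lambda>r. f (W r))) has_real_derivative f (W s)) (at s)"
      using s at_within_interior[of s "{0..t}"] by simp
    then show ?thesis unfolding V_def by (auto intro!: derivative_eq_intros)
  qed
  have Vc: "continuous_on {0..t} V" unfolding V_def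
    by (intro continuous_intros indefinite_integral_continuous_1 fWi) simp
  have Fc: "continuous_on {h..} F"
    using h by (intro continuous_at_imp_continuous_on ballI DERIV_isCont[OF F_deriv]) auto
  define \<phi> where "\<phi> = (\<lambda>s. F (V s) + s)"
  have d\<phi>: "(\<phi> has_real_derivative - (1 / f (V s)) * f (W s) + 1) (at s)" if s: "0 < s" "s < t" for s
    unfolding \<phi>_def using Vh[of s] h s by (intro DERIV_add DERIV_chain2[OF F_deriv Vd] DERIV_ident) auto
  have "\<exists>l z. 0 < z \<and> z < t \<and> (\<phi> has_real_derivative l) (at z) \<and> \<phi> t - \<phi> 0 = (t - 0) * l"
  proof (rule MVT[OF t])
    show "continuous_on {0..t} \<phi>" unfolding \<phi>_def
      by (intro continuous_intros continuous_on_compose2[OF Fc Vc]) (use Vh in auto)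
    show "\<phi> differentiable (at s)" if "0 < s" "s < t" for s
      using d\<phi>[OF that] by (auto simp: real_differentiable_def)
  qed
  then obtain l z where z: "0 < z" "z < t" "(\<phi> has_real_derivative l) (at z)" "\<phi> t - \<phi> 0 = t * l" by auto
  have "l = - (1 / f (V z)) * f (W z) + 1" using DERIV_unique[OF z(3) d\<phi>[OF z(1,2)]] .
  moreover have "f (V z) \<le> f (W z)" using VW[of z] Vh[of z] z h \<tau>0 by (intro mono_onD[OF f_mono]) auto
  moreover have "0 < f (V z)" using Vh[of z] z h \<tau>0 by (intro f_pos) auto
  then have "1 \<le> f (W z) / f (V z)" using \<open>f (V z) \<le> f (W z)\<close> by simp
  ultimately have "l \<le> 0" by simp
  then have "t * l \<le> 0" using t by (intro mult_nonneg_nonpos) auto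
  then have "\<phi> t \<le> \<phi> 0" using z(4) by simp
  moreover have "0 < F (V t)" using Vh[of t] h by (intro F_pos) auto
  ultimately show ?thesis by (simp add: \<phi>_def V_def)
qed

text \<open>Along a solution the caloric average \<open>s \<mapsto> S(t - s)u(s)(x)\<close> satisfies \<open>H' \<ge> f(H)\<close> by Jensen's inequality,
  so it would blow up before time t if it started above \<open>F\<^bsup>-1\<^esup>(t)\<close>.\<close>
lemma solution_imp_time_le_F:
  fixes \<mu> :: "'a::euclidean_space \<Rightarrow> real"
  assumes \<theta>: "0 < \<theta>" "\<theta> \<le> 2" and \<mu>[measurable]: "\<mu> \<in> borel_measurable borel"
    and U: "\<tau>0 < U" "\<And>v w. U \<le> v \<Longrightarrow> 0 \<le> w \<Longrightarrow> f v + f' v * w \<le> f w + f' v * v"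
    and sol: "she_solution \<theta> f \<mu> T u"
  shows "AE z in lborel. 0 < snd z \<and> snd z < T \<longrightarrow>
    (\<exists>h\<ge>0. (\<integral>\<^sup>+ y. ennreal (frac_heat_kernel \<theta> (fst z - y) (snd z)) * ennreal (\<mu> y) \<partial>lborel) = ennreal h \<and> (U \<le> h \<longrightarrow> snd z \<le> F h))"
proof -
  let ?k = "\<lambda>x t. ennreal (frac_heat_kernel \<theta> (x::'a) t)"
  have um: "(\<lambda>z. u (fst z) (snd z)) \<in> borel_measurable borel"
    and u0: "\<And>x t. 0 < t \<Longrightarrow> t < T \<Longrightarrow> 0 \<le> u x t"
    and ueq: "AE z in lborel. 0 < snd z \<and> snd z < T \<longrightarrow> ennreal (u (fst z) (snd z)) = duhamel \<theta> f \<mu> u (fst z) (snd z)"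
    using sol by (auto simp: she_solution_iff)
  \<comment> \<open>The sign of u is known only for 0 < t < T; cutting off outside changes no
    Duhamel integral up to time T and makes f(u1) measurable on all of space-time.\<close>
  define u1 where "u1 = (\<lambda>x t. if 0 < t \<and> t < T then u x t else 0)"
  have u10: "0 \<le> u1 x t" for x t using u0 by (simp add: u1_def)
  have snd_m[measurable]: "snd \<in> borel_measurable (borel :: ('a \<times> real) measure)"
    by (intro borel_measurable_continuous_onI continuous_intros)
  have u1m[measurable]: "(\<lambda>z. u1 (fst z) (snd z)) \<in> borel_measurable borel"
    unfolding u1_def using um by measurable
  have fu1m[measurable]: "(\<lambda>z. f (u1 (fst z) (snd z))) \<in> borel_measurable borel"
  proof -
    have "continuous_on UNIV (\<lambda>a. f (max 0 a))"
      by (rule continuous_on_compose2[OF f_cont]) (auto intro!: continuous_intros)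
    then have "(\<lambda>a. f (max 0 a)) \<in> borel_measurable borel" by (rule borel_measurable_continuous_onI)
    from measurable_compose[OF u1m this] show ?thesis using u10 by (simp add: max_absorb2)
  qed
  have sec: "(\<lambda>y::'a. (y, s)) \<in> measurable borel borel" for s :: real
    by (intro borel_measurable_continuous_onI continuous_intros)
  have fu1s[measurable]: "(\<lambda>y. f (u1 y s)) \<in> borel_measurable borel" for s
    using measurable_compose[OF sec fu1m, of s] by simp
  have u1s[measurable]: "(\<lambda>y. u1 y s) \<in> borel_measurable borel" for s
    using measurable_compose[OF sec u1m, of s] by simp
  define w where "w = (\<lambda>x t s. \<integral>\<^sup>+ y. ?k (x - y) (t - s) * ennreal (f (u1 y s)) \<partial>lborel)"
  have wm[measurable]: "w x t \<in> borel_measurable borel" for x t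
    unfolding w_def using fu1m by (intro borel_measurable_heat_convolution[where h="\<lambda>y s. ennreal (f (u1 y s))"]; measurable)
  define H where "H = (\<lambda>x t. \<integral>\<^sup>+ y. ?k (x - y) t * ennreal (\<mu> y) \<partial>lborel)"
  have duh: "duhamel \<theta> f \<mu> u1 x t = H x t + (\<integral>\<^sup>+ s \<in> {0<..<t}. w x t s \<partial>lborel)" for x t
    by (simp add: duhamel_def H_def w_def)
  have Hm[measurable]: "(\<lambda>y. H y s) \<in> borel_measurable borel" for s
    unfolding H_def by measurable
  define good where "good = (\<lambda>z. 0 < snd z \<and> snd z < T \<longrightarrow> ennreal (u1 (fst z) (snd z)) = duhamel \<theta> f \<mu> u1 (fst z) (snd z))"
  have good: "AE z in lborel. good z"
    using ueq
  proof eventually_elim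
    case (elim z)
    have "duhamel \<theta> f \<mu> u1 (fst z) (snd z) = duhamel \<theta> f \<mu> u (fst z) (snd z)" if "snd z < T"
      by (intro antisym duhamel_mono) (use that in \<open>auto simp: u1_def\<close>)
    then show ?case using elim by (auto simp: good_def u1_def)
  qed
  \<comment> \<open>Averaging u1 at time s requires the equation at almost every y for that s.
    Fubini first gives almost every s for almost every y, hence the exchange of order.\<close>
  have good_s: "AE s in lborel. AE y in lborel. good (y, s)"
  proof -
    have [measurable]: "(\<lambda>z. duhamel \<theta> f \<mu> u1 (fst z) (snd z)) \<in> borel_measurable borel"
      by (intro borel_measurable_duhamel \<mu> fu1m)
    have "Measurable.pred borel good" unfolding good_def by measurable
    then have "{z \<in> space (lborel \<Otimes>\<^sub>M lborel). good (fst z, snd z)} \<in> sets (lborel \<Otimes>\<^sub>M lborel)"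
      unfolding lborel_prod by simp
    moreover have "AE y in lborel. AE s in lborel. good (y, s)"
      using good unfolding lborel_prod[symmetric] by (rule lborel_pair.AE_pair)
    ultimately show ?thesis using lborel_pair.AE_commute[of "\<lambda>y s. good (y, s)"] by simp
  qed
  have key: "\<exists>h\<ge>0. H x t = ennreal h \<and> (U \<le> h \<longrightarrow> t \<le> F h)" if g: "good (x, t)" and t: "0 < t" "t < T" for x t
  proof -
    have eq: "ennreal (u1 x t) = H x t + (\<integral>\<^sup>+ s \<in> {0<..<t}. w x t s \<partial>lborel)"
      using g t by (simp add: good_def duh)
    then have Hfin: "H x t < \<infinity>" and Wfin: "(\<integral>\<^sup>+ s \<in> {0<..<t}. w x t s \<partial>lborel) < \<infinity>"
      using ennreal_less_top[of "u1 x t"] by (auto simp: ennreal_add_less_top)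
    define h where "h = enn2real (H x t)"
    have Hh: "H x t = ennreal h" using Hfin by (simp add: h_def)
    have h0: "0 \<le> h" by (simp add: h_def)
    have "t \<le> F h" if Uh: "U \<le> h"
    proof (rule lifespan_le_F[OF wm[of x t] _ t(1) Wfin])
      show "\<tau>0 < h" using U Uh by simp
      show "AE s in lborel. 0 < s \<and> s < t \<longrightarrow> ennreal (f (h + enn2real (\<integral>\<^sup>+ r \<in> {0<..<s}. w x t r \<partial>lborel))) \<le> w x t s"
        using good_s
      proof eventually_elim
        case (elim s)
        show ?case
        proof
          assume s: "0 < s \<and> s < t"
          define A where "A = enn2real (\<integral>\<^sup>+ r \<in> {0<..<s}. w x t r \<partial>lborel)"
          have A: "(\<integral>\<^sup>+ r \<in> {0<..<s}. w x t r \<partial>lborel) = ennreal A"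
          proof -
            have "(\<integral>\<^sup>+ r \<in> {0<..<s}. w x t r \<partial>lborel) \<le> (\<integral>\<^sup>+ r \<in> {0<..<t}. w x t r \<partial>lborel)"
              using s by (intro nn_integral_mono) (auto simp: indicator_def)
            then show ?thesis unfolding A_def using Wfin by (simp add: le_less_trans)
          qed
          have A0: "0 \<le> A" by (simp add: A_def)
          \<comment> \<open>Propagating the equation at time s up to time t by the semigroup law,
            here for the source and in \<open>HH\<close> for the datum, gives S(t-s)u(s)(x) = h + A:
            the datum part h is independent of s, and A integrates the same w over (0, s).\<close>
          have ww: "(\<integral>\<^sup>+ y. ?k (x - y) (t - s) * w y s r \<partial>lborel) = w x t r" if r: "0 < r" "r < s" for r
          proof -
            have "(\<integral>\<^sup>+ y. ?k (x - y) (t - s) * w y s r \<partial>lborel) = (\<integral>\<^sup>+ y. ?k (x - y) (t - s + (s - r)) * ennreal (f (u1 y r)) \<partial>lborel)"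
              unfolding w_def using s r by (intro frac_heat_kernel_semigroup_nn_integral[OF \<theta>]) auto
            then show ?thesis by (simp add: w_def)
          qed
          have HH: "(\<integral>\<^sup>+ y. ?k (x - y) (t - s) * H y s \<partial>lborel) = H x t"
            unfolding H_def using s by (subst frac_heat_kernel_semigroup_nn_integral[OF \<theta>]) auto
          have wym: "(\<lambda>p. w (fst p) s (snd p)) \<in> borel_measurable (borel \<Otimes>\<^sub>M borel)"
            unfolding w_def using fu1m by (intro borel_measurable_heat_convolution[where h="\<lambda>y s. ennreal (f (u1 y s))"]; measurable)
          have wym'[measurable]: "(\<lambda>p. ?k (x - fst p) (t - s) * (w (fst p) s (snd p) * indicator {0<..<s} (snd p))) \<in> borel_measurable (lborel \<Otimes>\<^sub>M lborel)"
            using wym by measurable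
          have wy[measurable]: "(\<lambda>y. \<integral>\<^sup>+ r \<in> {0<..<s}. w y s r \<partial>lborel) \<in> borel_measurable borel"
          proof (subst measurable_lborel2[symmetric], rule lborel.borel_measurable_nn_integral)
            show "(\<lambda>(y, r). w y s r * indicator {0<..<s} r) \<in> borel_measurable (lborel \<Otimes>\<^sub>M lborel)"
              unfolding split_beta' using wym by measurable
          qed
          have ws[measurable]: "w y s \<in> borel_measurable borel" for y by (rule wm)
          have "(\<integral>\<^sup>+ y. ?k (x - y) (t - s) * ennreal (u1 y s) \<partial>lborel)
             = (\<integral>\<^sup>+ y. ?k (x - y) (t - s) * H y s + ?k (x - y) (t - s) * (\<integral>\<^sup>+ r \<in> {0<..<s}. w y s r \<partial>lborel) \<partial>lborel)"
          proof (rule nn_integral_cong_AE)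
            show "AE y in lborel. ?k (x - y) (t - s) * ennreal (u1 y s) = ?k (x - y) (t - s) * H y s + ?k (x - y) (t - s) * (\<integral>\<^sup>+ r \<in> {0<..<s}. w y s r \<partial>lborel)"
              using elim by eventually_elim (use s t in \<open>simp add: good_def duh distrib_left\<close>)
          qed
          also have "\<dots> = H x t + (\<integral>\<^sup>+ y. ?k (x - y) (t - s) * (\<integral>\<^sup>+ r \<in> {0<..<s}. w y s r \<partial>lborel) \<partial>lborel)"
            by (subst nn_integral_add) (auto simp: HH)
          also have "(\<integral>\<^sup>+ y. ?k (x - y) (t - s) * (\<integral>\<^sup>+ r \<in> {0<..<s}. w y s r \<partial>lborel) \<partial>lborel)
             = (\<integral>\<^sup>+ y. (\<integral>\<^sup>+ r. ?k (x - y) (t - s) * (w y s r * indicator {0<..<s} r) \<partial>lborel) \<partial>lborel)"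
            by (intro nn_integral_cong nn_integral_cmult[symmetric]) measurable
          also have "\<dots> = (\<integral>\<^sup>+ r. (\<integral>\<^sup>+ y. ?k (x - y) (t - s) * (w y s r * indicator {0<..<s} r) \<partial>lborel) \<partial>lborel)"
            by (rule lborel_pair.Fubini'[symmetric]) (use wym' in \<open>simp add: split_beta'\<close>)
          also have "\<dots> = (\<integral>\<^sup>+ r \<in> {0<..<s}. w x t r \<partial>lborel)"
            using ww by (intro nn_integral_cong) (auto simp: indicator_def)
          finally have I: "(\<integral>\<^sup>+ y. ?k (x - y) (t - s) * ennreal (u1 y s) \<partial>lborel) = ennreal (h + A)"
            using h0 A0 by (simp add: Hh A ennreal_plus)
          define v where "v = h + A"
          have vU: "U \<le> v" using Uh A0 by (simp add: v_def)
          have v0: "0 \<le> v" using h0 A0 by (simp add: v_def)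
          have p0: "0 \<le> f' v" using U vU by (intro f'_nonneg) simp
          have fv0: "0 \<le> f v" using v0 by (rule f_nonneg)
          have ts: "0 < t - s" using s by simp
          \<comment> \<open>Jensen's inequality by integrating the tangent of f at the mean value v
            = h + A; the term f' v * v is kept on the right to avoid subtraction in
            [0, \<infinity>].\<close>
          have "ennreal (f v) + ennreal (f' v) * ennreal v =
              (\<integral>\<^sup>+ y. ?k (x - y) (t - s) * ennreal (f v) + ennreal (f' v) * (?k (x - y) (t - s) * ennreal (u1 y s)) \<partial>lborel)"
            using frac_heat_kernel_mass[OF \<theta> ts, of x] I by (simp add: nn_integral_add nn_integral_cmult nn_integral_multc v_def)
          also have "\<dots> \<le> (\<integral>\<^sup>+ y. ?k (x - y) (t - s) * ennreal (f (u1 y s)) + ?k (x - y) (t - s) * ennreal (f' v * v) \<partial>lborel)"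
          proof (rule nn_integral_mono)
            fix y :: 'a
            have "ennreal (f v + f' v * u1 y s) \<le> ennreal (f (u1 y s) + f' v * v)"
              by (intro ennreal_leI U(2) vU u10)
            then have "ennreal (f v) + ennreal (f' v) * ennreal (u1 y s) \<le> ennreal (f (u1 y s)) + ennreal (f' v * v)"
              using fv0 p0 u10[of y s] f_nonneg[OF u10[of y s]] v0 by (simp add: ennreal_plus ennreal_mult)
            from mult_left_mono[OF this, of "?k (x - y) (t - s)"]
            show "?k (x - y) (t - s) * ennreal (f v) + ennreal (f' v) * (?k (x - y) (t - s) * ennreal (u1 y s)) \<le> ?k (x - y) (t - s) * ennreal (f (u1 y s)) + ?k (x - y) (t - s) * ennreal (f' v * v)"
              by (simp add: distrib_left mult.left_commute)
          qed
          also have "\<dots> = w x t s + ennreal (f' v * v)"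
            unfolding w_def using frac_heat_kernel_mass[OF \<theta> ts, of x] by (simp add: nn_integral_add nn_integral_multc)
          finally have "ennreal (f' v * v) + ennreal (f v) \<le> ennreal (f' v * v) + w x t s"
            using p0 v0 by (simp add: ennreal_mult add.commute)
          then show "ennreal (f (h + enn2real (\<integral>\<^sup>+ r \<in> {0<..<s}. w x t r \<partial>lborel))) \<le> w x t s"
            by (simp add: ennreal_add_left_cancel_le v_def A_def)
        qed
      qed
    qed
    then show ?thesis using Hh h0 by blast
  qed
  show ?thesis
    using good
  proof eventually_elim
    case (elim z)
    show ?case using key[of "fst z" "snd z"] elim unfolding H_def by auto
  qed
qed

text \<open>Jensen's inequality for the convex function \<open>a \<mapsto> F\<^bsup>-1\<^esup>(a\<^sup>2)\<close>: unlike \<open>F\<^bsup>-1\<^esup>(|x|\<^sup>\<theta>)\<close>, it only involves the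
  moment of order \<open>\<theta>/2\<close> of the kernel, which is finite.\<close>
lemma heat_average_ge:
  fixes \<mu> :: "'a::euclidean_space \<Rightarrow> real"
  assumes \<theta>: "0 < \<theta>" "\<theta> \<le> 2" and \<mu>[measurable]: "\<mu> \<in> borel_measurable borel" and \<mu>0: "\<And>x. 0 \<le> \<mu> x"
    and U: "\<tau>0 < U" "\<And>u v. U \<le> u \<Longrightarrow> u \<le> v \<Longrightarrow> f u * F u powr (1 / 2) \<le> f v * F v powr (1 / 2)"
    and e: "0 < e" and low: "\<And>x. x \<noteq> 0 \<Longrightarrow> e * norm x powr \<theta> \<le> F U \<Longrightarrow> \<tau>0 < \<mu> x \<and> F (\<mu> x) \<le> e * norm x powr \<theta>"
    and t: "0 < t" and C: "0 < C"
    and mom: "(\<integral>\<^sup>+y. ennreal (frac_heat_kernel \<theta> (x - y) t) * ennreal (norm y powr (\<theta> / 2)) \<partial>lborel) \<le> ennreal (C * sqrt t)"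
    and v: "U \<le> v" "F v = e * C\<^sup>2 * t"
  shows "ennreal v \<le> (\<integral>\<^sup>+ y. ennreal (frac_heat_kernel \<theta> (x - y) t) * ennreal (\<mu> y) \<partial>lborel) + ennreal (U / sqrt (F U) * sqrt (e * C\<^sup>2 * t))"
proof -
  let ?k = "\<lambda>x t. ennreal (frac_heat_kernel \<theta> (x::'a) t)"
  \<comment> \<open>In this variable the assumption near the origin reads F(\<mu>) \<le> a^2. It
    holds up to the level a = a0, where a^2 = F U, and A bounds the kernel average of a.\<close>
  define a where "a = (\<lambda>y::'a. sqrt e * norm y powr (\<theta> / 2))"
  define a0 where "a0 = sqrt (F U)"
  define A where "A = sqrt e * (C * sqrt t)"
  \<comment> \<open>-P is the slope at a = A of the function F^(-1)(a^2), whose value there is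
    v.\<close>
  define P where "P = 2 * (f v * F v powr (1 / 2))"
  have FU: "0 < F U" by (rule F_pos[OF U(1)])
  have a0: "0 < a0" using FU by (simp add: a0_def)
  have U0: "0 < U" using U \<tau>0 by simp
  have v0: "\<tau>0 < v" "0 < v" using U v \<tau>0 by auto
  have P0: "0 < P" using f_pos[OF v0(2)] F_pos[OF v0(1)] by (simp add: P_def)
  have A0: "0 \<le> A" using e C t by (simp add: A_def)
  have A: "A = sqrt (e * C\<^sup>2 * t)" using C by (simp add: A_def real_sqrt_mult)
  have Fv: "F v powr (1 / 2) = A" using F_pos[OF v0(1)] by (simp add: A v(2) powr_half_sqrt)
  have a_nn: "0 \<le> a y" for y using e by (simp add: a_def)
  have a2: "(a y)\<^sup>2 = e * norm y powr \<theta>" for y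
  proof -
    have "(norm y powr (\<theta> / 2))\<^sup>2 = norm y powr \<theta>" by (simp add: power2_eq_square flip: powr_add)
    then show ?thesis using e by (simp add: a_def power_mult_distrib)
  qed
  \<comment> \<open>Near the origin this is the tangent inequality. Where a > a0 only \<mu> \<ge> 0
    is known; the tangent at a0 is at most U, and U \<le> (U/a0) a. Adding that term everywhere
    gives one inequality, at the cost of an error (U/a0) A = O(\<surd>t).\<close>
  have pt: "v + P * A \<le> \<mu> y + (U / a0 + P) * a y" if y: "y \<noteq> 0" for y
  proof (cases "a y \<le> a0")
    case True
    then have "(a y)\<^sup>2 \<le> a0\<^sup>2" using a_nn by (intro power_mono) auto
    then have le: "e * norm y powr \<theta> \<le> F U" using FU by (simp add: a2 a0_def)
    have \<mu>y: "\<tau>0 < \<mu> y" "F (\<mu> y) \<le> (a y)\<^sup>2" using low[OF y le] by (auto simp: a2)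
    have "U \<le> \<mu> y" using \<mu>y le F_le_iff[OF U(1) \<mu>y(1)] by (simp add: a2)
    then have "P * (F v powr (1 / 2) - F (\<mu> y) powr (1 / 2)) \<le> \<mu> y - v"
      unfolding P_def using U v by (intro sqrt_F_above_tangent) auto
    moreover have "F (\<mu> y) powr (1 / 2) \<le> a y"
      using \<mu>y F_pos[OF \<mu>y(1)] a_nn[of y] by (simp add: powr_half_sqrt real_le_lsqrt)
    then have "P * F (\<mu> y) powr (1 / 2) \<le> P * a y" using P0 by (intro mult_left_mono) auto
    moreover have "0 \<le> U / a0 * a y" using U0 a0 a_nn by simp
    ultimately show ?thesis by (simp add: Fv algebra_simps)
  next
    case False
    have "P * (F v powr (1 / 2) - F U powr (1 / 2)) \<le> U - v"
      unfolding P_def using U v by (intro sqrt_F_above_tangent) auto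
    moreover have "F U powr (1 / 2) = a0" using FU by (simp add: a0_def powr_half_sqrt)
    moreover have "P * a0 \<le> P * a y" using P0 False by (intro mult_left_mono) auto
    moreover have "U \<le> U / a0 * a y" using False a0 U0 by (simp add: field_simps)
    ultimately show ?thesis using \<mu>0[of y] by (simp add: Fv algebra_simps)
  qed
  have am[measurable]: "a \<in> borel_measurable borel" unfolding a_def by measurable
  let ?S = "\<integral>\<^sup>+ y. ?k (x - y) t * ennreal (\<mu> y) \<partial>lborel"
  have UP: "0 \<le> U / a0 + P" using U0 a0 P0 by simp
  have aA: "(\<integral>\<^sup>+ y. ?k (x - y) t * ennreal (a y) \<partial>lborel) \<le> ennreal A"
  proof -
    have "(\<integral>\<^sup>+ y. ?k (x - y) t * ennreal (a y) \<partial>lborel) = ennreal (sqrt e) * (\<integral>\<^sup>+ y. ?k (x - y) t * ennreal (norm y powr (\<theta> / 2)) \<partial>lborel)"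
      using e by (subst nn_integral_cmult[symmetric]) (auto simp: a_def ennreal_mult mult.left_commute)
    also have "\<dots> \<le> ennreal (sqrt e) * ennreal (C * sqrt t)" by (intro mult_left_mono mom) simp
    also have "\<dots> = ennreal A" using e C t by (simp add: A_def ennreal_mult)
    finally show ?thesis .
  qed
  have "ennreal (v + P * A) = (\<integral>\<^sup>+ y. ?k (x - y) t * ennreal (v + P * A) \<partial>lborel)"
    using frac_heat_kernel_mass[OF \<theta> t, of x] by (simp add: nn_integral_multc)
  also have "\<dots> \<le> (\<integral>\<^sup>+ y. ?k (x - y) t * ennreal (\<mu> y) + ennreal (U / a0 + P) * (?k (x - y) t * ennreal (a y)) \<partial>lborel)"
  proof (rule nn_integral_mono_AE)
    show "AE y in lborel. ?k (x - y) t * ennreal (v + P * A) \<le> ?k (x - y) t * ennreal (\<mu> y) + ennreal (U / a0 + P) * (?k (x - y) t * ennreal (a y))"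
      using AE_lborel_singleton[of "0::'a"]
    proof eventually_elim
      case (elim y)
      have "?k (x - y) t * ennreal (v + P * A) \<le> ?k (x - y) t * ennreal (\<mu> y + (U / a0 + P) * a y)"
        by (intro mult_left_mono ennreal_leI pt elim) simp
      also have "ennreal (\<mu> y + (U / a0 + P) * a y) = ennreal (\<mu> y) + ennreal (U / a0 + P) * ennreal (a y)"
        using \<mu>0[of y] UP a_nn[of y] by (subst ennreal_plus) (auto simp: ennreal_mult)
      finally show ?case by (simp add: distrib_left mult.left_commute)
    qed
  qed
  also have "\<dots> = ?S + ennreal (U / a0 + P) * (\<integral>\<^sup>+ y. ?k (x - y) t * ennreal (a y) \<partial>lborel)"
    by (simp add: nn_integral_add nn_integral_cmult)
  also have "\<dots> \<le> ?S + ennreal (U / a0 + P) * ennreal A" by (intro add_left_mono mult_left_mono aA) simp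
  also have "ennreal (U / a0 + P) * ennreal A = ennreal (P * A) + ennreal (U / a0 * A)"
    using UP A0 P0 U0 a0 by (simp add: ennreal_mult[symmetric] ennreal_plus[symmetric] algebra_simps del: ennreal_plus)
  finally have "ennreal (P * A) + ennreal v \<le> ennreal (P * A) + (?S + ennreal (U / a0 * A))"
    using v0 P0 A0 by (simp add: ennreal_plus ac_simps)
  then have "ennreal v \<le> ?S + ennreal (U / a0 * A)" by (simp add: ennreal_add_left_cancel_le)
  then show ?thesis by (simp add: A a0_def)
qed

text \<open>A solution forces h = S(t)\<mu>(x) \<le> vt = F^(-1)(t), while averaging gives h \<ge>
  v0 - O(\<surd>t) with F v0 \<le> t/2. As v0 - vt \<ge> f(vt) t/2, the product f(vt) \<surd>t = f
  F^(1/2) at vt would stay bounded as t tends to 0.\<close>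

lemma not_locally_solvable_of_F_le:
  assumes \<theta>: "0 < \<theta>" "\<theta> \<le> 2"
  shows "\<exists>e0>0. \<forall>e U. \<forall>\<mu>::'a::euclidean_space \<Rightarrow> real. 0 < e \<longrightarrow> e \<le> e0 \<longrightarrow> \<tau>0 < U \<longrightarrow> \<mu> \<in> borel_measurable borel \<longrightarrow> (\<forall>x. 0 \<le> \<mu> x) \<longrightarrow>
     (\<forall>x. x \<noteq> 0 \<longrightarrow> e * norm x powr \<theta> \<le> F U \<longrightarrow> \<tau>0 < \<mu> x \<and> F (\<mu> x) \<le> e * norm x powr \<theta>) \<longrightarrow> \<not> locally_solvable \<theta> f \<mu>"
proof -
  let ?k = "\<lambda>x t. ennreal (frac_heat_kernel \<theta> (x::'a) t)"
  obtain C where C: "C > 0" and mom: "\<And>t x. t > 0 \<Longrightarrow> norm x \<le> t powr (1 / \<theta>) \<Longrightarrow>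
     (\<integral>\<^sup>+y. ?k (x - y) t * ennreal (norm y powr (\<theta> / 2)) \<partial>lborel) \<le> ennreal (C * sqrt t)"
    using frac_heat_kernel_half_moment[OF \<theta>, where 'a='a] by blast
  \<comment> \<open>Makes e C^2 \<le> 1/2, so that F v0 = e C^2 t is at most half of F vt =
    t.\<close>
  define e0 where "e0 = 1 / (2 * C\<^sup>2)"
  have "e0 > 0" using C by (simp add: e0_def)
  moreover have False
    if e: "0 < e" "e \<le> e0" and U: "\<tau>0 < U" and \<mu>[measurable]: "\<mu> \<in> borel_measurable borel" and \<mu>0: "\<And>x. 0 \<le> \<mu> x"
      and low: "\<And>x. x \<noteq> 0 \<Longrightarrow> e * norm x powr \<theta> \<le> F U \<Longrightarrow> \<tau>0 < \<mu> x \<and> F (\<mu> x) \<le> e * norm x powr \<theta>"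
      and solv: "locally_solvable \<theta> f \<mu>" for e U and \<mu> :: "'a \<Rightarrow> real"
  proof -
    obtain T u where T: "T > 0" and sol: "she_solution \<theta> f \<mu> T u" using solv by (auto simp: locally_solvable_def)
    obtain Ua where Ua: "Ua > \<tau>0" "\<And>v w. Ua \<le> v \<Longrightarrow> 0 \<le> w \<Longrightarrow> f v + f' v * w \<le> f w + f' v * v"
      using f_above_tangent by blast
    obtain Ub where Ub: "Ub > \<tau>0" "\<And>u. Ub \<le> u \<Longrightarrow> 1 / 2 < f' u * F u"
      using f'F_eventually[of "1 / 2" "q + 1"] q by auto
    define W where "W = max U (max Ua Ub)"
    have W: "\<tau>0 < W" "U \<le> W" "Ua \<le> W" "Ub \<le> W" using U by (auto simp: W_def)
    have W0: "0 < W" using W \<tau>0 by simp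
    have inc: "f u * F u powr (1 / 2) \<le> f v * F v powr (1 / 2)" if "W \<le> u" "u \<le> v" for u v
      using that W Ub(2) by (intro fF_mono_of_le[OF W(1)]) (auto intro!: less_imp_le)
    have FW: "0 < F W" by (rule F_pos[OF W(1)])
    have lowW: "\<tau>0 < \<mu> x \<and> F (\<mu> x) \<le> e * norm x powr \<theta>" if "x \<noteq> 0" "e * norm x powr \<theta> \<le> F W" for x
      using low[OF that(1)] that(2) F_antimono[OF U W(2)] by simp
    \<comment> \<open>Twice the constant of the error term in \<open>heat_average_ge\<close>; the 2
      comes from the half in f(vt) t/2.\<close>
    define M where "M = 2 * W / sqrt (F W)"
    have "\<forall>\<^sub>F v in at_top. M < f v * F v powr (1 / 2)"
      using fF_half_at_top by (simp add: filterlim_at_top_dense)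
    then obtain V where V: "\<And>v. V \<le> v \<Longrightarrow> M < f v * F v powr (1 / 2)" by (auto simp: eventually_at_top_linorder)
    define V1 where "V1 = max V W"
    have V1: "\<tau>0 < V1" "V \<le> V1" "W \<le> V1" using W by (auto simp: V1_def)
    define t1 where "t1 = min T (F V1)"
    have t1: "0 < t1" using T F_pos[OF V1(1)] by (simp add: t1_def)
    \<comment> \<open>An open set inside the region |x| \<le> t^(1/\<theta>), t < t1, from which a
      point outside the exceptional null set can be picked.\<close>
    define S where "S = ball (0::'a) ((t1 / 2) powr (1 / \<theta>)) \<times> {t1 / 2<..<t1}"
    have "open S" unfolding S_def by (intro open_Times) auto
    moreover have "(0, 3 * t1 / 4) \<in> S" using t1 by (simp add: S_def)
    then have "S \<noteq> {}" by blast
    moreover have tangentW: "f v + f' v * w \<le> f w + f' v * v" if "W \<le> v" "0 \<le> w" for v w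
      using Ua(2) that W(3) by simp
    note solution_imp_time_le_F[OF \<theta> \<mu> W(1) tangentW sol]
    ultimately obtain p where p: "p \<in> S" "0 < snd p \<and> snd p < T \<longrightarrow>
      (\<exists>h\<ge>0. (\<integral>\<^sup>+ y. ?k (fst p - y) (snd p) * ennreal (\<mu> y) \<partial>lborel) = ennreal h \<and> (W \<le> h \<longrightarrow> snd p \<le> F h))"
      using ex_in_open_of_AE_lborel by blast
    define x t where "x = fst p" and "t = snd p"
    have t: "0 < t" "t < t1" "t < T" and x: "norm x \<le> t powr (1 / \<theta>)"
    proof -
      have xt: "norm x < (t1 / 2) powr (1 / \<theta>)" "t1 / 2 < t" "t < t1" using p(1) by (auto simp: S_def x_def t_def)
      then show "0 < t" "t < t1" "t < T" using t1 by (auto simp: t1_def)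
      have "(t1 / 2) powr (1 / \<theta>) \<le> t powr (1 / \<theta>)" using xt t1 \<theta> by (intro powr_mono2) auto
      then show "norm x \<le> t powr (1 / \<theta>)" using xt by simp
    qed
    obtain h where h: "0 \<le> h" "(\<integral>\<^sup>+ y. ?k (x - y) t * ennreal (\<mu> y) \<partial>lborel) = ennreal h" "W \<le> h \<Longrightarrow> t \<le> F h"
      using p(2) t by (auto simp: x_def t_def)
    have tF: "t \<le> F V1" using t by (simp add: t1_def)
    have ec: "e * C\<^sup>2 \<le> 1 / 2"
    proof -
      have "e * C\<^sup>2 \<le> e0 * C\<^sup>2" using e by (intro mult_right_mono) auto
      then show ?thesis using C by (simp add: e0_def)
    qed
    obtain vt where vt: "V1 \<le> vt" "F vt = t" using F_onto[OF V1(1) t(1) tF] by auto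
    have d: "0 < e * C\<^sup>2 * t" "e * C\<^sup>2 * t \<le> t / 2"
      using e C t mult_right_mono[OF ec, of t] by auto
    then have "e * C\<^sup>2 * t \<le> F vt" using vt(2) t by simp
    then obtain v0 where v0: "vt \<le> v0" "F v0 = e * C\<^sup>2 * t"
      using F_onto[of vt "e * C\<^sup>2 * t"] d V1 vt by auto
    have vt0: "\<tau>0 < vt" "0 < vt" using vt V1 \<tau>0 by auto
    have hvt: "h \<le> vt"
    proof (cases "W \<le> h")
      case True
      then have "F vt \<le> F h" using h(3) vt by simp
      then show ?thesis using F_le_iff[of h vt] True W vt0 by simp
    qed (use vt V1 in auto)
    have "ennreal v0 \<le> ennreal h + ennreal (W / sqrt (F W) * sqrt (e * C\<^sup>2 * t))"
      unfolding h(2)[symmetric]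
      by (rule heat_average_ge[OF \<theta> \<mu> \<mu>0 W(1) inc e(1) lowW t(1) C mom[OF t(1) x] _ v0(2)]) (use v0 vt V1 in auto)
    then have "ennreal v0 \<le> ennreal (h + W / sqrt (F W) * sqrt (e * C\<^sup>2 * t))"
      using h W0 FW d by (subst ennreal_plus) auto
    then have "v0 \<le> h + W / sqrt (F W) * sqrt (e * C\<^sup>2 * t)"
      using h W0 FW d by (subst (asm) ennreal_le_iff) auto
    also have "\<dots> \<le> vt + W / sqrt (F W) * sqrt t"
      using hvt W0 FW d t by (intro add_mono mult_left_mono) auto
    finally have up: "v0 - vt \<le> W / sqrt (F W) * sqrt t" by simp
    \<comment> \<open>F is convex because f is nondecreasing: its tangent at vt has slope -1/f(vt),
      and F drops by at least t/2 between vt and v0.\<close>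
    have "f vt * (t / 2) \<le> v0 - vt"
    proof -
      have "F vt + - (1 / f vt) * (v0 - vt) \<le> F v0"
      proof (rule above_tangent_of_mono_deriv[where U = vt])
        show "(F has_real_derivative - (1 / f u)) (at u)" if "vt \<le> u" for u using that vt0 by (intro F_deriv) simp
        show "- (1 / f u) \<le> - (1 / f v)" if "vt \<le> u" "u \<le> v" for u v
        proof -
          have "f u \<le> f v" "0 < f u" using that vt0 by (auto intro!: mono_onD[OF f_mono] f_pos)
          then show ?thesis by (simp add: frac_le)
        qed
      qed (use v0 in auto)
      then have "t - (v0 - vt) / f vt \<le> e * C\<^sup>2 * t" using vt v0 by simp
      then have "t / 2 \<le> (v0 - vt) / f vt" using d(2) by linarith
      then show ?thesis using f_pos[OF vt0(2)] by (simp add: pos_le_divide_eq mult.commute)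
    qed
    then have "f vt * (t / 2) \<le> W / sqrt (F W) * sqrt t" using up by (rule order_trans)
    moreover have "(f vt * sqrt t) * sqrt t = f vt * t" using t by (simp add: mult.assoc)
    moreover have "M * sqrt t = 2 * (W / sqrt (F W) * sqrt t)" by (simp add: M_def)
    ultimately have "(f vt * sqrt t) * sqrt t \<le> M * sqrt t" by linarith
    then have "f vt * sqrt t \<le> M" using t by simp
    moreover have "M < f vt * F vt powr (1 / 2)" using vt(1) V1(2) by (intro V) simp
    ultimately show False using vt t by (simp add: powr_half_sqrt)
  qed
  ultimately show ?thesis by blast
qed

end

section \<open>The critical dilation\<close>

text \<open>For q different from 1 the conjugate exponent is 1 + 1/(q - 1), so the condition reads
  1/(q - 1) > \<theta>/n > 0, which excludes q < 1.\<close>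

lemma supercritical_exponent:
  fixes q \<theta> n :: real
  assumes "0 < \<theta>" "0 < n" "p_of_q q > ereal (1 + \<theta> / n)"
  shows "1 \<le> q" "q - 1 < n / \<theta>"
proof -
  have *: "1 \<le> q \<and> q - 1 < n / \<theta>"
  proof (cases "q = 1")
    case False
    then have gt: "1 + \<theta> / n < q / (q - 1)" using assms by (simp add: p_of_q_def)
    also have "q / (q - 1) = 1 + 1 / (q - 1)" using False by (simp add: field_simps)
    finally have i: "\<theta> / n < 1 / (q - 1)" by simp
    have "0 < \<theta> / n" using assms by simp
    then have "0 < 1 / (q - 1)" using i by (rule less_trans)
    then have q1: "0 < q - 1" by (simp add: zero_less_divide_iff)
    then show ?thesis using i assms by (simp add: field_simps)
  qed (use assms in simp)
  then show "1 \<le> q" "q - 1 < n / \<theta>" by auto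
qed

lemma powr_less_iff_base:
  fixes p x y :: real
  assumes "0 < p" "0 < x" "0 < y"
  shows "x powr p < y powr p \<longleftrightarrow> x < y"
  using assms powr_less_mono2[of p x y] powr_mono2[of p y x] by force

text \<open>Wherever \<psi>(s) < B, monotonicity of \<phi> gives s \<le> D \<phi>(B), so s cannot be
  large.\<close>

lemma eventually_ge_of_asymp:
  fixes \<phi> \<psi> :: "real \<Rightarrow> real"
  assumes \<phi>: "mono_on {0..} \<phi>" and \<psi>: "\<And>s. 0 \<le> s \<Longrightarrow> 0 \<le> \<psi> s"
    and D: "\<And>s. L \<le> s \<Longrightarrow> s \<le> D * \<phi> (\<psi> s)" "0 < D" and L: "0 < L" and B: "0 \<le> B"
  shows "\<exists>s0\<ge>L. \<forall>s\<ge>s0. B \<le> \<psi> s"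
proof (intro exI[of _ "max L (D * \<phi> B + 1)"] conjI allI impI)
  fix s assume s: "max L (D * \<phi> B + 1) \<le> s"
  show "B \<le> \<psi> s"
  proof (rule ccontr)
    assume "\<not> B \<le> \<psi> s"
    then have "\<phi> (\<psi> s) \<le> \<phi> B" using \<psi>[of s] s L B by (intro mono_onD[OF \<phi>]) auto
    then have "D * \<phi> (\<psi> s) \<le> D * \<phi> B" using D(2) by simp
    then show False using D(1)[of s] s by simp
  qed
qed simp

text \<open>Everything about \<phi> is condensed into a two-sided linear bound on 1/F(\<psi>(s)):
  the upper constant b serves existence, the lower constant a nonexistence.\<close>

lemma (in nonlinearity) G_comp_asymp:
  assumes \<phi>: "mono_on {0..} \<phi>" and \<psi>: "\<And>s. 0 \<le> s \<Longrightarrow> 0 \<le> \<psi> s"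
    and "asymp_equiv \<phi> (G_fun f)" "asymp_equiv (\<phi> \<circ> \<psi>) id"
  obtains a b L where "0 < a" "0 < b" "0 < L"
    "\<And>s. L \<le> s \<Longrightarrow> \<tau>0 < \<psi> s \<and> a * s \<le> 1 / F (\<psi> s) \<and> 1 / F (\<psi> s) \<le> b * s"
proof -
  obtain C1 C2 L1 where C: "0 < C1" "0 < C2" "0 < L1" "\<And>u. L1 \<le> u \<Longrightarrow> C1 * \<phi> u \<le> G_fun f u \<and> G_fun f u \<le> C2 * \<phi> u"
    using assms(3) by (auto simp: asymp_equiv_def)
  obtain D1 D2 L2 where D: "0 < D1" "0 < D2" "0 < L2" "\<And>s. L2 \<le> s \<Longrightarrow> D1 * \<phi> (\<psi> s) \<le> s \<and> s \<le> D2 * \<phi> (\<psi> s)"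
    using assms(4) by (auto simp: asymp_equiv_def)
  have "\<exists>L\<ge>L2. \<forall>s\<ge>L. max L1 (\<tau>0 + 1) \<le> \<psi> s"
    using D C(3) by (intro eventually_ge_of_asymp[OF \<phi> \<psi>, where D = D2]) auto
  then obtain L where L: "L2 \<le> L" "\<And>s. L \<le> s \<Longrightarrow> max L1 (\<tau>0 + 1) \<le> \<psi> s" by blast
  show ?thesis
  proof (rule that[of "C1 / D2" "C2 / D1" L])
    fix s assume s: "L \<le> s"
    then have \<psi>s: "L1 \<le> \<psi> s" "\<tau>0 < \<psi> s" using L(2)[of s] by auto
    have G: "G_fun f (\<psi> s) = 1 / F (\<psi> s)" using \<psi>s \<tau>0 by (simp add: G_fun_def)
    have Ds: "D1 * \<phi> (\<psi> s) \<le> s" "s \<le> D2 * \<phi> (\<psi> s)" using D(4)[of s] s L by auto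
    have "C1 / D2 * s \<le> C1 * \<phi> (\<psi> s)" using Ds D C by (simp add: field_simps)
    moreover have "C2 * \<phi> (\<psi> s) \<le> C2 / D1 * s" using Ds D C by (simp add: field_simps)
    ultimately show "\<tau>0 < \<psi> s \<and> C1 / D2 * s \<le> 1 / F (\<psi> s) \<and> 1 / F (\<psi> s) \<le> C2 / D1 * s"
      using C(4)[OF \<psi>s(1)] \<psi>s(2) unfolding G by auto
  qed (use C D L in auto)
qed

theorem theorem1p2:
  fixes f f' \<phi> \<psi> :: "real \<Rightarrow> real" and \<theta> \<tau>0 \<tau>1 q :: real
  assumes theta: "0 < \<theta>" "\<theta> \<le> 2"
    and f_range: "\<forall>u \<ge> 0. 0 \<le> f u"
    (* (M) *)
    and M_cont: "continuous_on {0..} f"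
    and M_mono: "mono_on {0..} f"
    and M_pos: "\<forall>u > 0. 0 < f u"
    (* (S) *)
    and S_tau0: "0 < \<tau>0"
    and S_deriv: "\<forall>u \<ge> \<tau>0. (f has_real_derivative f' u) (at u within {\<tau>0..})"
    and S_C1: "continuous_on {\<tau>0..} f'"
    and S_int: "(\<integral>\<^sup>+ s \<in> {\<tau>0..}. ennreal (1 / f s) \<partial>lborel) < \<infinity>"
    (* (C) *)
    and C_tau1: "0 \<le> \<tau>1"
    and C_convex: "convex_on {\<tau>1..} f"
    (* (L) *)
    and L_lim: "((\<lambda>u. f' u * F_fun f u) \<longlongrightarrow> q) at_top"
    (* supercritical *)
    and supercrit: "p_of_q q > ereal (1 + \<theta> / real DIM('a::euclidean_space))"
    (* phi, psi *)
    and phi_range: "\<forall>u \<ge> 0. 0 \<le> \<phi> u" and phi_mono: "mono_on {0..} \<phi>"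
    and psi_range: "\<forall>u \<ge> 0. 0 \<le> \<psi> u" and psi_mono: "mono_on {0..} \<psi>"
    and phi_G: "asymp_equiv \<phi> (G_fun f)"
    and phi_psi: "asymp_equiv (\<phi> \<circ> \<psi>) id"
  shows "\<exists>!l0. 0 < l0 \<and>
           dilation_critical \<theta> f (\<lambda>x::'a. \<psi> (l0 * norm x powr (- \<theta>)))"
proof -
  have N: "0 < real DIM('a)" by simp
  note sup = supercritical_exponent[OF theta(1) N supercrit]
  interpret nonlinearity f f' \<tau>0 \<tau>1 q
    by unfold_locales
       (use f_range M_cont M_mono M_pos S_tau0 S_deriv S_int C_tau1 C_convex L_lim sup(1) in auto)
  have \<psi>0: "\<And>s. 0 \<le> s \<Longrightarrow> 0 \<le> \<psi> s" using psi_range by simp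
  obtain a b L where ab: "0 < a" "0 < b" and L: "0 < L"
    and GL: "\<And>s. L \<le> s \<Longrightarrow> \<tau>0 < \<psi> s \<and> a * s \<le> 1 / F (\<psi> s) \<and> 1 / F (\<psi> s) \<le> b * s"
    using G_comp_asymp[OF phi_mono \<psi>0 phi_G phi_psi] by blast
  define \<mu> :: "real \<Rightarrow> 'a \<Rightarrow> real" where "\<mu> = (\<lambda>l x. \<psi> (l * norm x powr - \<theta>))"
  have \<psi>_le: "\<psi> s \<le> \<psi> s'" if "0 \<le> s" "s \<le> s'" for s s'
    using that by (intro mono_onD[OF psi_mono]) auto
  have \<mu>_nonneg: "0 \<le> \<mu> l x" if "0 < l" for l x using that \<psi>0 by (simp add: \<mu>_def)
  have \<mu>_meas: "\<mu> l \<in> borel_measurable borel" if "0 < l" for l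
  proof -
    have [measurable]: "(\<lambda>s. \<psi> (max 0 s)) \<in> borel_measurable borel"
      by (rule borel_measurable_mono) (auto intro!: monoI \<psi>_le)
    have "(\<lambda>x::'a. \<psi> (max 0 (l * norm x powr - \<theta>))) \<in> borel_measurable borel" by measurable
    then show ?thesis using that by (simp add: \<mu>_def max_absorb2)
  qed
  have \<mu>_mono: "\<mu> l x \<le> \<mu> l' x" if "0 < l" "l \<le> l'" for l l' x
    unfolding \<mu>_def using that by (intro \<psi>_le mult_right_mono) auto
  \<comment> \<open>Above the level \<psi> L the argument of \<psi> must exceed L. This also covers
    x = 0, where \<open>norm x powr - \<theta>\<close> is 0 and the datum equals \<psi> 0 \<le>
    U.\<close>
  define U where "U = max (\<tau>0 + 1) (\<psi> L)"
  have U: "\<tau>0 < U" by (simp add: U_def)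
  have upper: "1 / F (\<mu> l x) \<le> (b * l) * norm x powr - \<theta>" if "0 < l" "U < \<mu> l x" for l x
  proof -
    have "L \<le> l * norm x powr - \<theta>"
    proof (rule ccontr)
      assume "\<not> L \<le> l * norm x powr - \<theta>"
      then have "\<mu> l x \<le> \<psi> L" unfolding \<mu>_def using that by (intro \<psi>_le) auto
      then show False using that by (simp add: U_def)
    qed
    then show ?thesis using GL by (simp add: \<mu>_def mult.assoc)
  qed
  \<comment> \<open>The bound on F W translates smallness of |x|^\<theta>/(a l) into l
    |x|^(-\<theta>) \<ge> L, where the asymptotic comparison holds.\<close>
  obtain W where W: "\<tau>0 < W" "F W \<le> 1 / (a * L)"
  proof -
    have "\<forall>\<^sub>F v in at_top. F v < 1 / (a * L) \<and> \<tau>0 + 1 \<le> v"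
      using ab L by (intro eventually_conj order_tendstoD(2)[OF F_tendsto_0] eventually_ge_at_top) simp
    then obtain v where "F v < 1 / (a * L)" "\<tau>0 + 1 \<le> v" by (auto dest!: eventually_happens)
    then show ?thesis by (intro that[of v]) auto
  qed
  have lower: "\<tau>0 < \<mu> l x \<and> F (\<mu> l x) \<le> 1 / (a * l) * norm x powr \<theta>"
    if l: "0 < l" and x: "x \<noteq> 0" "1 / (a * l) * norm x powr \<theta> \<le> F W" for l x
  proof -
    define s where "s = l * norm x powr - \<theta>"
    have s: "0 < s" "1 / (a * l) * norm x powr \<theta> = 1 / (a * s)" using l x by (auto simp: s_def powr_minus_divide)
    then have "1 / (a * s) \<le> 1 / (a * L)" using x W by simp
    then have "L \<le> s" using s ab L by (simp add: field_simps)
    then have *: "\<tau>0 < \<mu> l x" "a * s \<le> 1 / F (\<mu> l x)" using GL[of s] by (auto simp: \<mu>_def s_def)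
    then have "F (\<mu> l x) \<le> 1 / (a * s)" using F_pos[OF *(1)] ab s by (simp add: field_simps)
    then show ?thesis using * s by simp
  qed
  define A where "A = {l. 0 < l \<and> locally_solvable \<theta> f (\<mu> l)}"
  have A_down: "l \<in> A" if "l' \<in> A" "0 < l" "l \<le> l'" for l l'
    using that locally_solvable_mono[OF f_cont f_mono f_nonneg \<mu>_meas[of l] \<mu>_mono[of l l']] by (auto simp: A_def)
  obtain b0 where b0: "b0 > 0" and solvable: "\<And>b U \<nu>. 0 < b \<Longrightarrow> b \<le> b0 \<Longrightarrow> \<tau>0 < U \<Longrightarrow> \<nu> \<in> borel_measurable borel \<Longrightarrow> (\<forall>x::'a. 0 \<le> \<nu> x) \<Longrightarrow>
     (\<forall>x. U < \<nu> x \<longrightarrow> 1 / F (\<nu> x) \<le> b * norm x powr - \<theta>) \<Longrightarrow> locally_solvable \<theta> f \<nu>"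
    using locally_solvable_of_G_le[OF theta sup(2)] by blast
  \<comment> \<open>For l = b0/b the coefficient b l in \<open>upper\<close> is exactly the
    admissible b0.\<close>
  have A_ne: "b0 / b \<in> A"
  proof -
    have l: "0 < b0 / b" using b0 ab by simp
    have "locally_solvable \<theta> f (\<mu> (b0 / b))"
    proof (rule solvable[OF _ _ U \<mu>_meas[OF l]])
      show "\<forall>x. U < \<mu> (b0 / b) x \<longrightarrow> 1 / F (\<mu> (b0 / b) x) \<le> b * (b0 / b) * norm x powr - \<theta>"
        using upper[OF l] by blast
    qed (use b0 ab \<mu>_nonneg[OF l] in auto)
    then show ?thesis using l by (simp add: A_def)
  qed
  obtain e0 where e0: "e0 > 0" and unsolvable: "\<And>e U \<nu>. 0 < e \<Longrightarrow> e \<le> e0 \<Longrightarrow> \<tau>0 < U \<Longrightarrow> \<nu> \<in> borel_measurable borel \<Longrightarrow> (\<forall>x::'a. 0 \<le> \<nu> x) \<Longrightarrow>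
     (\<forall>x. x \<noteq> 0 \<longrightarrow> e * norm x powr \<theta> \<le> F U \<longrightarrow> \<tau>0 < \<nu> x \<and> F (\<nu> x) \<le> e * norm x powr \<theta>) \<Longrightarrow> \<not> locally_solvable \<theta> f \<nu>"
    using not_locally_solvable_of_F_le[OF theta, where 'a='a] by blast
  \<comment> \<open>Beyond 1/(a e0) the coefficient 1/(a l) in \<open>lower\<close> is at most
    e0.\<close>
  have A_bdd: "l \<le> 1 / (a * e0)" if "l \<in> A" for l
  proof (rule ccontr)
    assume "\<not> l \<le> 1 / (a * e0)"
    moreover have l: "0 < l" "locally_solvable \<theta> f (\<mu> l)" using that by (auto simp: A_def)
    ultimately have "1 / (a * l) \<le> e0" using ab e0 by (simp add: field_simps)
    then have "\<not> locally_solvable \<theta> f (\<mu> l)"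
      using lower[OF l(1)] \<mu>_nonneg[OF l(1)] ab l by (intro unsolvable[OF _ _ W(1) \<mu>_meas]) auto
    then show False using l by simp
  qed
  \<comment> \<open>At x = 0 both sides are \<psi> 0, since 0 powr anything is 0.\<close>
  have dil: "(\<lambda>x. \<mu> l ((1 / c) *\<^sub>R x)) = \<mu> (l * c powr \<theta>)" if "0 < c" for l c
    using that by (auto simp: \<mu>_def fun_eq_iff powr_divide powr_minus_divide)
  have crit_iff: "dilation_critical \<theta> f (\<mu> l) \<longleftrightarrow> (\<forall>m. 0 < m \<and> m < l \<longrightarrow> m \<in> A) \<and> (\<forall>m>l. m \<notin> A)"
    if l: "0 < l" for l
  proof -
    have inB: "in_B (\<mu> l)"
      unfolding in_B_def
    proof (intro conjI allI impI)
      show "\<mu> l \<in> borel_measurable lborel" using \<mu>_meas[OF l] by simp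
      fix r :: real assume r: "0 < r"
      have "\<bar>\<mu> l x\<bar> \<le> \<psi> (l * r powr - \<theta>)" if "r \<le> norm x" for x
      proof -
        have "norm x powr - \<theta> \<le> r powr - \<theta>" using that r theta by (intro powr_mono2') auto
        then have "\<mu> l x \<le> \<psi> (l * r powr - \<theta>)" unfolding \<mu>_def using l by (intro \<psi>_le) auto
        then show ?thesis using \<mu>_nonneg[OF l] by simp
      qed
      then show "\<exists>M. AE x in lborel. r \<le> norm x \<longrightarrow> \<bar>\<mu> l x\<bar> \<le> M" by (intro exI AE_I2) auto
    qed
    have int: "locally_integrable (\<mu> l)"
      using l ab upper[OF l] \<mu>_nonneg[OF l]
      by (intro locally_integrable_of_G_le[OF theta(1) sup(2) U, of "b * l"] \<mu>_meas) auto
    have scale: "\<exists>c>0. l * c powr \<theta> = m \<and> (c < 1 \<longleftrightarrow> m < l) \<and> (1 < c \<longleftrightarrow> l < m)" if m: "0 < m" for m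
    proof (intro exI[of _ "(m / l) powr (1 / \<theta>)"] conjI)
      have eq: "((m / l) powr (1 / \<theta>)) powr \<theta> = m / l" using theta l m by (simp add: powr_powr)
      then show "l * ((m / l) powr (1 / \<theta>)) powr \<theta> = m" using l by simp
      show "(m / l) powr (1 / \<theta>) < 1 \<longleftrightarrow> m < l"
        using powr_less_iff_base[of "1 / \<theta>" "m / l" 1] theta l m by simp
      show "1 < (m / l) powr (1 / \<theta>) \<longleftrightarrow> l < m"
        using powr_less_iff_base[of "1 / \<theta>" 1 "m / l"] theta l m by simp
    qed (use l m in simp)
    have pow: "0 < l * c powr \<theta> \<and> (l * c powr \<theta> < l \<longleftrightarrow> c < 1) \<and> (l < l * c powr \<theta> \<longleftrightarrow> 1 < c)" if "0 < c" for c
      using that l theta powr_less_iff_base[of \<theta> c 1] powr_less_iff_base[of \<theta> 1 c]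
      by (simp add: mult_less_cancel_left2 mult_less_cancel_left1)
    show ?thesis
    proof
      assume crit: "dilation_critical \<theta> f (\<mu> l)"
      show "(\<forall>m. 0 < m \<and> m < l \<longrightarrow> m \<in> A) \<and> (\<forall>m>l. m \<notin> A)"
      proof (intro conjI allI impI)
        fix m assume m: "0 < m \<and> m < l"
        then obtain c where c: "c > 0" "c < 1" "l * c powr \<theta> = m" using scale[of m] by auto
        have "locally_solvable \<theta> f (\<lambda>x. \<mu> l ((1 / c) *\<^sub>R x))"
          using crit c unfolding dilation_critical_def by blast
        then have "locally_solvable \<theta> f (\<mu> m)" unfolding dil[OF c(1)] c(3) .
        then show "m \<in> A" using m by (simp add: A_def)
      next
        fix m assume m: "l < m"
        then obtain c where c: "c > 0" "1 < c" "l * c powr \<theta> = m" using scale[of m] l by auto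
        have "\<not> locally_solvable \<theta> f (\<lambda>x. \<mu> l ((1 / c) *\<^sub>R x))"
          using crit c unfolding dilation_critical_def by blast
        then have "\<not> locally_solvable \<theta> f (\<mu> m)" unfolding dil[OF c(1)] c(3) .
        then show "m \<notin> A" by (simp add: A_def)
      qed
    next
      assume *: "(\<forall>m. 0 < m \<and> m < l \<longrightarrow> m \<in> A) \<and> (\<forall>m>l. m \<notin> A)"
      show "dilation_critical \<theta> f (\<mu> l)"
        unfolding dilation_critical_def
      proof (intro conjI allI impI)
        fix c :: real assume c: "0 < c \<and> c < 1"
        then have "l * c powr \<theta> \<in> A" using * pow[of c] by blast
        then show "locally_solvable \<theta> f (\<lambda>x. \<mu> l ((1 / c) *\<^sub>R x))" using dil[of c l] c by (simp add: A_def)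
      next
        fix c :: real assume c: "1 < c"
        then have "l * c powr \<theta> \<notin> A" "0 < l * c powr \<theta>" using * pow[of c] by auto
        then show "\<not> locally_solvable \<theta> f (\<lambda>x. \<mu> l ((1 / c) *\<^sub>R x))" using dil[of c l] c by (simp add: A_def)
      qed (use inB int \<mu>_nonneg[OF l] in auto)
    qed
  qed
  have bdd: "bdd_above A" using A_bdd by (rule bdd_aboveI)
  have pos: "0 < Sup A"
    by (rule less_le_trans[OF _ cSup_upper[OF A_ne bdd]]) (use b0 ab in simp)
  \<comment> \<open>A is an interval with endpoints 0 and Sup A. Criticality of l concerns only
    parameters strictly below and strictly above l, so it singles out Sup A whether or not Sup A
    belongs to A.\<close>
  have crit_Sup: "0 < l \<and> dilation_critical \<theta> f (\<mu> l) \<longleftrightarrow> l = Sup A" for l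
  proof
    assume l: "0 < l \<and> dilation_critical \<theta> f (\<mu> l)"
    then have below: "\<And>m. 0 < m \<Longrightarrow> m < l \<Longrightarrow> m \<in> A" and above: "\<And>m. m > l \<Longrightarrow> m \<notin> A"
      using crit_iff[of l] by auto
    show "l = Sup A"
    proof (rule antisym)
      show "Sup A \<le> l"
      proof (rule cSup_least)
        show "m \<le> l" if "m \<in> A" for m using above[of m] that by (cases "m \<le> l") auto
      qed (use A_ne in blast)
      show "l \<le> Sup A"
      proof (rule dense_le_bounded[of 0])
        show "m \<le> Sup A" if "0 < m" "m < l" for m using below[OF that] bdd by (intro cSup_upper)
      qed (use l in auto)
    qed
  next
    assume l: "l = Sup A"
    have "m \<in> A" if m: "0 < m" "m < Sup A" for m
    proof -
      obtain l' where "l' \<in> A" "m < l'" using less_cSupD[OF _ m(2)] A_ne by blast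
      then show ?thesis using A_down[of l' m] m by simp
    qed
    moreover have "m \<notin> A" if "m > Sup A" for m using cSup_upper[OF _ bdd, of m] that by auto
    ultimately show "0 < l \<and> dilation_critical \<theta> f (\<mu> l)" using crit_iff[OF pos] pos l by blast
  qed
  have "\<exists>!l. 0 < l \<and> dilation_critical \<theta> f (\<mu> l)"
    unfolding crit_Sup by simp
  then show ?thesis unfolding \<mu>_def .
qed

end
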